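(* Let $d\in\mathbb N$ and write points of $\mathbb R^d$ as $z=(x,t)\in\mathbb R^{d-1}\times\mathbb R$. Let $\kappa$ satisfy $\frac12\leq\kappa\leq1$ if $d\geq3$, and $\frac12<\kappa\leq1$ if $d=2$, and put $q=\frac{2d}{d-4+4\kappa}$. Then there is $C>0$ such that for all $u\in\mathcal S(\mathbb R^d)$ $$\|u\|_q\leq C\,\|\partial_{tt}u-\Delta u\|_2^{1-\kappa}\,\|u\|_2^{\kappa},$$ where $\Delta$ denotes the Laplacian in the variable $x\in\mathbb R^{d-1}$.
   Context: $\|\cdot\|_p$ denotes the $L^p(\mathbb R^d)$-norm; $x^0:=1$. *)

theory Defs
  imports "HOL-Analysis.Analysis"
begin

inductive_set partial_derivs :: "('a::euclidean_space \<Rightarrow> complex) \<Rightarrow> ('a \<Rightarrow> complex) set"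
  for u :: "'a \<Rightarrow> complex" where
  base: "u \<in> partial_derivs u"
| step: "f \<in> partial_derivs u \<Longrightarrow> b \<in> Basis \<Longrightarrow>
          (\<lambda>z. frechet_derivative f (at z) b) \<in> partial_derivs u"

definition schwartz :: "('a::euclidean_space \<Rightarrow> complex) \<Rightarrow> bool" where
  "schwartz u \<longleftrightarrow>
     (\<forall>f \<in> partial_derivs u.
        (\<forall>z. f differentiable (at z)) \<and>
        (\<forall>k::nat. \<exists>C. \<forall>z. norm z ^ k * norm (f z) \<le> C))"

definition Lnorm :: "real \<Rightarrow> ('a::euclidean_space \<Rightarrow> complex) \<Rightarrow> real" where
  "Lnorm p u = (\<integral>z. norm (u z) powr p \<partial>lborel) powr (1 / p)"

definition rpow :: "real \<Rightarrow> real \<Rightarrow> real" where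
  "rpow x a = (if a = 0 then 1 else x powr a)"

definition d2 :: "('a::euclidean_space \<Rightarrow> complex) \<Rightarrow> 'a \<Rightarrow> 'a \<Rightarrow> complex" where
  "d2 u v z = frechet_derivative (\<lambda>w. frechet_derivative u (at w) v) (at z) v"

definition wave :: "('a::euclidean_space \<times> real \<Rightarrow> complex) \<Rightarrow> 'a \<times> real \<Rightarrow> complex" where
  "wave u z = d2 u (0, 1) z - (\<Sum>b\<in>Basis. d2 u (b, 0) z)"

end

theory Submission
  imports Defs "HOL-Probability.Sinc_Integral"
begin

text \<open>With \<open>\<box>\<close> the wave operator, \<open>exp (is\<box>)\<close> is unitary on \<open>L\<^sup>2\<close> and maps \<open>L\<^sup>1\<close> to \<open>L\<^sup>\<infinity>\<close> with norm at
  most \<open>\<bar>s\<bar> powr (-d/2)\<close>, just as the Schroedinger group, so the estimate is a stationary form of the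
  endpoint Strichartz inequality of Keel and Tao. Averaging \<open>d/ds ((1 - s/T) exp (is\<box>) u)\<close> over
  \<open>[0, T]\<close> bounds \<open>\<integral> u f\<close> by \<open>\<parallel>u\<parallel> / T + \<parallel>\<box>u\<parallel>\<close> times the \<open>L\<^sup>2\<close> norm of time averages of \<open>exp (is\<box>) f\<close>.
  These are expanded over the dyadic level sets of \<open>u\<close>; the interaction of two levels is split into
  \<open>\<bar>s - s'\<bar> < R\<close> (Cauchy-Schwarz in \<open>L\<^sup>2\<close>) and \<open>\<bar>s - s'\<bar> \<ge> R\<close> (dispersion), which gives geometric
  off-diagonal decay and a summable double series. The group is regularised by a heat factor
  \<open>exp (\<epsilon>\<Delta>)\<close>, so that its kernel is an explicit Gaussian and no Fourier transform is needed.
  Choosing \<open>T = \<parallel>u\<parallel> / \<parallel>\<box>u\<parallel>\<close> ends the proof.\<close>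

text \<open>Interpolating the two bounds on the group, with the decay
  \<open>\<bar>s\<bar> powr (-\<gamma>)\<close> that is used throughout, gives an operator norm of
  1/|s| from the dual of L^q to L^q at q = 2\<gamma>/(\<gamma> - 1). This is exactly the power at
  which the Hardy-Littlewood-Sobolev inequality fails, so the double time integral cannot be
  estimated after interpolation. The order is therefore reversed: each pair of level sets is
  integrated in time with both bounds kept apart, cut at a lag adapted to the pair, and the exponent
  q appears only when the levels are summed. A level enters through two unrelated numbers, its
  height and the measure of its level set. The gain of a pair is a power of a ratio of measures and
  may exceed 1; only together with the geometric growth of the heights does it become decay in
  \<open>\<bar>k - l\<bar>\<close>. The signature of the operator leaves no trace in the estimates:
  every coordinate contributes a heat factor whose complex time \<zeta> has the same modulus,
  whatever the sign.\<close>

section \<open>Bounded integrable functions and curves of such functions\<close>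

text \<open>Boundedness is pointwise rather than essential, so the class is closed under products
  and lies in L^2; every pairing below is then the integral of an integrable function.\<close>

definition L1_bdd :: "('a::euclidean_space \<Rightarrow> complex) \<Rightarrow> bool" where
  "L1_bdd f \<longleftrightarrow> integrable lborel f \<and> (\<exists>B. \<forall>z. norm (f z) \<le> B)"

definition l2sq :: "('a::euclidean_space \<Rightarrow> complex) \<Rightarrow> real" where
  "l2sq f = (LBINT z. (norm (f z))\<^sup>2)"

lemma l2sq_nonneg [simp]: "0 \<le> l2sq f"
  by (simp add: l2sq_def)

lemma L1_bddI:
  assumes "f \<in> borel_measurable borel" "integrable lborel G" "\<And>z. norm (f z) \<le> G z" "\<And>z. norm (f z) \<le> B"
  shows "L1_bdd f"
  unfolding L1_bdd_def
proof
  show "integrable lborel f"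
  proof (rule Bochner_Integration.integrable_bound[OF assms(2)])
    show "AE x in lborel. norm (f x) \<le> norm (G x)"
      using assms(3) by (auto intro!: AE_I2 order_trans[OF _ abs_ge_self])
  qed (use assms in simp)
qed (use assms in blast)

lemma L1_bdd_bound:
  assumes "L1_bdd f"
  obtains B where "0 < B" "\<And>z. norm (f z) \<le> B"
proof -
  obtain B where "\<forall>z. norm (f z) \<le> B" using assms by (auto simp: L1_bdd_def)
  then have "norm (f z) \<le> max 1 B" for z by (meson max.coboundedI2)
  then show thesis using that[of "max 1 B"] by simp
qed

lemma L1_bdd_integrable: "L1_bdd f \<Longrightarrow> integrable lborel f"
  by (simp add: L1_bdd_def)

lemma L1_bdd_measurable: "L1_bdd f \<Longrightarrow> f \<in> borel_measurable borel"
  by (auto simp: L1_bdd_def)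

lemma L1_bdd_mult_bounded:
  assumes f: "L1_bdd f" and g: "g \<in> borel_measurable borel" "\<And>z. norm (g z) \<le> B"
  shows "L1_bdd (\<lambda>z. f z * g z)"
proof -
  obtain C where C: "0 < C" "\<And>z. norm (f z) \<le> C" using L1_bdd_bound[OF f] by blast
  show ?thesis
  proof (rule L1_bddI)
    show "integrable lborel (\<lambda>z. norm (f z) * B)"
      using f by (auto simp: L1_bdd_def)
    show "(\<lambda>z. f z * g z) \<in> borel_measurable borel"
      using L1_bdd_measurable[OF f] g by simp
    show "norm (f z * g z) \<le> norm (f z) * B" for z
      by (simp add: norm_mult mult_left_mono g)
    show "norm (f z * g z) \<le> C * B" for z
      unfolding norm_mult using C g by (intro mult_mono) (auto intro: less_imp_le)
  qed
qed

lemma L1_bdd_mult: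
  assumes "L1_bdd f" "L1_bdd g"
  shows "L1_bdd (\<lambda>z. f z * g z)"
  using L1_bdd_mult_bounded[OF assms(1) L1_bdd_measurable[OF assms(2)]] L1_bdd_bound[OF assms(2)]
  by metis

lemma L1_bdd_cmult: "L1_bdd f \<Longrightarrow> L1_bdd (\<lambda>z. c * f z)"
  using L1_bdd_mult_bounded[of f "\<lambda>z. c" "norm c"] by (simp add: mult.commute)

lemma L1_bdd_cnj [simp]: "L1_bdd (\<lambda>z. cnj (f z)) \<longleftrightarrow> L1_bdd f"
  by (auto simp: L1_bdd_def)

lemma L1_bdd_add:
  assumes "L1_bdd f" "L1_bdd g"
  shows "L1_bdd (\<lambda>z. f z + g z)"
proof -
  obtain B C where "\<And>z. norm (f z) \<le> B" "\<And>z. norm (g z) \<le> C"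
    using assms L1_bdd_bound by metis
  then have "norm (f z + g z) \<le> B + C" for z
    by (meson add_mono norm_triangle_mono)
  then show ?thesis using assms by (auto simp: L1_bdd_def)
qed

lemma L1_bdd_zero [simp]: "L1_bdd (\<lambda>z. 0)"
  by (auto simp: L1_bdd_def)

lemma L1_bdd_sum:
  assumes "\<And>i. i \<in> I \<Longrightarrow> L1_bdd (f i)"
  shows "L1_bdd (\<lambda>z. \<Sum>i\<in>I. f i z)"
  using assms by (induction I rule: infinite_finite_induct) (auto intro: L1_bdd_add)

lemma integrable_norm_sq:
  assumes "L1_bdd f"
  shows "integrable lborel (\<lambda>z. (norm (f z))\<^sup>2)"
proof -
  have "integrable lborel (\<lambda>z. norm (f z * f z))"
    using L1_bdd_mult[OF assms assms] by (auto simp: L1_bdd_def)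
  then show ?thesis by (simp add: norm_mult power2_eq_square)
qed

lemma l2sq_cnj [simp]: "l2sq (\<lambda>z. cnj (f z)) = l2sq f"
  by (simp add: l2sq_def)

lemma l2sq_eq_inner:
  assumes "L1_bdd f"
  shows "complex_of_real (l2sq f) = (LBINT z. f z * cnj (f z))"
proof -
  have "(LBINT z. f z * cnj (f z)) = (LBINT z. complex_of_real ((norm (f z))\<^sup>2))"
    by (intro Bochner_Integration.integral_cong) (simp_all only: complex_norm_square)
  then show ?thesis by (simp only: l2sq_def integral_complex_of_real)
qed

lemma Cauchy_Schwarz_l2sq:
  assumes f: "L1_bdd f" and g: "L1_bdd g"
  shows "norm (LBINT z. f z * g z) \<le> sqrt (l2sq f) * sqrt (l2sq g)"
proof -
  define c where "c = (LBINT z. norm (f z) * norm (g z))"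
  have i: "integrable lborel (\<lambda>z. norm (f z) * norm (g z))"
    using L1_bdd_mult[OF f g, THEN L1_bdd_integrable, THEN integrable_norm] by (simp add: norm_mult)
  have c0: "0 \<le> c" unfolding c_def by simp
  \<comment> \<open>The squared L^2 distance between t |f| and |g| is a quadratic in t; both cases
    below evaluate it at one point.\<close>
  have q: "0 \<le> l2sq f * t\<^sup>2 + (-2 * c) * t + l2sq g" for t
  proof -
    have "0 \<le> (LBINT z. (t * norm (f z) - norm (g z))\<^sup>2)" by simp
    also have "... = (LBINT z. (t\<^sup>2 * (norm (f z))\<^sup>2 - 2 * t * (norm (f z) * norm (g z))) + (norm (g z))\<^sup>2)"
      by (intro Bochner_Integration.integral_cong) (auto simp: power2_eq_square algebra_simps)
    also have "... = t\<^sup>2 * l2sq f - 2 * t * c + l2sq g"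
      unfolding l2sq_def c_def
      by (simp add: integrable_norm_sq f g i)
    finally show ?thesis by (simp add: algebra_simps)
  qed
  have "c\<^sup>2 \<le> l2sq f * l2sq g"
  proof (cases "l2sq f = 0")
    case True
    have "c = 0"
    proof (rule ccontr)
      assume "c \<noteq> 0"
      \<comment> \<open>At this t the expression, linear in t because its leading coefficient
        vanishes, equals -1.\<close>
      then show False using q[of "(l2sq g + 1) / (2 * c)"] True by (simp add: field_simps)
    qed
    then show ?thesis by (simp add: True)
  next
    case False
    then have "0 < l2sq f" using l2sq_nonneg[of f] by linarith
    \<comment> \<open>This t is the minimiser of the quadratic.\<close>
    then show ?thesis using q[of "c / l2sq f"] by (simp add: field_simps power2_eq_square)
  qed
  then have "c \<le> sqrt (l2sq f) * sqrt (l2sq g)"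
    by (metis real_le_rsqrt real_sqrt_mult)
  moreover have "norm (LBINT z. f z * g z) \<le> c"
    unfolding c_def norm_mult[symmetric] by (rule integral_norm_bound)
  ultimately show ?thesis by linarith
qed

section \<open>Product domination, Fubini, and time integrals of curves\<close>

lemma lborel_integrable_product:
  fixes a :: "'a::euclidean_space \<Rightarrow> real" and b :: "'b::euclidean_space \<Rightarrow> real"
  assumes a: "integrable lborel a" and b: "integrable lborel b"
  shows "integrable (lborel \<Otimes>\<^sub>M lborel) (\<lambda>(x, y). a x * b y)"
proof (rule lborel_pair.Fubini_integrable)
  show "(\<lambda>(x, y). a x * b y) \<in> borel_measurable (lborel \<Otimes>\<^sub>M lborel)"
    using a b by measurable
  show "integrable lborel (\<lambda>x. LBINT y. norm (case (x, y) of (x, y) \<Rightarrow> a x * b y))"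
    using a b by (simp add: abs_mult)
  show "AE x in lborel. integrable lborel (\<lambda>y. case (x, y) of (x, y) \<Rightarrow> a x * b y)"
    using b by simp
qed

lemma integrable_dominated_product:
  fixes F :: "'a::euclidean_space \<Rightarrow> 'b::euclidean_space \<Rightarrow> complex"
  assumes "case_prod F \<in> borel_measurable (lborel \<Otimes>\<^sub>M lborel)"
    and "integrable lborel a" "integrable lborel b" "\<And>x y. norm (F x y) \<le> a x * b y"
  shows "integrable (lborel \<Otimes>\<^sub>M lborel) (case_prod F)"
proof (rule Bochner_Integration.integrable_bound[OF lborel_integrable_product[OF assms(2,3)] assms(1)])
  show "AE x in lborel \<Otimes>\<^sub>M lborel. norm (case_prod F x) \<le> norm (case x of (x, y) \<Rightarrow> a x * b y)"
    using assms(4) by (auto intro!: AE_I2 order_trans[OF _ abs_ge_self])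
qed

lemma Fubini_dominated:
  fixes F :: "'a::euclidean_space \<Rightarrow> 'b::euclidean_space \<Rightarrow> complex"
  assumes "case_prod F \<in> borel_measurable (lborel \<Otimes>\<^sub>M lborel)"
    and "integrable lborel a" "integrable lborel b" "\<And>x y. norm (F x y) \<le> a x * b y"
  shows "(LBINT x. LBINT y. F x y) = (LBINT y. LBINT x. F x y)"
  using lborel_pair.Fubini_integral[OF integrable_dominated_product[OF assms]] by simp

text \<open>Domination by a function of time multiplied by a function of space is what every later
  use of Fubini rests on. The cut-off to [0, T] is built into the curve, so time integrals can run
  over the whole line.\<close>

definition curve :: "real \<Rightarrow> (real \<Rightarrow> 'a::euclidean_space \<Rightarrow> complex) \<Rightarrow> bool" where
  "curve T v \<longleftrightarrow> case_prod v \<in> borel_measurable (lborel \<Otimes>\<^sub>M lborel) \<and>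
     (\<exists>G B. integrable lborel G \<and> (\<forall>y. G y \<le> B) \<and>
        (\<forall>s y. norm (v s y) \<le> indicator {0..T} s * G y))"

lemma curveE:
  assumes "curve T v"
  obtains G B where "case_prod v \<in> borel_measurable (lborel \<Otimes>\<^sub>M lborel)" "integrable lborel G"
    "\<And>y. G y \<le> B" "\<And>s y. norm (v s y) \<le> indicator {0..T} s * G y" "0 \<le> B"
proof -
  obtain G B where *: "case_prod v \<in> borel_measurable (lborel \<Otimes>\<^sub>M lborel)" "integrable lborel G"
    "\<And>y. G y \<le> B" "\<And>s y. norm (v s y) \<le> indicator {0..T} s * G y"
    using assms unfolding curve_def by blast
  have "G y \<le> max 0 B" for y using *(3)[of y] by linarith
  with * show thesis by (intro that[of G "max 0 B"]) auto
qed

lemma curve_L1_bdd: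
  assumes "curve T v" shows "L1_bdd (v s)"
proof -
  obtain G B where *: "case_prod v \<in> borel_measurable (lborel \<Otimes>\<^sub>M lborel)" "integrable lborel G"
    "\<And>y. G y \<le> B" "\<And>s y. norm (v s y) \<le> indicator {0..T} s * G y" "0 \<le> B"
    using curveE[OF assms] by blast
  show ?thesis
  proof (rule L1_bddI)
    have "(\<lambda>y. case_prod v (s, y)) \<in> borel_measurable lborel"
      using *(1) by measurable
    then show "v s \<in> borel_measurable borel" by simp
    show "integrable lborel (\<lambda>y. indicator {0..T} s * G y)" using * by simp
    show "norm (v s y) \<le> indicator {0..T} s * G y" for y by fact
    show "norm (v s y) \<le> B" for y
      using *(3)[of y] *(4)[of s y] *(5) by (cases "s \<in> {0..T}") auto
  qed
qed

lemma integrable_indicator_Icc: "integrable lborel (indicator {a..b::real} :: real \<Rightarrow> real)"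
  by (rule integrable_real_indicator) (auto simp: emeasure_lborel_Icc_eq)

lemma curve_integral_L1_bdd:
  assumes "curve T v" shows "L1_bdd (\<lambda>y. LBINT s. v s y)"
proof -
  obtain G B where *: "case_prod v \<in> borel_measurable (lborel \<Otimes>\<^sub>M lborel)" "integrable lborel G"
    "\<And>y. G y \<le> B" "\<And>s y. norm (v s y) \<le> indicator {0..T} s * G y" "0 \<le> B"
    using curveE[OF assms] by blast
  have G0: "0 \<le> G y" if "0 \<le> T" for y
    using order_trans[OF norm_ge_zero *(4)[of 0 y]] that by simp
  have m: "(\<lambda>(y, s). v s y) \<in> borel_measurable (lborel \<Otimes>\<^sub>M lborel)"
    using measurable_compose[OF measurable_pair_swap' *(1)] by (simp add: case_prod_beta' )
  have le: "norm (LBINT s. v s y) \<le> \<bar>T\<bar> * \<bar>G y\<bar>" for y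
  proof -
    have "norm (LBINT s. v s y) \<le> (LBINT s. norm (v s y))" by (rule integral_norm_bound)
    also have "... \<le> (LBINT s. indicator {0..T} s * \<bar>G y\<bar>)"
    proof (rule integral_mono')
      show "norm (v s y) \<le> indicator {0..T} s * \<bar>G y\<bar>" for s
        using *(4)[of s y] by (auto simp: indicator_def split: if_splits)
    qed (use integrable_indicator_Icc in auto)
    \<comment> \<open>The sign of T is left open; for T < 0 the interval is empty and the integral
      is 0.\<close>
    also have "... \<le> \<bar>T\<bar> * \<bar>G y\<bar>" by (cases "0 \<le> T") (auto simp: mult_nonpos_nonneg)
    finally show ?thesis .
  qed
  show ?thesis
  proof (rule L1_bddI)
    show "(\<lambda>y. LBINT s. v s y) \<in> borel_measurable borel"
      using lborel.borel_measurable_lebesgue_integral[of "\<lambda>y s. v s y" lborel] m by simp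
    show "integrable lborel (\<lambda>y. \<bar>T\<bar> * \<bar>G y\<bar>)" using * by simp
    show "norm (LBINT s. v s y) \<le> \<bar>T\<bar> * \<bar>G y\<bar>" for y by fact
    show "norm (LBINT s. v s y) \<le> \<bar>T\<bar> * B" for y
    proof (cases "0 \<le> T")
      case True
      then show ?thesis using le[of y] *(3)[of y] G0[OF True, of y]
        by (smt (verit) mult_left_mono abs_ge_zero)
    next
      case False
      then have "v s y = 0" for s using *(4)[of s y] by (auto simp: indicator_def)
      then show ?thesis using *(5) by simp
    qed
  qed
qed

lemma integrable_curve_mult:
  assumes v: "curve T v" and h: "L1_bdd h"
  shows "integrable (lborel \<Otimes>\<^sub>M lborel) (\<lambda>(s, y). v s y * h y)"
proof -
  obtain G B where *: "case_prod v \<in> borel_measurable (lborel \<Otimes>\<^sub>M lborel)" "integrable lborel G"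
    "\<And>y. G y \<le> B" "\<And>s y. norm (v s y) \<le> indicator {0..T} s * G y" "0 \<le> B"
    using curveE[OF v] by blast
  have h': "h \<in> borel_measurable lborel" using L1_bdd_measurable[OF h] by simp
  obtain C where C: "\<And>y. norm (h y) \<le> C" using L1_bdd_bound[OF h] by metis
  have C0: "0 \<le> C" using C norm_ge_zero order_trans by blast
  show ?thesis
  proof (rule integrable_dominated_product)
    have "(\<lambda>x. case_prod v x * h (snd x)) \<in> borel_measurable (lborel \<Otimes>\<^sub>M lborel)"
      by (intro borel_measurable_times *(1) measurable_compose[OF measurable_snd h'])
    then show "(\<lambda>(s, y). v s y * h y) \<in> borel_measurable (lborel \<Otimes>\<^sub>M lborel)"
      by (simp add: case_prod_beta')
    show "integrable lborel (indicator {0..T} :: real \<Rightarrow> real)" by (rule integrable_indicator_Icc)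
    show "integrable lborel (\<lambda>y. G y * C)" using * by simp
    show "norm (v s y * h y) \<le> indicator {0..T} s * (G y * C)" for s y
      using mult_mono[OF *(4)[of s y] C[of y]] C0 order_trans[OF norm_ge_zero *(4)[of s y]]
      by (simp add: norm_mult mult.assoc)
  qed
qed

lemma curve_swap:
  assumes v: "curve T v" and h: "L1_bdd h"
  shows "(LBINT y. (LBINT s. v s y) * h y) = (LBINT s. LBINT y. v s y * h y)"
  using lborel_pair.Fubini_integral[OF integrable_curve_mult[OF v h]] by simp

lemma integrable_curve_pairing:
  assumes "curve T v" "L1_bdd h"
  shows "integrable lborel (\<lambda>s. LBINT y. v s y * h y)"
  using lborel_pair.integrable_fst[OF integrable_curve_mult[OF assms]] by simp

lemma integrable_curve_time:
  assumes v: "curve T v"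
  shows "integrable lborel (\<lambda>s. v s y)"
proof -
  note c = v[unfolded curve_def]
  from c[THEN conjunct2] obtain G where G: "\<And>s y. norm (v s y) \<le> indicator {0..T} s * G y" by blast
  show ?thesis
  proof (rule Bochner_Integration.integrable_bound)
    show "integrable lborel (\<lambda>s. indicator {0..T} s * G y)" using integrable_indicator_Icc by simp
    have "(\<lambda>s. case_prod v (s, y)) \<in> borel_measurable lborel" using c[THEN conjunct1] by measurable
    then show "(\<lambda>s. v s y) \<in> borel_measurable lborel" by (simp only: prod.case)
    have "norm (v s y) \<le> norm (indicator {0..T} s * G y)" for s using G[of s y] unfolding real_norm_def by linarith
    then show "AE s in lborel. norm (v s y) \<le> norm (indicator {0..T} s * G y)" by (intro AE_I2)
  qed
qed

lemma curve_scale: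
  assumes v: "curve T v" and w: "w \<in> borel_measurable borel" "\<And>s. s \<in> {0..T} \<Longrightarrow> norm (w s) \<le> 1"
  shows "curve T (\<lambda>s y. w s * v s y)"
proof -
  obtain G B where *: "case_prod v \<in> borel_measurable (lborel \<Otimes>\<^sub>M lborel)" "integrable lborel G"
    "\<And>y. G y \<le> B" "\<And>s y. norm (v s y) \<le> indicator {0..T} s * G y" "0 \<le> B"
    using curveE[OF v] by blast
  have w': "w \<in> borel_measurable lborel" using w by simp
  have m: "(\<lambda>x. w (fst x) * case_prod v x) \<in> borel_measurable (lborel \<Otimes>\<^sub>M lborel)"
    using *(1) w' by measurable
  have "norm (w s * v s y) \<le> indicator {0..T} s * G y" for s y
  proof (cases "s \<in> {0..T}")
    case True
    have "norm (w s * v s y) \<le> 1 * norm (v s y)"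
      unfolding norm_mult by (intro mult_right_mono w(2) True) simp
    then show ?thesis using *(4)[of s y] by linarith
  next
    case False
    then show ?thesis using *(4)[of s y] by (simp add: norm_mult)
  qed
  then show ?thesis unfolding curve_def using *(2,3) m by (auto simp: case_prod_beta')
qed

lemma curve_zero_outside:
  assumes "curve T v" "s \<notin> {0..T}"
  shows "v s y = 0"
proof -
  obtain G where "norm (v s y) \<le> indicator {0..T} s * G y" using assms(1) unfolding curve_def by blast
  then show ?thesis using assms(2) by simp
qed

text \<open>The expansion behind the TT* method. \<open>curve_swap\<close> extracts one time
  integral, and only from the left factor, so the pairing is conjugated, opened, conjugated back and
  opened again.\<close>

lemma curve_inner:
  assumes v: "curve T v" and v': "curve T v'"
  shows "(LBINT y. (LBINT s. v s y) * cnj (LBINT s. v' s y))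
       = (LBINT s'. LBINT s. LBINT y. v s y * cnj (v' s' y))"
proof -
  have "(LBINT y. (LBINT s. v s y) * cnj (LBINT s. v' s y))
    = cnj (LBINT y. (LBINT s. v' s y) * cnj (LBINT s. v s y))"
  proof -
    have "(LBINT y. (LBINT s. v s y) * cnj (LBINT s. v' s y))
      = (LBINT y. cnj ((LBINT s. v' s y) * cnj (LBINT s. v s y)))"
      by (simp add: mult.commute)
    also have "... = cnj (LBINT y. (LBINT s. v' s y) * cnj (LBINT s. v s y))"
      by (rule Bochner_Integration.integral_cnj)
    finally show ?thesis .
  qed
  also have "... = cnj (LBINT s'. LBINT y. v' s' y * cnj (LBINT s. v s y))"
    by (subst curve_swap[OF v']) (use curve_integral_L1_bdd[OF v] in auto)
  also have "... = (LBINT s'. LBINT y. (LBINT s. v s y) * cnj (v' s' y))"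
  proof -
    have "(LBINT s'. LBINT y. (LBINT s. v s y) * cnj (v' s' y))
      = (LBINT s'. LBINT y. cnj (v' s' y * cnj (LBINT s. v s y)))"
      by (simp add: mult.commute)
    then show ?thesis by (simp only: Bochner_Integration.integral_cnj)
  qed
  also have "... = (LBINT s'. LBINT s. LBINT y. v s y * cnj (v' s' y))"
    by (subst curve_swap[OF v]) (use curve_L1_bdd[OF v'] in auto)
  finally show ?thesis .
qed

section \<open>Off-diagonal decay\<close>

lemma has_bochner_integral_powr_tail:
  fixes \<gamma> \<rho> :: real
  assumes "1 < \<gamma>" "0 < \<rho>"
  shows "has_bochner_integral lborel (\<lambda>x. indicator {\<rho>..} x * x powr (-\<gamma>)) (\<rho> powr (1 - \<gamma>) / (\<gamma> - 1))"
proof (rule has_bochner_integral_nn_integral)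
  have "((\<lambda>x. x powr (-\<gamma>)) has_integral -(\<rho> powr (-\<gamma> + 1)) / (-\<gamma> + 1)) {\<rho>..}"
    using assms by (intro has_integral_powr_to_inf) auto
  moreover have "-(\<rho> powr (-\<gamma> + 1)) / (-\<gamma> + 1) = \<rho> powr (1 - \<gamma>) / (\<gamma> - 1)"
    using assms by (simp add: field_simps)
  ultimately have "((\<lambda>x. x powr (-\<gamma>)) has_integral \<rho> powr (1 - \<gamma>) / (\<gamma> - 1)) {\<rho>..}" by simp
  then have "((\<lambda>x. indicator {\<rho>..} x * x powr (-\<gamma>)) has_integral \<rho> powr (1 - \<gamma>) / (\<gamma> - 1)) UNIV"
    using has_integral_restrict_UNIV[of "{\<rho>..}" "\<lambda>x. x powr (-\<gamma>)"]
    by (simp add: indicator_def of_bool_def if_distrib[of "\<lambda>c. c * _"] cong: if_cong)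
  from nn_integral_has_integral_lborel[OF _ _ this]
  show "(\<integral>\<^sup>+x. ennreal (indicator {\<rho>..} x * x powr (-\<gamma>)) \<partial>lborel) = ennreal (\<rho> powr (1 - \<gamma>) / (\<gamma> - 1))"
    by simp
qed (use assms in auto)

text \<open>Lags below \<rho> fill an interval of length 2 \<rho>; each of the two tails contributes
  the one-sided integral of \<open>x powr (-\<gamma>)\<close>, finite because \<gamma> > 1.\<close>

lemma norm_integral_le_power_decay:
  fixes h :: "real \<Rightarrow> complex" and \<gamma> \<rho> a b s :: real
  assumes "1 < \<gamma>" "0 < \<rho>" "0 \<le> a" "0 \<le> b"
    and near: "\<And>t. \<bar>t - s\<bar> < \<rho> \<Longrightarrow> norm (h t) \<le> a"
    and far: "\<And>t. \<rho> \<le> \<bar>t - s\<bar> \<Longrightarrow> norm (h t) \<le> b * \<bar>t - s\<bar> powr (-\<gamma>)"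
  shows "norm (LBINT t. h t) \<le> 2 * a * \<rho> + 2 * b * (\<rho> powr (1 - \<gamma>) / (\<gamma> - 1))"
proof -
  define \<tau> where "\<tau> = (\<lambda>x. indicator {\<rho>..} x * x powr (-\<gamma>))"
  define I where "I = \<rho> powr (1 - \<gamma>) / (\<gamma> - 1)"
  have \<tau>: "has_bochner_integral lborel \<tau> I"
    unfolding \<tau>_def I_def using assms by (intro has_bochner_integral_powr_tail)
  have r: "has_bochner_integral lborel (\<lambda>t. \<tau> (t - s)) I"
    using lborel_has_bochner_integral_real_affine_iff[of 1 \<tau> I "-s"] \<tau> by simp
  have l: "has_bochner_integral lborel (\<lambda>t. \<tau> (s - t)) I"
    using lborel_has_bochner_integral_real_affine_iff[of "-1" \<tau> I "s"] \<tau> by simp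
  have n: "has_bochner_integral lborel (indicator {s-\<rho>..s+\<rho>} :: real \<Rightarrow> real) (2 * \<rho>)"
    using has_bochner_integral_real_indicator[of "{s-\<rho>..s+\<rho>}" lborel] assms
    by (simp add: emeasure_lborel_Icc_eq)
  have "has_bochner_integral lborel (\<lambda>t. a * indicator {s-\<rho>..s+\<rho>} t + (b * \<tau> (t - s) + b * \<tau> (s - t)))
         (a * (2 * \<rho>) + (b * I + b * I))"
    by (intro has_bochner_integral_add has_bochner_integral_mult_right r l n)
  then have i: "integrable lborel (\<lambda>t. a * indicator {s-\<rho>..s+\<rho>} t + (b * \<tau> (t - s) + b * \<tau> (s - t)))"
    and e: "(LBINT t. a * indicator {s-\<rho>..s+\<rho>} t + (b * \<tau> (t - s) + b * \<tau> (s - t))) = a * (2 * \<rho>) + (b * I + b * I)"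
    by (simp_all add: has_bochner_integral_iff)
  have \<tau>0: "0 \<le> \<tau> x" for x by (simp add: \<tau>_def)
  have "norm (LBINT t. h t) \<le> (LBINT t. norm (h t))" by (rule integral_norm_bound)
  also have "... \<le> (LBINT t. a * indicator {s-\<rho>..s+\<rho>} t + (b * \<tau> (t - s) + b * \<tau> (s - t)))"
  proof (rule integral_mono'[OF i])
    fix t :: real
    show "0 \<le> a * indicator {s-\<rho>..s+\<rho>} t + (b * \<tau> (t - s) + b * \<tau> (s - t))"
      using assms \<tau>0 by (intro add_nonneg_nonneg mult_nonneg_nonneg) auto
    consider "\<bar>t - s\<bar> < \<rho>" | "\<rho> \<le> t - s" | "\<rho> \<le> s - t" by linarith
    then show "norm (h t) \<le> a * indicator {s-\<rho>..s+\<rho>} t + (b * \<tau> (t - s) + b * \<tau> (s - t))"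
    proof cases
      case 1
      then have "a * indicator {s-\<rho>..s+\<rho>} t = a" by (auto simp: indicator_def)
      moreover have "0 \<le> b * \<tau> (t - s) + b * \<tau> (s - t)" using assms \<tau>0 by simp
      ultimately show ?thesis using near[OF 1] by linarith
    next
      case 2
      then have "norm (h t) \<le> b * \<tau> (t - s)" using far[of t] assms(2) by (simp add: \<tau>_def)
      moreover have "0 \<le> b * \<tau> (s - t)" "0 \<le> a * indicator {s-\<rho>..s+\<rho>} t" using assms \<tau>0 by auto
      ultimately show ?thesis by linarith
    next
      case 3
      then have "norm (h t) \<le> b * \<tau> (s - t)" using far[of t] assms(2) by (simp add: \<tau>_def abs_minus_commute)
      moreover have "0 \<le> b * \<tau> (t - s)" "0 \<le> a * indicator {s-\<rho>..s+\<rho>} t" using assms \<tau>0 by auto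
      ultimately show ?thesis by linarith
    qed
  qed
  finally show ?thesis using e by (simp add: I_def)
qed

lemma norm_integral_le_bounded_support:
  fixes h :: "real \<Rightarrow> complex"
  assumes "\<And>t. norm (h t) \<le> a * indicator {l..u} t" "0 \<le> a" "l \<le> u"
  shows "norm (LBINT t. h t) \<le> a * (u - l)"
proof -
  have "norm (LBINT t. h t) \<le> (LBINT t. norm (h t))" by (rule integral_norm_bound)
  also have "... \<le> (LBINT t. a * indicator {l..u} t)"
    using assms integrable_indicator_Icc[of l u] by (intro integral_mono') auto
  finally show ?thesis using assms by simp
qed

text \<open>The squared norm is a double time integral of pairings. The inner variable is handled by
  \<open>norm_integral_le_power_decay\<close> centred at the outer one; the outer variable ranges
  over a support of length u - l.\<close>

lemma l2sq_integral_curve_le: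
  assumes v: "curve T v" and \<gamma>: "1 < \<gamma>" "0 < \<rho>" "0 \<le> a" "0 \<le> b" "l \<le> u"
    and supp: "\<And>s y. s \<notin> {l..u} \<Longrightarrow> v s y = 0"
    and near: "\<And>s t. norm (LBINT y. v s y * cnj (v t y)) \<le> a"
    and far: "\<And>s t. s \<noteq> t \<Longrightarrow> norm (LBINT y. v s y * cnj (v t y)) \<le> b * \<bar>s - t\<bar> powr (-\<gamma>)"
  shows "l2sq (\<lambda>y. LBINT s. v s y) \<le> (u - l) * (2 * a * \<rho> + 2 * b * (\<rho> powr (1 - \<gamma>) / (\<gamma> - 1)))"
proof -
  have "complex_of_real (l2sq (\<lambda>y. LBINT s. v s y))
    = (LBINT t. LBINT s. LBINT y. v s y * cnj (v t y))"
    using l2sq_eq_inner[OF curve_integral_L1_bdd[OF v]] curve_inner[OF v v] by simp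
  then have "l2sq (\<lambda>y. LBINT s. v s y) = norm (LBINT t. LBINT s. LBINT y. v s y * cnj (v t y))"
    by (metis abs_of_nonneg l2sq_nonneg norm_of_real)
  also have "... \<le> (2 * a * \<rho> + 2 * b * (\<rho> powr (1 - \<gamma>) / (\<gamma> - 1))) * (u - l)"
  proof (rule norm_integral_le_bounded_support)
    fix t
    show "norm (LBINT s. LBINT y. v s y * cnj (v t y))
       \<le> (2 * a * \<rho> + 2 * b * (\<rho> powr (1 - \<gamma>) / (\<gamma> - 1))) * indicator {l..u} t"
    proof (cases "t \<in> {l..u}")
      case True
      have "norm (LBINT s. LBINT y. v s y * cnj (v t y)) \<le> 2 * a * \<rho> + 2 * b * (\<rho> powr (1 - \<gamma>) / (\<gamma> - 1))"
        using near far \<gamma> by (intro norm_integral_le_power_decay[where s=t]) auto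
      then show ?thesis using True by simp
    qed (simp add: supp)
  qed (use \<gamma> in auto)
  finally show ?thesis by (simp add: mult.commute)
qed

text \<open>For each fixed time t of the second curve the first one is cut at lag R. The near piece
  lives on an interval of length 2 R, so \<open>l2sq_integral_curve_le\<close> bounds its norm with
  a factor sqrt R, and Cauchy-Schwarz pairs it with \<open>v' t\<close>. The far piece is integrated
  against the dispersive bound. Integrating over t costs the factor T. The parameter \<rho> governs
  the self-interaction inside the near piece and is chosen independently of R.\<close>

lemma norm_inner_integral_curve_le:
  assumes v: "curve T v" and v': "curve T v'" and \<gamma>: "1 < \<gamma>" "0 < \<rho>" "0 < R" "0 \<le> T" "0 \<le> a" "0 \<le> b" "0 \<le> a'" "0 \<le> b'"
    and near: "\<And>s t. norm (LBINT y. v s y * cnj (v t y)) \<le> a"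
    and far: "\<And>s t. s \<noteq> t \<Longrightarrow> norm (LBINT y. v s y * cnj (v t y)) \<le> b * \<bar>s - t\<bar> powr (-\<gamma>)"
    and near': "\<And>t. l2sq (v' t) \<le> a'"
    and cross: "\<And>s t. s \<noteq> t \<Longrightarrow> norm (LBINT y. v s y * cnj (v' t y)) \<le> b' * \<bar>s - t\<bar> powr (-\<gamma>)"
  shows "norm (LBINT y. (LBINT s. v s y) * cnj (LBINT s. v' s y))
    \<le> T * (sqrt (2 * R * (2 * a * \<rho> + 2 * b * (\<rho> powr (1 - \<gamma>) / (\<gamma> - 1)))) * sqrt a'
           + 2 * b' * (R powr (1 - \<gamma>) / (\<gamma> - 1)))"
    (is "_ \<le> T * (?near + ?far)")
proof -
  have "norm (LBINT t. LBINT s. LBINT y. v s y * cnj (v' t y)) \<le> (?near + ?far) * (T - 0)"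
  proof (rule norm_integral_le_bounded_support)
    fix t
    show "norm (LBINT s. LBINT y. v s y * cnj (v' t y)) \<le> (?near + ?far) * indicator {0..T} t"
    proof (cases "t \<in> {0..T}")
      case False
      then show ?thesis by (simp add: curve_zero_outside[OF v'])
    next
      case True
      define w where "w = (\<lambda>s. indicator {t-R..t+R} s :: complex)"
      define vn where "vn = (\<lambda>s y. w s * v s y)"
      define vf where "vf = (\<lambda>s y. (1 - w s) * v s y)"
      have cn: "curve T vn" unfolding vn_def w_def by (rule curve_scale[OF v]) (auto simp: indicator_def)
      have cf: "curve T vf" unfolding vf_def w_def by (rule curve_scale[OF v]) (auto simp: indicator_def)
      have v't: "L1_bdd (\<lambda>y. cnj (v' t y))" using curve_L1_bdd[OF v'] by simp
      note Fi = integrable_curve_pairing[OF _ v't]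
      have split: "(LBINT y. v s y * cnj (v' t y)) = (LBINT y. vn s y * cnj (v' t y)) + (LBINT y. vf s y * cnj (v' t y))" for s
      proof -
        have "(LBINT y. vn s y * cnj (v' t y)) + (LBINT y. vf s y * cnj (v' t y))
          = (LBINT y. vn s y * cnj (v' t y) + vf s y * cnj (v' t y))"
          by (rule Bochner_Integration.integral_add[symmetric])
             (intro L1_bdd_integrable L1_bdd_mult curve_L1_bdd[OF cn] curve_L1_bdd[OF cf] v't)+
        then show ?thesis by (simp add: vn_def vf_def algebra_simps)
      qed
      have "norm (LBINT s. LBINT y. vn s y * cnj (v' t y)) = norm (LBINT y. (LBINT s. vn s y) * cnj (v' t y))"
        by (subst curve_swap[OF cn v't]) simp
      also have "... \<le> sqrt (l2sq (\<lambda>y. LBINT s. vn s y)) * sqrt (l2sq (v' t))"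
        using Cauchy_Schwarz_l2sq[OF curve_integral_L1_bdd[OF cn] v't] by simp
      also have "... \<le> sqrt (((t + R) - (t - R)) * (2 * a * \<rho> + 2 * b * (\<rho> powr (1 - \<gamma>) / (\<gamma> - 1)))) * sqrt a'"
      proof (intro mult_mono real_sqrt_le_mono near')
        \<comment> \<open>The cut-off takes only the values 0 and 1, so inserting it can only shrink
          a pairing, and the hypotheses on v carry over to its near piece.\<close>
        have eq: "(LBINT y. vn s y * cnj (vn r y)) = w s * cnj (w r) * (LBINT y. v s y * cnj (v r y))" for s r
          unfolding integral_mult_right_zero[symmetric] vn_def by (simp add: mult_ac)
        have le: "norm (LBINT y. vn s y * cnj (vn r y)) \<le> norm (LBINT y. v s y * cnj (v r y))" for s r
          unfolding eq norm_mult by (auto simp: w_def indicator_def)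
        show "l2sq (\<lambda>y. LBINT s. vn s y) \<le> ((t + R) - (t - R)) * (2 * a * \<rho> + 2 * b * (\<rho> powr (1 - \<gamma>) / (\<gamma> - 1)))"
          by (rule l2sq_integral_curve_le[OF cn])
             (use \<gamma> order_trans[OF le near] order_trans[OF le far] in \<open>auto simp: vn_def w_def\<close>)
      qed (use \<gamma> in \<open>auto intro!: mult_nonneg_nonneg add_nonneg_nonneg divide_nonneg_nonneg\<close>)
      also have "... = ?near" by simp
      finally have n: "norm (LBINT s. LBINT y. vn s y * cnj (v' t y)) \<le> ?near" .
      \<comment> \<open>The near constant is 0, since the far piece vanishes at lags below
        R.\<close>
      have "norm (LBINT s. LBINT y. vf s y * cnj (v' t y)) \<le> 2 * 0 * R + 2 * b' * (R powr (1 - \<gamma>) / (\<gamma> - 1))"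
      proof (rule norm_integral_le_power_decay[where s=t])
        fix s assume "\<bar>s - t\<bar> < R"
        then have "w s = 1" by (auto simp: w_def indicator_def)
        then show "norm (LBINT y. vf s y * cnj (v' t y)) \<le> 0" by (simp add: vf_def)
      next
        fix s assume s: "R \<le> \<bar>s - t\<bar>"
        have eq: "(LBINT y. vf s y * cnj (v' t y)) = (1 - w s) * (LBINT y. v s y * cnj (v' t y))"
          unfolding integral_mult_right_zero[symmetric] vf_def by (simp add: mult_ac)
        have "norm (LBINT y. vf s y * cnj (v' t y)) \<le> norm (LBINT y. v s y * cnj (v' t y))"
          unfolding eq norm_mult by (auto simp: w_def indicator_def)
        also have "... \<le> b' * \<bar>s - t\<bar> powr (-\<gamma>)" using s \<gamma> by (intro cross) auto
        finally show "norm (LBINT y. vf s y * cnj (v' t y)) \<le> b' * \<bar>s - t\<bar> powr (-\<gamma>)" .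
      qed (use \<gamma> in auto)
      then have f: "norm (LBINT s. LBINT y. vf s y * cnj (v' t y)) \<le> ?far" by simp
      have "(LBINT s. LBINT y. v s y * cnj (v' t y))
        = (LBINT s. LBINT y. vn s y * cnj (v' t y)) + (LBINT s. LBINT y. vf s y * cnj (v' t y))"
        unfolding split by (rule Bochner_Integration.integral_add[OF Fi[OF cn] Fi[OF cf]])
      then show ?thesis using norm_triangle_le[OF add_mono[OF n f]] True by simp
    qed
  qed (use \<gamma> in auto)
  then show ?thesis unfolding curve_inner[OF v v'] by (simp add: mult.commute)
qed

text \<open>Near/far splitting at the geometric mean \<open>R = M\<^sup>\<alpha> M'\<^sup>1\<^sup>-\<^sup>\<alpha>\<close>, for which both parts gain the same power of \<open>M / M'\<close>.\<close>

lemma off_diagonal_decay: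
  assumes v: "curve T v" and v': "curve T v'" and \<gamma>: "1 < \<gamma>" and pos: "0 \<le> T" "0 < D" "0 < h" "0 < h'" "0 < m" "0 < m'"
    and near: "\<And>s t. norm (LBINT y. v s y * cnj (v t y)) \<le> h\<^sup>2 * m"
    and far: "\<And>s t. s \<noteq> t \<Longrightarrow> norm (LBINT y. v s y * cnj (v t y)) \<le> D * h\<^sup>2 * m\<^sup>2 * \<bar>s - t\<bar> powr (-\<gamma>)"
    and near': "\<And>t. l2sq (v' t) \<le> h'\<^sup>2 * m'"
    and cross: "\<And>s t. s \<noteq> t \<Longrightarrow> norm (LBINT y. v s y * cnj (v' t y)) \<le> D * h * h' * m * m' * \<bar>s - t\<bar> powr (-\<gamma>)"
  defines "M \<equiv> (D * m) powr (1 / \<gamma>)" and "M' \<equiv> (D * m') powr (1 / \<gamma>)"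
    and "\<theta> \<equiv> (\<gamma> - 1) / (2 * (2 * \<gamma> - 1))"
  shows "norm (LBINT y. (LBINT s. v s y) * cnj (LBINT s. v' s y))
    \<le> T * (sqrt (4 * \<gamma> / (\<gamma> - 1)) + 2 / (\<gamma> - 1)) * (h * sqrt (m * M) * (h' * sqrt (m' * M')) * (M / M') powr \<theta>)"
proof -
  define t where "t = M / M'"
  \<comment> \<open>Equivalently
    \<open>R = M powr (2 * \<theta>) * M' powr (1 - 2 * \<theta>)\<close>, so the weight in the
    geometric mean is 2 \<theta>.\<close>
  define R where "R = M' * t powr (2 * \<theta>)"
  have M: "0 < M" "0 < M'" "0 < t" "0 < R" using pos by (auto simp: M_def M'_def t_def R_def)
  have Mt: "M = M' * t" using M by (simp add: t_def)
  \<comment> \<open>M is the lag at which the two bounds on the self-interaction,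
    \<open>h\<^sup>2 * m\<close> and \<open>D * h\<^sup>2 * m\<^sup>2 * M powr (-\<gamma>)\<close>,
    agree; hence \<rho> = M in what follows.\<close>
  have DM: "D * m = M powr \<gamma>" "D * m' = M' powr \<gamma>" using \<gamma> pos by (auto simp: M_def M'_def powr_powr)
  have a: "2 * (h\<^sup>2 * m) * M + 2 * (D * h\<^sup>2 * m\<^sup>2) * (M powr (1 - \<gamma>) / (\<gamma> - 1)) = 2 * \<gamma> / (\<gamma> - 1) * (h\<^sup>2 * m * M)"
  proof -
    have "D * h\<^sup>2 * m\<^sup>2 * M powr (1 - \<gamma>) = h\<^sup>2 * m * ((D * m) * M powr (1 - \<gamma>))" by (simp add: power2_eq_square)
    also have "... = h\<^sup>2 * m * M" unfolding DM powr_add[symmetric] using M by simp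
    finally have e: "D * h\<^sup>2 * m\<^sup>2 * M powr (1 - \<gamma>) = h\<^sup>2 * m * M" .
    have "2 * (D * h\<^sup>2 * m\<^sup>2) * (M powr (1 - \<gamma>) / (\<gamma> - 1)) = 2 * (D * h\<^sup>2 * m\<^sup>2 * M powr (1 - \<gamma>)) / (\<gamma> - 1)" by simp
    also have "... = 2 * (h\<^sup>2 * m * M) / (\<gamma> - 1)" unfolding e ..
    finally show ?thesis using \<gamma> by (simp add: field_simps)
  qed
  have n: "sqrt (2 * R * (2 * \<gamma> / (\<gamma> - 1) * (h\<^sup>2 * m * M))) * sqrt (h'\<^sup>2 * m')
     = sqrt (4 * \<gamma> / (\<gamma> - 1)) * (h * sqrt (m * M) * (h' * sqrt (m' * M')) * t powr \<theta>)"
  proof -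
    have "sqrt R = sqrt M' * t powr \<theta>"
      unfolding R_def real_sqrt_mult using M by (simp add: powr_half_sqrt[symmetric] powr_powr)
    moreover have "sqrt (2 * R * (2 * \<gamma> / (\<gamma> - 1) * (h\<^sup>2 * m * M))) = sqrt (4 * \<gamma> / (\<gamma> - 1)) * (h * sqrt (m * M)) * sqrt R"
    proof -
      have "2 * R * (2 * \<gamma> / (\<gamma> - 1) * (h\<^sup>2 * m * M)) = (4 * \<gamma> / (\<gamma> - 1)) * (h\<^sup>2 * (m * M)) * R" by simp
      then show ?thesis using pos by (simp only: real_sqrt_mult real_sqrt_abs)
    qed
    moreover have "sqrt (h'\<^sup>2 * m') = h' * sqrt m'" using pos by (simp add: real_sqrt_mult)
    moreover have "sqrt (m' * M') = sqrt m' * sqrt M'" by (simp add: real_sqrt_mult)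
    ultimately show ?thesis by simp
  qed
  have f: "2 * (D * h * h' * m * m') * (R powr (1 - \<gamma>) / (\<gamma> - 1))
     = 2 / (\<gamma> - 1) * (h * sqrt (m * M) * (h' * sqrt (m' * M')) * t powr \<theta>)"
  proof -
    \<comment> \<open>One square root of each measure is combined with D and converted into powers
      of M and M'; the other one stays in the final bound.\<close>
    have mm: "m = sqrt m * sqrt m" "m' = sqrt m' * sqrt m'" using pos by auto
    have sD: "D * sqrt m * sqrt m' = M powr (\<gamma>/2) * M' powr (\<gamma>/2)"
    proof -
      have "D * sqrt m * sqrt m' = sqrt (D * m) * sqrt (D * m')" using pos by (simp add: real_sqrt_mult)
      also have "... = M powr (\<gamma>/2) * M' powr (\<gamma>/2)" unfolding DM using M by (simp add: powr_half_sqrt[symmetric] powr_powr)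
      finally show ?thesis .
    qed
    have "M powr (\<gamma>/2) * M' powr (\<gamma>/2) * R powr (1 - \<gamma>) = sqrt M * sqrt M' * t powr \<theta>"
    proof -
      \<comment> \<open>The identity of exponents derived from this, far part on the left and near
        part on the right, is the equation that determines \<theta>.\<close>
      have "\<theta> * (2 * (2 * \<gamma> - 1)) = \<gamma> - 1" using \<gamma> by (simp add: \<theta>_def)
      then have e: "\<gamma>/2 + 2 * \<theta> * (1 - \<gamma>) = 1/2 + \<theta>" by (simp add: algebra_simps)
      have "M powr (\<gamma>/2) * M' powr (\<gamma>/2) * R powr (1 - \<gamma>)
        = (M' powr (\<gamma>/2) * M' powr (\<gamma>/2) * M' powr (1 - \<gamma>)) * (t powr (\<gamma>/2) * t powr (2 * \<theta> * (1 - \<gamma>)))"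
        unfolding R_def Mt using M by (simp add: powr_mult powr_powr)
      also have "M' powr (\<gamma>/2) * M' powr (\<gamma>/2) * M' powr (1 - \<gamma>) = M'"
        unfolding powr_add[symmetric] using M by simp
      also have "t powr (\<gamma>/2) * t powr (2 * \<theta> * (1 - \<gamma>)) = t powr (1/2) * t powr \<theta>"
        unfolding powr_add[symmetric] e ..
      finally show ?thesis unfolding Mt using M by (simp add: real_sqrt_mult powr_half_sqrt)
    qed
    note * = this
    have "D * h * h' * m * m' * R powr (1 - \<gamma>) = h * h' * sqrt m * sqrt m' * ((D * sqrt m * sqrt m') * R powr (1 - \<gamma>))"
    proof -
      have "D * h * h' * (sqrt m * sqrt m) * (sqrt m' * sqrt m') * R powr (1 - \<gamma>) = h * h' * sqrt m * sqrt m' * ((D * sqrt m * sqrt m') * R powr (1 - \<gamma>))"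
        by (simp only: mult_ac)
      then show ?thesis by (simp only: mm[symmetric])
    qed
    also have "... = h * sqrt (m * M) * (h' * sqrt (m' * M')) * t powr \<theta>"
      unfolding sD * by (simp add: real_sqrt_mult)
    finally show ?thesis by simp
  qed
  have "norm (LBINT y. (LBINT s. v s y) * cnj (LBINT s. v' s y))
    \<le> T * (sqrt (2 * R * (2 * (h\<^sup>2 * m) * M + 2 * (D * h\<^sup>2 * m\<^sup>2) * (M powr (1 - \<gamma>) / (\<gamma> - 1)))) * sqrt (h'\<^sup>2 * m')
           + 2 * (D * h * h' * m * m') * (R powr (1 - \<gamma>) / (\<gamma> - 1)))"
    using v v' \<gamma> M pos near far near' cross by (intro norm_inner_integral_curve_le) (auto simp: less_imp_le)
  also have "... = T * (sqrt (4 * \<gamma> / (\<gamma> - 1)) + 2 / (\<gamma> - 1)) * (h * sqrt (m * M) * (h' * sqrt (m' * M')) * t powr \<theta>)"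
    unfolding a n f by (simp add: algebra_simps)
  finally show ?thesis by (simp add: t_def)
qed

section \<open>Summation over levels\<close>

lemma finite_geometric_sum_le:
  fixes r :: real
  assumes "finite S" "0 \<le> r" "r < 1"
  shows "(\<Sum>j\<in>S. r ^ j) \<le> 1 / (1 - r)"
  using sum_le_suminf[of "\<lambda>j. r ^ j" S] assms by (simp add: summable_geometric suminf_geometric)

text \<open>Schur's test for the matrix with entries r^|k-l|: each row sums to at most 2/(1 - r),
  and the row bound is used once for each of the two squares. Symmetry reduces the hypothesis to l
  \<le> k, the side on which the decay between levels will be derived.\<close>

lemma Schur_geometric:
  fixes c :: "nat \<Rightarrow> real" and H :: "nat \<Rightarrow> nat \<Rightarrow> real"
  assumes "finite F" "0 \<le> r" "r < 1" "0 \<le> A"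
    and sym: "\<And>k l. H k l = H l k"
    and H: "\<And>k l. k \<in> F \<Longrightarrow> l \<in> F \<Longrightarrow> l \<le> k \<Longrightarrow> H k l \<le> A * ((c k)\<^sup>2 + (c l)\<^sup>2) * r ^ (k - l)"
  shows "(\<Sum>k\<in>F. \<Sum>l\<in>F. H k l) \<le> 4 * A / (1 - r) * (\<Sum>k\<in>F. (c k)\<^sup>2)"
proof -
  \<comment> \<open>With truncated subtraction this is |k - l|.\<close>
  define d where "d = (\<lambda>k l :: nat. (k - l) + (l - k))"
  have le: "H k l \<le> A * ((c k)\<^sup>2 * r ^ d k l + (c l)\<^sup>2 * r ^ d k l)" if "k \<in> F" "l \<in> F" for k l
  proof (cases "l \<le> k")
    case True
    then show ?thesis using H[OF that True] by (simp add: d_def algebra_simps)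
  next
    case False
    then show ?thesis using H[OF that(2,1)] sym[of k l] by (simp add: d_def algebra_simps)
  qed
  have row: "(\<Sum>l\<in>F. r ^ d k l) \<le> 2 / (1 - r)" for k
  proof -
    \<comment> \<open>The diagonal term is counted in both halves, which only enlarges the
      bound.\<close>
    have "(\<Sum>l\<in>F. r ^ d k l) \<le> (\<Sum>l\<in>{l\<in>F. l \<le> k}. r ^ d k l) + (\<Sum>l\<in>{l\<in>F. k \<le> l}. r ^ d k l)"
    proof -
      have "(\<Sum>l\<in>F. r ^ d k l) = (\<Sum>l\<in>{l\<in>F. l \<le> k} \<union> {l\<in>F. k \<le> l}. r ^ d k l)"
        by (rule sum.cong) auto
      moreover have "0 \<le> (\<Sum>l\<in>{l\<in>F. l \<le> k} \<inter> {l\<in>F. k \<le> l}. r ^ d k l)"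
        using assms by (intro sum_nonneg) auto
      ultimately show ?thesis
        using sum.union_inter[of "{l\<in>F. l \<le> k}" "{l\<in>F. k \<le> l}" "\<lambda>l. r ^ d k l"] assms(1) by simp
    qed
    also have "(\<Sum>l\<in>{l\<in>F. l \<le> k}. r ^ d k l) = (\<Sum>j\<in>(\<lambda>l. k - l) ` {l\<in>F. l \<le> k}. r ^ j)"
      by (subst sum.reindex) (auto simp: inj_on_def d_def)
    also have "... \<le> 1 / (1 - r)" using assms by (intro finite_geometric_sum_le) auto
    also have "(\<Sum>l\<in>{l\<in>F. k \<le> l}. r ^ d k l) = (\<Sum>j\<in>(\<lambda>l. l - k) ` {l\<in>F. k \<le> l}. r ^ j)"
      by (subst sum.reindex) (auto simp: inj_on_def d_def)
    also have "... \<le> 1 / (1 - r)" using assms by (intro finite_geometric_sum_le) auto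
    finally show ?thesis by simp
  qed
  have half: "(\<Sum>k\<in>F. \<Sum>l\<in>F. (c k)\<^sup>2 * r ^ d k l) \<le> (\<Sum>k\<in>F. (c k)\<^sup>2) * (2 / (1 - r))"
    unfolding sum_distrib_left[symmetric] sum_distrib_right
    by (intro sum_mono mult_left_mono row) auto
  have "(\<Sum>k\<in>F. \<Sum>l\<in>F. H k l) \<le> (\<Sum>k\<in>F. \<Sum>l\<in>F. A * ((c k)\<^sup>2 * r ^ d k l + (c l)\<^sup>2 * r ^ d k l))"
    by (intro sum_mono le)
  also have "... = A * ((\<Sum>k\<in>F. \<Sum>l\<in>F. (c k)\<^sup>2 * r ^ d k l) + (\<Sum>l\<in>F. \<Sum>k\<in>F. (c l)\<^sup>2 * r ^ d k l))"
    by (subst (2) sum.swap) (simp add: sum_distrib_left sum.distrib distrib_left)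
  also have "(\<Sum>l\<in>F. \<Sum>k\<in>F. (c l)\<^sup>2 * r ^ d k l) = (\<Sum>k\<in>F. \<Sum>l\<in>F. (c k)\<^sup>2 * r ^ d k l)"
    by (simp add: d_def add.commute)
  also have "A * ((\<Sum>k\<in>F. \<Sum>l\<in>F. (c k)\<^sup>2 * r ^ d k l) + (\<Sum>k\<in>F. \<Sum>l\<in>F. (c k)\<^sup>2 * r ^ d k l))
    \<le> A * ((\<Sum>k\<in>F. (c k)\<^sup>2) * (2 / (1 - r)) + (\<Sum>k\<in>F. (c k)\<^sup>2) * (2 / (1 - r)))"
    using assms half by (intro mult_left_mono add_mono) auto
  finally show ?thesis by (simp add: field_simps)
qed

text \<open>If x \<le> y the power is at most 1; otherwise it is at most x / y because \<tau> \<le>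
  1, and the product is at most the square of x. An imbalance of this kind between two levels is
  thus harmless.\<close>

lemma powr_mult_le_sum_squares:
  fixes x y \<tau> :: real
  assumes "0 < x" "0 < y" "0 \<le> \<tau>" "\<tau> \<le> 1"
  shows "x * y * (x / y) powr \<tau> \<le> x\<^sup>2 + y\<^sup>2"
proof (cases "x \<le> y")
  case True
  then have "(x / y) powr \<tau> \<le> 1" using assms by (intro powr_le1) auto
  then have "x * y * (x / y) powr \<tau> \<le> x * y * 1" using assms by (intro mult_left_mono) auto
  also have "... \<le> x\<^sup>2 + y\<^sup>2"
    using True assms mult_right_mono[OF True, of y] zero_le_square[of x] unfolding power2_eq_square by linarith
  finally show ?thesis .
next
  case False
  then have "(x / y) powr \<tau> \<le> (x / y) powr 1" using assms by (intro powr_mono) auto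
  then have "x * y * (x / y) powr \<tau> \<le> x * y * (x / y)" using assms by (intro mult_left_mono) auto
  also have "... = x\<^sup>2" using assms by (simp add: power2_eq_square)
  finally show ?thesis using zero_le_power2[of y] by linarith
qed

definition off_diagonal_const :: "real \<Rightarrow> real" where
  "off_diagonal_const \<gamma> = sqrt (4 * \<gamma> / (\<gamma> - 1)) + 2 / (\<gamma> - 1)"

text \<open>The exponent is 2 \<theta> / (1 + \<gamma>) with the \<theta> of
  \<open>off_diagonal_decay\<close>; the value is the decay per level when heights grow by the
  factor b.\<close>

definition off_diagonal_ratio :: "real \<Rightarrow> real \<Rightarrow> real" where
  "off_diagonal_ratio \<gamma> b = b powr (- ((\<gamma> - 1) / (2 * \<gamma> - 1) / (1 + \<gamma>)))"

text \<open>The constant delivered by \<open>Schur_geometric\<close>. It depends on \<gamma> and b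
  only, hence neither on the number of levels nor on T nor on the functions.\<close>

definition curve_sum_const :: "real \<Rightarrow> real \<Rightarrow> real" where
  "curve_sum_const \<gamma> b = 4 * off_diagonal_const \<gamma> / (1 - off_diagonal_ratio \<gamma> b)"

lemma off_diagonal_const_pos: "1 < \<gamma> \<Longrightarrow> 0 < off_diagonal_const \<gamma>"
  by (auto simp: off_diagonal_const_def intro: add_nonneg_pos)

lemma off_diagonal_ratio_bounds: "1 < \<gamma> \<Longrightarrow> 1 < b \<Longrightarrow> 0 < off_diagonal_ratio \<gamma> b \<and> off_diagonal_ratio \<gamma> b < 1"
  by (auto simp: off_diagonal_ratio_def powr_minus_divide)

lemma curve_sum_const_pos: "1 < \<gamma> \<Longrightarrow> 1 < b \<Longrightarrow> 0 < curve_sum_const \<gamma> b"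
  using off_diagonal_const_pos[of \<gamma>] off_diagonal_ratio_bounds[of \<gamma> b] by (simp add: curve_sum_const_def)

text \<open>The gain \<open>(M k / M l) powr \<theta>\<close> of \<open>off_diagonal_decay\<close>
  need not be small, since the m k are arbitrary. But for
  \<open>e k = h k * sqrt (m k * M k)\<close> and l \<le> k one has \<open>e k / e l = b ^ (k - l) *
  (M k / M l) powr ((1 + \<gamma>) / 2)\<close>. Hence the gain equals
  \<open>b powr (- \<tau> * (k - l))\<close> times \<open>(e k / e l) powr \<tau>\<close>, where
  \<tau> = 2 \<theta> / (1 + \<gamma>). The first factor decays geometrically; the second is
  absorbed by \<open>powr_mult_le_sum_squares\<close>.\<close>

lemma l2sq_sum_integral_curve_le:
  fixes \<gamma> b x\<^sub>0 D T :: real and v :: "nat \<Rightarrow> real \<Rightarrow> 'a::euclidean_space \<Rightarrow> complex"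
  assumes \<gamma>: "1 < \<gamma>" and b: "1 < b" and F: "finite F" and pos: "0 < x\<^sub>0" "0 < D" "0 \<le> T"
    and v: "\<And>k. k \<in> F \<Longrightarrow> curve T (v k)"
    and h: "\<And>k. k \<in> F \<Longrightarrow> h k = x\<^sub>0 * b ^ k" and m: "\<And>k. k \<in> F \<Longrightarrow> 0 < m k"
    and near: "\<And>k t. k \<in> F \<Longrightarrow> l2sq (v k t) \<le> (h k)\<^sup>2 * m k"
    and far: "\<And>k l s t. k \<in> F \<Longrightarrow> l \<in> F \<Longrightarrow> s \<noteq> t \<Longrightarrow>
          norm (LBINT y. v k s y * cnj (v l t y)) \<le> D * h k * h l * m k * m l * \<bar>s - t\<bar> powr (-\<gamma>)"
  shows "l2sq (\<lambda>y. \<Sum>k\<in>F. LBINT s. v k s y) \<le> curve_sum_const \<gamma> b * T * (\<Sum>k\<in>F. (h k)\<^sup>2 * m k * (D * m k) powr (1 / \<gamma>))"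
proof -
  define \<theta> where "\<theta> = (\<gamma> - 1) / (2 * (2 * \<gamma> - 1))"
  define \<tau> where "\<tau> = 2 * \<theta> / (1 + \<gamma>)"
  define r where "r = b powr (-\<tau>)"
  define A where "A = sqrt (4 * \<gamma> / (\<gamma> - 1)) + 2 / (\<gamma> - 1)"
  have \<theta>: "0 < \<theta>" "\<theta> \<le> 1" using \<gamma> by (auto simp: \<theta>_def field_simps)
  have \<tau>: "0 < \<tau>" "\<tau> \<le> 1" using \<gamma> \<theta> by (auto simp: \<tau>_def field_simps)
  have r_eq: "r = off_diagonal_ratio \<gamma> b"
  proof -
    have "2 * \<theta> = (\<gamma> - 1) / (2 * \<gamma> - 1)" using \<gamma> by (simp add: \<theta>_def divide_simps) (simp add: algebra_simps)
    then show ?thesis by (simp only: r_def off_diagonal_ratio_def \<tau>_def)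
  qed
  have r: "0 < r" "r < 1" using b \<tau> by (auto simp: r_def powr_minus_divide)
  have A_eq: "A = off_diagonal_const \<gamma>" by (simp add: A_def off_diagonal_const_def)
  have A: "0 < A" using off_diagonal_const_pos[OF \<gamma>] by (simp add: A_eq)
  define M where "M = (\<lambda>k. (D * m k) powr (1 / \<gamma>))"
  \<comment> \<open>Up to constants, the bound on the diagonal term of level k is the square of e
    k.\<close>
  define e where "e = (\<lambda>k. h k * sqrt (m k * M k))"
  define g where "g = (\<lambda>k y. LBINT s. v k s y)"
  define H where "H = (\<lambda>k l. norm (LBINT y. g k y * cnj (g l y)))"
  have hp: "0 < h k" if "k \<in> F" for k using h[OF that] pos b by simp
  have Mp: "0 < M k" if "k \<in> F" for k using m[OF that] pos by (simp add: M_def)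
  have ep: "0 < e k" if "k \<in> F" for k using m[OF that] hp[OF that] Mp[OF that] by (simp add: e_def)
  have g: "L1_bdd (g k)" if "k \<in> F" for k
    unfolding g_def by (rule curve_integral_L1_bdd[OF v[OF that]])
  have self: "norm (LBINT y. v k s y * cnj (v k t y)) \<le> (h k)\<^sup>2 * m k" if "k \<in> F" for k s t
  proof -
    have "norm (LBINT y. v k s y * cnj (v k t y)) \<le> sqrt (l2sq (v k s)) * sqrt (l2sq (v k t))"
      using Cauchy_Schwarz_l2sq[of "v k s" "\<lambda>y. cnj (v k t y)"] curve_L1_bdd[OF v[OF that]] by simp
    also have "... \<le> sqrt ((h k)\<^sup>2 * m k) * sqrt ((h k)\<^sup>2 * m k)"
      using m[OF that] by (intro mult_mono real_sqrt_le_mono near that) auto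
    also have "... = (h k)\<^sup>2 * m k" using m[OF that] by simp
    finally show ?thesis .
  qed
  have Hle: "H k l \<le> T * A * ((e k)\<^sup>2 + (e l)\<^sup>2) * r ^ (k - l)" if k: "k \<in> F" and l: "l \<in> F" and "l \<le> k" for k l
  proof -
    have "H k l \<le> T * A * (e k * e l * (M k / M l) powr \<theta>)"
      unfolding H_def g_def e_def M_def A_def \<theta>_def
    proof (rule off_diagonal_decay[OF v[OF k] v[OF l] \<gamma> pos(3) pos(2) hp[OF k] hp[OF l] m[OF k] m[OF l] self[OF k] _ near[OF l]])
      show "norm (LBINT y. v k s y * cnj (v k t y)) \<le> D * (h k)\<^sup>2 * (m k)\<^sup>2 * \<bar>s - t\<bar> powr (-\<gamma>)" if "s \<noteq> t" for s t
        using far[OF k k that] by (simp add: power2_eq_square mult_ac)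
      show "norm (LBINT y. v k s y * cnj (v l t y)) \<le> D * h k * h l * m k * m l * \<bar>s - t\<bar> powr (-\<gamma>)" if "s \<noteq> t" for s t
        by (rule far[OF k l that])
    qed
    moreover have "e k * e l * (M k / M l) powr \<theta> \<le> ((e k)\<^sup>2 + (e l)\<^sup>2) * r ^ (k - l)"
    proof -
      \<comment> \<open>Eliminating m k through \<open>D * m k = M k powr \<gamma>\<close> makes the
        height visible, so that e k / e l can be compared with the ratio of heights.\<close>
      have em: "e i = h i * M i powr ((1 + \<gamma>) / 2) / sqrt D" if "i \<in> F" for i
      proof -
        have "m i = M i powr \<gamma> / D" using pos m[OF that] \<gamma> by (simp add: M_def powr_powr)
        then have "m i * M i = M i powr (1 + \<gamma>) / D" using Mp[OF that] by (simp add: powr_add)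
        then show ?thesis using Mp[OF that] by (simp add: e_def real_sqrt_divide powr_half_sqrt[symmetric] powr_powr)
      qed
      have "e k / e l = (h k / h l) * (M k / M l) powr ((1 + \<gamma>) / 2)"
        unfolding em[OF k] em[OF l] using pos hp[OF k] hp[OF l] Mp[OF k] Mp[OF l]
        by (simp add: powr_divide)
      moreover have "h k / h l = b ^ (k - l)"
        unfolding h[OF k] h[OF l] using pos b \<open>l \<le> k\<close> by (simp add: power_diff)
      ultimately have "(M k / M l) powr ((1 + \<gamma>) / 2) = (e k / e l) * (1 / b ^ (k - l))"
        using b by simp
      then have "((M k / M l) powr ((1 + \<gamma>) / 2)) powr \<tau> = (e k / e l) powr \<tau> * (1 / b ^ (k - l)) powr \<tau>"
        by (simp only: powr_mult)
      moreover have "((M k / M l) powr ((1 + \<gamma>) / 2)) powr \<tau> = (M k / M l) powr \<theta>"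
        unfolding powr_powr using \<gamma> by (simp add: \<tau>_def)
      moreover have "(1 / b ^ (k - l)) powr \<tau> = r ^ (k - l)"
      proof -
        have "1 / b ^ (k - l) = b powr (- real (k - l))"
          using b by (simp add: powr_minus_divide powr_realpow)
        then have "(1 / b ^ (k - l)) powr \<tau> = b powr (-\<tau> * real (k - l))"
          by (simp add: powr_powr mult.commute)
        also have "... = r powr real (k - l)" by (simp only: r_def powr_powr)
        also have "... = r ^ (k - l)" using r by (simp only: powr_realpow)
        finally show ?thesis .
      qed
      ultimately have "e k * e l * (M k / M l) powr \<theta> = (e k * e l * (e k / e l) powr \<tau>) * r ^ (k - l)"
        by simp
      also have "... \<le> ((e k)\<^sup>2 + (e l)\<^sup>2) * r ^ (k - l)"
        using ep[OF k] ep[OF l] \<tau> r by (intro mult_right_mono powr_mult_le_sum_squares) auto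
      finally show ?thesis .
    qed
    then have "T * A * (e k * e l * (M k / M l) powr \<theta>) \<le> T * A * (((e k)\<^sup>2 + (e l)\<^sup>2) * r ^ (k - l))"
      using A pos by (intro mult_left_mono) auto
    ultimately show ?thesis unfolding mult.assoc by linarith
  qed
  have sym: "H k l = H l k" for k l
  proof -
    have "(LBINT y. g k y * cnj (g l y)) = (LBINT y. cnj (g l y * cnj (g k y)))" by (simp add: mult.commute)
    also have "... = cnj (LBINT y. g l y * cnj (g k y))" by (rule Bochner_Integration.integral_cnj)
    finally show ?thesis unfolding H_def by simp
  qed
  have gi: "integrable lborel (\<lambda>y. g k y * cnj (g l y))" if "k \<in> F" "l \<in> F" for k l
    using g that by (intro L1_bdd_integrable L1_bdd_mult) auto
  have "complex_of_real (l2sq (\<lambda>y. \<Sum>k\<in>F. g k y)) = (LBINT y. (\<Sum>k\<in>F. \<Sum>l\<in>F. g k y * cnj (g l y)))"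
    using l2sq_eq_inner[OF L1_bdd_sum[OF g, of F "\<lambda>k. k"]] by (simp add: sum_product)
  also have "... = (\<Sum>k\<in>F. \<Sum>l\<in>F. LBINT y. g k y * cnj (g l y))"
    using gi by (simp add: Bochner_Integration.integral_sum)
  finally have "l2sq (\<lambda>y. \<Sum>k\<in>F. g k y) = norm (\<Sum>k\<in>F. \<Sum>l\<in>F. LBINT y. g k y * cnj (g l y))"
    by (metis abs_of_nonneg l2sq_nonneg norm_of_real)
  also have "... \<le> (\<Sum>k\<in>F. \<Sum>l\<in>F. H k l)"
    unfolding H_def by (intro order_trans[OF norm_sum] sum_mono norm_sum)
  also have "... \<le> 4 * (T * A) / (1 - r) * (\<Sum>k\<in>F. (e k)\<^sup>2)"
  proof (rule Schur_geometric[OF F _ r(2) _ sym])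
    show "0 \<le> r" "0 \<le> T * A" using r A pos by auto
  qed (rule Hle)
  also have "(\<Sum>k\<in>F. (e k)\<^sup>2) = (\<Sum>k\<in>F. (h k)\<^sup>2 * m k * M k)"
    using Mp m by (intro sum.cong) (auto simp: e_def power_mult_distrib less_imp_le)
  finally show "l2sq (\<lambda>y. \<Sum>k\<in>F. LBINT s. v k s y) \<le> curve_sum_const \<gamma> b * T * (\<Sum>k\<in>F. (h k)\<^sup>2 * m k * (D * m k) powr (1 / \<gamma>))"
    unfolding g_def M_def curve_sum_const_def r_eq A_eq by (simp add: mult_ac)
qed

section \<open>Integration in Euclidean space\<close>

lemma has_bochner_integral_prod_Basis:
  fixes f :: "real \<Rightarrow> real"
  assumes f: "integrable lborel f" and nn: "\<And>x. 0 \<le> f x"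
  shows "has_bochner_integral lborel (\<lambda>z::'a::euclidean_space. \<Prod>b\<in>Basis. f (z \<bullet> b)) ((LBINT x. f x) ^ DIM('a))"
proof (rule has_bochner_integral_nn_integral)
  have [measurable]: "f \<in> borel_measurable borel" using f by auto
  show "(\<lambda>z::'a. \<Prod>b\<in>Basis. f (z \<bullet> b)) \<in> borel_measurable lborel" by measurable
  have "(\<integral>\<^sup>+z. ennreal (\<Prod>b\<in>(Basis::'a set). f (z \<bullet> b)) \<partial>lborel) = (\<integral>\<^sup>+z. (\<Prod>b\<in>(Basis::'a set). ennreal (f (z \<bullet> b))) \<partial>lborel)"
    using nn by (simp add: prod_ennreal)
  also have "... = (\<Prod>b\<in>(Basis::'a set). \<integral>\<^sup>+x. ennreal (f x) \<partial>lborel)"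
    by (rule nn_integral_lborel_prod) auto
  also have "... = (\<Prod>b\<in>(Basis::'a set). ennreal (LBINT x. f x))"
    using f nn by (simp add: nn_integral_eq_integral)
  also have "... = ennreal ((LBINT x. f x) ^ DIM('a))"
    using nn by (simp add: ennreal_power)
  finally show "(\<integral>\<^sup>+z. ennreal (\<Prod>b\<in>(Basis::'a set). f (z \<bullet> b)) \<partial>lborel) = ennreal ((LBINT x. f x) ^ DIM('a))" .
qed (use nn in \<open>auto intro: prod_nonneg\<close>)

section \<open>A common integrable majorant for Gaussians and Schwartz functions\<close>

definition cauchy_weight :: "'a::euclidean_space \<Rightarrow> real" where
  "cauchy_weight z = (\<Prod>b\<in>Basis. inverse (1 + (z \<bullet> b)\<^sup>2))"

lemma integrable_cauchy_weight: "integrable lborel (cauchy_weight :: 'a::euclidean_space \<Rightarrow> real)"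
proof -
  have "integrable lborel (\<lambda>x::real. inverse (1 + x\<^sup>2))"
    using integrable_inverse_1_plus_square by (simp add: set_integrable_def)
  from has_bochner_integral_prod_Basis[OF this, where 'a='a]
  show ?thesis unfolding cauchy_weight_def[abs_def] by (auto simp: has_bochner_integral_iff)
qed

lemma cauchy_weight_pos: "0 < cauchy_weight z"
  unfolding cauchy_weight_def by (intro prod_pos) (auto intro: add_pos_nonneg)

lemma cauchy_weight_le_1: "cauchy_weight z \<le> 1"
  unfolding cauchy_weight_def
  by (intro prod_le_1) (auto intro!: inverse_le_1_iff[THEN iffD2] simp: add_nonneg_nonneg)

text \<open>Each factor is at least 1/(1 + |z|^2). Polynomial decay is thereby traded for the
  weight, whose product form reduces its integrability to one dimension.\<close>

lemma cauchy_weight_lower: "1 \<le> (1 + (norm z)\<^sup>2) ^ DIM('a) * cauchy_weight (z::'a::euclidean_space)"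
proof -
  have "(\<Prod>b\<in>(Basis::'a set). inverse (1 + (norm z)\<^sup>2)) \<le> cauchy_weight z"
    unfolding cauchy_weight_def
  proof (intro prod_mono conjI)
    fix b :: 'a assume "b \<in> Basis"
    then have "(z \<bullet> b)\<^sup>2 \<le> (norm z)\<^sup>2"
      using Basis_le_norm[of b z] power_mono[of "\<bar>z \<bullet> b\<bar>" "norm z" 2] by simp
    moreover have "0 < 1 + (z \<bullet> b)\<^sup>2" by (auto intro: add_pos_nonneg)
    ultimately show "inverse (1 + (norm z)\<^sup>2) \<le> inverse (1 + (z \<bullet> b)\<^sup>2)" by (intro le_imp_inverse_le) auto
  qed (auto intro: add_nonneg_nonneg)
  then have "inverse ((1 + (norm z)\<^sup>2) ^ DIM('a)) \<le> cauchy_weight z" by (simp add: power_inverse)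
  moreover have p: "0 < (1 + (norm z)\<^sup>2) ^ DIM('a)" by (auto intro!: zero_less_power add_pos_nonneg)
  ultimately have le: "(1 + (norm z)\<^sup>2) ^ DIM('a) * inverse ((1 + (norm z)\<^sup>2) ^ DIM('a)) \<le> (1 + (norm z)\<^sup>2) ^ DIM('a) * cauchy_weight z"
    by (intro mult_left_mono) auto
  have "(1 + (norm z)\<^sup>2) ^ DIM('a) * inverse ((1 + (norm z)\<^sup>2) ^ DIM('a)) = 1"
    by (rule right_inverse[OF less_imp_neq[OF p, symmetric]])
  from le[unfolded this] show ?thesis .
qed

lemma power_exp_bounded:
  fixes c :: real
  assumes "0 < c"
  obtains C where "0 < C" "\<And>t. 0 \<le> t \<Longrightarrow> (1 + t) ^ n * exp (- c * t) \<le> C"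
proof (cases "n = 0")
  case True
  then show thesis using that[of 1] assms by simp
next
  case False
  show thesis
  proof (rule that[of "exp c * (real n / c) ^ n"])
    show "0 < exp c * (real n / c) ^ n" using assms False by simp
    fix t :: real assume "0 \<le> t"
    \<comment> \<open>This is x \<le> exp x at x = c (1 + t) / n, raised to the n-th power.\<close>
    have "(c * (1 + t) / n) ^ n \<le> exp (c * (1 + t) / n) ^ n"
    proof (rule power_mono)
      show "c * (1 + t) / n \<le> exp (c * (1 + t) / n)" using exp_ge_add_one_self[of "c * (1 + t) / n"] by linarith
    qed (use assms \<open>0 \<le> t\<close> in auto)
    also have "... = exp (c * (1 + t))" using False by (simp flip: exp_of_nat_mult)
    also have "... = exp c * exp (c * t)" by (simp add: distrib_left exp_add)
    also have "(c * (1 + t) / n) ^ n = (c / n) ^ n * (1 + t) ^ n"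
      by (simp flip: power_mult_distrib)
    finally have "(c / n) ^ n * (1 + t) ^ n \<le> exp c * exp (c * t)" .
    then have "((real n / c) ^ n * exp (- c * t)) * ((c / n) ^ n * (1 + t) ^ n) \<le> ((real n / c) ^ n * exp (- c * t)) * (exp c * exp (c * t))"
      using assms by (intro mult_left_mono) auto
    then have "((real n / c) ^ n * (c / n) ^ n) * ((1 + t) ^ n * exp (- c * t)) \<le> exp c * (real n / c) ^ n * (exp (- c * t) * exp (c * t))"
      by (simp only: mult_ac)
    moreover have "(real n / c) ^ n * (c / n) ^ n = 1" using assms False by (simp flip: power_mult_distrib)
    moreover have "exp (- c * t) * exp (c * t) = 1" by (simp flip: exp_add)
    ultimately show "(1 + t) ^ n * exp (- c * t) \<le> exp c * (real n / c) ^ n"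
      by (simp only: mult_1_left mult_1_right)
  qed
qed

lemma gaussian_le_cauchy_weight:
  fixes c :: real
  assumes "0 < c"
  obtains C where "0 < C" "\<And>z::'a::euclidean_space. (1 + (norm z)\<^sup>2) ^ n * exp (- c * (norm z)\<^sup>2) \<le> C * cauchy_weight z"
proof -
  \<comment> \<open>The \<open>DIM('a)\<close> additional powers pay for
    \<open>cauchy_weight_lower\<close>.\<close>
  obtain C where C: "0 < C" "\<And>t. 0 \<le> t \<Longrightarrow> (1 + t) ^ (n + DIM('a)) * exp (- c * t) \<le> C"
    using power_exp_bounded[OF assms] by blast
  show thesis
  proof (rule that[OF C(1)])
    fix z :: 'a
    have "(1 + (norm z)\<^sup>2) ^ n * exp (- c * (norm z)\<^sup>2) * 1
      \<le> (1 + (norm z)\<^sup>2) ^ n * exp (- c * (norm z)\<^sup>2) * ((1 + (norm z)\<^sup>2) ^ DIM('a) * cauchy_weight z)"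
      by (intro mult_left_mono cauchy_weight_lower) (auto intro!: mult_nonneg_nonneg zero_le_power add_nonneg_nonneg)
    also have "... = ((1 + (norm z)\<^sup>2) ^ (n + DIM('a)) * exp (- c * (norm z)\<^sup>2)) * cauchy_weight z"
      by (simp add: power_add mult_ac)
    also have "... \<le> C * cauchy_weight z"
      using C(2)[of "(norm z)\<^sup>2"] cauchy_weight_pos[of z] by (intro mult_right_mono) auto
    finally show "(1 + (norm z)\<^sup>2) ^ n * exp (- c * (norm z)\<^sup>2) \<le> C * cauchy_weight z" by simp
  qed
qed

section \<open>Translation, reflection and convolution\<close>

lemma lborel_distr_reflect:
  fixes y :: "'a::euclidean_space"
  shows "distr lborel borel (\<lambda>x. y - x) = lborel"
  using lborel_affine[of "-1" y] by (simp add: density_1)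

lemma lborel_integral_translate:
  fixes f :: "'a::euclidean_space \<Rightarrow> 'b::{banach, second_countable_topology}"
  shows "(LBINT x. f (x + c)) = (LBINT x. f x)" (is ?I)
    and "integrable lborel (\<lambda>x. f (x + c)) \<longleftrightarrow> integrable lborel f" (is ?E)
proof -
  have *: "integrable lborel (\<lambda>x. g (x + d))" if "integrable lborel g" for g :: "'a \<Rightarrow> 'b" and d
  proof -
    have "integrable (distr lborel borel ((+) d)) g" using that by (simp add: lborel_distr_plus)
    then show ?thesis using integrable_distr[of "(+) d" lborel borel g] by (simp add: add.commute)
  qed
  show E: ?E using *[of f c] *[of "\<lambda>x. f (x + c)" "-c"] by auto
  show ?I
  proof (cases "integrable lborel f")
    case True
    have "(LBINT x. f x) = (\<integral>x. f x \<partial>(distr lborel borel ((+) c)))" by (simp add: lborel_distr_plus)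
    also have "... = (LBINT x. f (c + x))" by (rule integral_distr) (use True in auto)
    finally show ?thesis by (simp add: add.commute)
  next
    case False
    \<comment> \<open>Neither side is integrable, so both integrals have the default value
      0.\<close>
    then show ?thesis using E by (simp add: not_integrable_integral_eq)
  qed
qed

lemma lborel_integral_reflect:
  fixes f :: "'a::euclidean_space \<Rightarrow> 'b::{banach, second_countable_topology}"
  assumes "integrable lborel f"
  shows "(LBINT x. f (y - x)) = (LBINT x. f x)" "integrable lborel (\<lambda>x. f (y - x))"
proof -
  have "(LBINT x. f x) = (\<integral>x. f x \<partial>(distr lborel borel (\<lambda>x. y - x)))" by (simp add: lborel_distr_reflect)
  also have "... = (LBINT x. f (y - x))" by (rule integral_distr) (use assms in auto)
  finally show "(LBINT x. f (y - x)) = (LBINT x. f x)" ..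
  have "integrable (distr lborel borel (\<lambda>x. y - x)) f" using assms by (simp add: lborel_distr_reflect)
  then show "integrable lborel (\<lambda>x. f (y - x))" using integrable_distr[of "\<lambda>x. y - x" lborel borel f] by simp
qed

lemma convolution_integrable:
  fixes A f :: "'a::euclidean_space \<Rightarrow> real"
  assumes A: "integrable lborel A" and f: "integrable lborel f"
  shows "integrable (lborel \<Otimes>\<^sub>M lborel) (\<lambda>(z, y). A (y - z) * f z)"
proof (rule lborel_pair.Fubini_integrable)
  have [measurable]: "A \<in> borel_measurable borel" "f \<in> borel_measurable borel" using A f by auto
  show "(\<lambda>(z, y). A (y - z) * f z) \<in> borel_measurable (lborel \<Otimes>\<^sub>M lborel)" by measurable
  have "(LBINT y. norm (case (z, y) of (z, y) \<Rightarrow> A (y - z) * f z)) = (LBINT y. norm (A y)) * norm (f z)" for z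
    using lborel_integral_translate(1)[of "\<lambda>y. norm (A y)" "-z"] by (simp add: abs_mult)
  then show "integrable lborel (\<lambda>z. LBINT y. norm (case (z, y) of (z, y) \<Rightarrow> A (y - z) * f z))"
    using f by simp
  show "AE z in lborel. integrable lborel (\<lambda>y. case (z, y) of (z, y) \<Rightarrow> A (y - z) * f z)"
    using lborel_integral_translate(2)[of A] A by (auto simp: diff_conv_add_uminus simp del: add_uminus_conv_diff)
qed

lemma convolution_integral:
  fixes A f :: "'a::euclidean_space \<Rightarrow> real"
  assumes A: "integrable lborel A" and f: "integrable lborel f"
  shows "integrable lborel (\<lambda>y. LBINT z. A (y - z) * f z)"
    and "(LBINT y. LBINT z. A (y - z) * f z) = (LBINT z. A z) * (LBINT z. f z)"
proof -
  note i = convolution_integrable[OF A f]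
  show "integrable lborel (\<lambda>y. LBINT z. A (y - z) * f z)"
    using lborel_pair.integrable_snd[OF i] by simp
  have "(LBINT y. LBINT z. A (y - z) * f z) = (LBINT z. LBINT y. A (y - z) * f z)"
    using lborel_pair.Fubini_integral[OF i] by simp
  also have "... = (LBINT z. (LBINT y. A y) * f z)"
    using lborel_integral_translate(1)[of A] by (simp add: diff_conv_add_uminus del: add_uminus_conv_diff)
  finally show "(LBINT y. LBINT z. A (y - z) * f z) = (LBINT z. A z) * (LBINT z. f z)" by simp
qed

section \<open>Integration by parts along a direction\<close>

definition has_dir_deriv :: "('a::euclidean_space \<Rightarrow> complex) \<Rightarrow> ('a \<Rightarrow> complex) \<Rightarrow> 'a \<Rightarrow> bool" where
  "has_dir_deriv F F' b \<longleftrightarrow> (\<forall>z. ((\<lambda>r. F (z + r *\<^sub>R b)) has_vector_derivative F' z) (at 0))"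

lemma has_dir_deriv_line:
  assumes "has_dir_deriv F F' b"
  shows "((\<lambda>r. F (z + r *\<^sub>R b)) has_vector_derivative F' (z + r *\<^sub>R b)) (at r)"
proof -
  have "((\<lambda>x. x - r) has_vector_derivative 1) (at r)" by (auto intro!: derivative_eq_intros)
  moreover have "((\<lambda>t. F ((z + r *\<^sub>R b) + t *\<^sub>R b)) has_vector_derivative F' (z + r *\<^sub>R b)) (at (r - r))"
    using assms by (simp add: has_dir_deriv_def)
  ultimately have "((\<lambda>t. F ((z + r *\<^sub>R b) + t *\<^sub>R b)) \<circ> (\<lambda>x. x - r) has_vector_derivative 1 *\<^sub>R F' (z + r *\<^sub>R b)) (at r)"
    by (rule vector_diff_chain_at)
  then show ?thesis by (simp add: o_def algebra_simps)
qed

lemma has_dir_deriv_mult: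
  assumes "has_dir_deriv F F' b" "has_dir_deriv G G' b"
  shows "has_dir_deriv (\<lambda>z. F z * G z) (\<lambda>z. F z * G' z + F' z * G z) b"
  unfolding has_dir_deriv_def
proof
  fix z
  show "((\<lambda>r. F (z + r *\<^sub>R b) * G (z + r *\<^sub>R b)) has_vector_derivative F z * G' z + F' z * G z) (at 0)"
    using has_vector_derivative_mult[OF assms[unfolded has_dir_deriv_def, rule_format], of z z] by simp
qed

text \<open>By translation invariance F (z + b) - F z integrates to zero. By the fundamental theorem
  on the segment from z to z + b and Fubini, the same integral is an average over r in [0, 1] of
  translates of the integral of F', all of them equal. Boundary terms at infinity never
  arise.\<close>

lemma integral_dir_deriv_eq_0:
  assumes der: "has_dir_deriv F F' b" and cont: "continuous_on UNIV F'"
    and F: "integrable lborel F" and F': "integrable lborel F'"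
  shows "(LBINT z. F' z) = 0"
proof -
  define ind where "ind = (indicator {0..1} :: real \<Rightarrow> real)"
  have F'm: "F' \<in> borel_measurable borel" using F' by auto
  have ftc: "(LBINT r. ind r *\<^sub>R F' (z + r *\<^sub>R b)) = F (z + b) - F z" for z
  proof -
    have "(LBINT r. indicator {0..1} r *\<^sub>R F' (z + r *\<^sub>R b)) = F (z + 1 *\<^sub>R b) - F (z + 0 *\<^sub>R b)"
    proof (rule integral_FTC_atLeastAtMost)
      show "continuous_on {0..1} (\<lambda>r. F' (z + r *\<^sub>R b))"
        by (intro continuous_on_compose2[OF cont] continuous_intros) auto
    qed (auto intro: has_vector_derivative_at_within[OF has_dir_deriv_line[OF der]])
    then show ?thesis by (simp add: ind_def)
  qed
  have "integrable (lborel \<Otimes>\<^sub>M lborel) (\<lambda>(r, z). ind r *\<^sub>R F' (z + r *\<^sub>R b))"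
  proof (rule lborel_pair.Fubini_integrable)
    show "(\<lambda>(r, z). ind r *\<^sub>R F' (z + r *\<^sub>R b)) \<in> borel_measurable (lborel \<Otimes>\<^sub>M lborel)"
      using F'm unfolding ind_def by measurable
    show "integrable lborel (\<lambda>r. LBINT z. norm (case (r, z) of (r, z) \<Rightarrow> ind r *\<^sub>R F' (z + r *\<^sub>R b)))"
      using integrable_indicator_Icc[of 0 1] lborel_integral_translate(1)[of "\<lambda>z. norm (F' z)"]
      by (simp add: ind_def)
    show "AE r in lborel. integrable lborel (\<lambda>z. case (r, z) of (r, z) \<Rightarrow> ind r *\<^sub>R F' (z + r *\<^sub>R b))"
      using lborel_integral_translate(2)[of F'] F' by auto
  qed
  from lborel_pair.Fubini_integral[OF this]
  have "(LBINT z. F (z + b) - F z) = (LBINT r. LBINT z. ind r *\<^sub>R F' (z + r *\<^sub>R b))"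
    by (simp add: ftc)
  also have "... = (LBINT r. ind r *\<^sub>R (LBINT z. F' z))"
    using lborel_integral_translate(1)[of F'] by simp
  also have "... = (LBINT z. F' z)"
    using integrable_indicator_Icc[of 0 1] by (simp add: ind_def)
  also have "(LBINT z. F (z + b) - F z) = 0"
    using F lborel_integral_translate[of F b] by simp
  finally show ?thesis by simp
qed

text \<open>Only pure second derivatives are recorded, because the operators considered are signed
  sums of these.\<close>

definition C2_dir :: "('a::euclidean_space \<Rightarrow> complex) \<Rightarrow> ('a \<Rightarrow> 'a \<Rightarrow> complex) \<Rightarrow> ('a \<Rightarrow> 'a \<Rightarrow> complex) \<Rightarrow> bool" where
  "C2_dir u u1 u2 \<longleftrightarrow> continuous_on UNIV u \<and> L1_bdd u \<and>
     (\<forall>b\<in>Basis. has_dir_deriv u (u1 b) b \<and> has_dir_deriv (u1 b) (u2 b) b \<and>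
        continuous_on UNIV (u1 b) \<and> continuous_on UNIV (u2 b) \<and> L1_bdd (u1 b) \<and> L1_bdd (u2 b))"

text \<open>The derivatives of F u1 and of F1 u both integrate to zero; the mixed term F1 u1 cancels
  in the difference.\<close>

lemma Green_dir:
  assumes F: "C2_dir F F1 F2" and u: "C2_dir u u1 u2" and b: "b \<in> Basis"
  shows "(LBINT z. F2 b z * u z) = (LBINT z. F z * u2 b z)"
proof -
  note F' = F[unfolded C2_dir_def] and u' = u[unfolded C2_dir_def]
  have i: "integrable lborel (\<lambda>z. F z * u2 b z)" "integrable lborel (\<lambda>z. F1 b z * u1 b z)" "integrable lborel (\<lambda>z. F2 b z * u z)"
    "integrable lborel (\<lambda>z. F z * u1 b z)" "integrable lborel (\<lambda>z. F1 b z * u z)"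
    using F' u' b by (auto intro!: L1_bdd_integrable L1_bdd_mult)
  have "(LBINT z. F z * u2 b z + F1 b z * u1 b z) = 0"
    using F' u' b i
    by (intro integral_dir_deriv_eq_0[OF has_dir_deriv_mult] continuous_intros Bochner_Integration.integrable_add) auto
  moreover have "(LBINT z. F1 b z * u1 b z + F2 b z * u z) = 0"
    using F' u' b i
    by (intro integral_dir_deriv_eq_0[OF has_dir_deriv_mult] continuous_intros Bochner_Integration.integrable_add) auto
  ultimately show ?thesis using i by (simp add: add_eq_0_iff)
qed

section \<open>The oscillatory Gaussian kernel\<close>

lemma norm_sq_eq_sum_Basis: "(norm z)\<^sup>2 = (\<Sum>b\<in>Basis. (z \<bullet> b)\<^sup>2)"
  unfolding power2_norm_eq_inner by (subst euclidean_inner) (simp add: power2_eq_square)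

text \<open>One sign per coordinate covers the Laplacian, the wave operator and every other
  signature at once; \<epsilon> is the strength of the heat regularisation.\<close>

locale oscillatory_kernel =
  fixes sg :: "'a::euclidean_space \<Rightarrow> real" and \<epsilon> :: real
  assumes sg: "b \<in> Basis \<Longrightarrow> (sg b)\<^sup>2 = 1" and \<epsilon>: "0 < \<epsilon>"
begin

text \<open>A complex heat time: in direction b the regularised group acts as the heat semigroup at
  time \<zeta>.\<close>

definition \<zeta> :: "'a \<Rightarrow> real \<Rightarrow> complex" where
  "\<zeta> b s = Complex \<epsilon> (sg b * s)"

text \<open>The Gaussian kernel of \<open>exp (\<epsilon>\<Delta> + is (\<Sum>b. sg b \<partial>\<^sub>b\<^sup>2))\<close>. Writing the normalising factor as an
  exponential of principal logarithms makes it smooth in \<open>s\<close> and avoids a choice of square roots.\<close>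

definition K :: "real \<Rightarrow> 'a \<Rightarrow> complex" where
  "K s z = exp (\<Sum>b\<in>Basis. - (of_real (z \<bullet> b))\<^sup>2 / (4 * \<zeta> b s) - Ln (4 * of_real pi * \<zeta> b s) / 2)"

definition K1 :: "real \<Rightarrow> 'a \<Rightarrow> 'a \<Rightarrow> complex" where
  "K1 s b z = - of_real (z \<bullet> b) / (2 * \<zeta> b s) * K s z"

definition K2 :: "real \<Rightarrow> 'a \<Rightarrow> 'a \<Rightarrow> complex" where
  "K2 s b z = ((of_real (z \<bullet> b))\<^sup>2 / (4 * (\<zeta> b s)\<^sup>2) - 1 / (2 * \<zeta> b s)) * K s z"

definition KB :: "real \<Rightarrow> 'a \<Rightarrow> complex" where
  "KB s z = (\<Sum>b\<in>Basis. of_real (sg b) * K2 s b z)"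

lemma \<zeta>_simps [simp]: "Re (\<zeta> b s) = \<epsilon>" "Im (\<zeta> b s) = sg b * s"
  by (auto simp: \<zeta>_def)

lemma \<zeta>_nonzero [simp]: "\<zeta> b s \<noteq> 0"
  using \<epsilon> \<zeta>_simps(1) by (metis less_irrefl zero_complex.sel(1))

lemma \<zeta>_notin_nonpos: "4 * of_real pi * \<zeta> b s \<notin> \<real>\<^sub>\<le>\<^sub>0"
  using \<epsilon> pi_gt_zero by (auto simp: complex_nonpos_Reals_iff mult_le_0_iff simp del: pi_gt_zero)

lemma norm_\<zeta>: "b \<in> Basis \<Longrightarrow> (norm (\<zeta> b s))\<^sup>2 = \<epsilon>\<^sup>2 + s\<^sup>2"
  using sg[of b] by (simp add: cmod_power2 power_mult_distrib)

lemma norm_\<zeta>_ge: "\<epsilon> \<le> norm (\<zeta> b s)"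
  using complex_Re_le_cmod[of "\<zeta> b s"] by simp

text \<open>All directions share the modulus sqrt (\<epsilon>^2 + s^2) of \<zeta>, because the signs
  square to 1, and also the real part \<epsilon> / (\<epsilon>^2 + s^2) of 1/\<zeta>. This is why
  the wave operator disperses like a Laplacian.\<close>

lemma norm_K: "norm (K s z) = (4 * pi * sqrt (\<epsilon>\<^sup>2 + s\<^sup>2)) powr (- real DIM('a) / 2) * exp (- (\<epsilon> / (4 * (\<epsilon>\<^sup>2 + s\<^sup>2))) * (norm z)\<^sup>2)"
proof -
  define L where "L = ln (4 * pi * sqrt (\<epsilon>\<^sup>2 + s\<^sup>2))"
  have p: "0 < \<epsilon>\<^sup>2 + s\<^sup>2" using \<epsilon> by (auto intro: add_pos_nonneg)
  have "Re (- (of_real (z \<bullet> b))\<^sup>2 / (4 * \<zeta> b s) - Ln (4 * of_real pi * \<zeta> b s) / 2) = - (\<epsilon> / (4 * (\<epsilon>\<^sup>2 + s\<^sup>2))) * (z \<bullet> b)\<^sup>2 - L / 2"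
    if b: "b \<in> Basis" for b
  proof -
    have "norm (\<zeta> b s) = sqrt (\<epsilon>\<^sup>2 + s\<^sup>2)" using norm_\<zeta>[OF b, of s] by (metis norm_ge_zero real_sqrt_unique)
    then have 1: "Re (Ln (4 * of_real pi * \<zeta> b s)) = L" unfolding L_def by (simp add: norm_mult)
    have "Re (1 / \<zeta> b s) = \<epsilon> / (\<epsilon>\<^sup>2 + s\<^sup>2)"
      using norm_\<zeta>[OF b, of s] by (simp add: Re_divide cmod_power2)
    moreover have "- (of_real (z \<bullet> b))\<^sup>2 / (4 * \<zeta> b s) = of_real (- ((z \<bullet> b)\<^sup>2) / 4) * (1 / \<zeta> b s)" by simp
    ultimately have "Re (- (of_real (z \<bullet> b))\<^sup>2 / (4 * \<zeta> b s)) = (- ((z \<bullet> b)\<^sup>2) / 4) * (\<epsilon> / (\<epsilon>\<^sup>2 + s\<^sup>2))"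
      by (simp only: Re_complex_of_real times_complex.sel Im_complex_of_real mult_zero_left diff_zero)
    moreover have "Re (A - X / 2) = Re A - Re X / 2" for A X by simp
    ultimately show ?thesis using 1 by simp
  qed
  then have "norm (K s z) = exp (\<Sum>b\<in>(Basis::'a set). - (\<epsilon> / (4 * (\<epsilon>\<^sup>2 + s\<^sup>2))) * (z \<bullet> b)\<^sup>2 - L / 2)"
    unfolding K_def norm_exp_eq_Re Re_sum by (intro arg_cong[where f=exp] sum.cong) auto
  also have "(\<Sum>b\<in>(Basis::'a set). - (\<epsilon> / (4 * (\<epsilon>\<^sup>2 + s\<^sup>2))) * (z \<bullet> b)\<^sup>2 - L / 2)
    = - (\<epsilon> / (4 * (\<epsilon>\<^sup>2 + s\<^sup>2))) * (norm z)\<^sup>2 + (- real DIM('a) / 2) * L"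
  proof -
    have "(norm z)\<^sup>2 = (\<Sum>b\<in>Basis. (z \<bullet> b)\<^sup>2)"
      by (rule norm_sq_eq_sum_Basis)
    then show ?thesis by (simp add: sum_subtractf sum_distrib_left)
  qed
  also have "exp (- (\<epsilon> / (4 * (\<epsilon>\<^sup>2 + s\<^sup>2))) * (norm z)\<^sup>2 + (- real DIM('a) / 2) * L)
    = exp ((- real DIM('a) / 2) * L) * exp (- (\<epsilon> / (4 * (\<epsilon>\<^sup>2 + s\<^sup>2))) * (norm z)\<^sup>2)"
    by (simp add: exp_add[symmetric])
  also have "exp ((- real DIM('a) / 2) * L) = (4 * pi * sqrt (\<epsilon>\<^sup>2 + s\<^sup>2)) powr (- real DIM('a) / 2)"
    unfolding L_def powr_def using p by auto
  finally show ?thesis .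
qed

text \<open>The bound is uniform in \<epsilon> and so survives the removal of the
  regularisation.\<close>

lemma norm_K_le_dispersive:
  assumes "s \<noteq> 0"
  shows "norm (K s z) \<le> \<bar>s\<bar> powr (- real DIM('a) / 2)"
proof -
  have "\<bar>s\<bar> \<le> sqrt (\<epsilon>\<^sup>2 + s\<^sup>2)" by (rule real_le_rsqrt) auto
  also have "... \<le> 4 * pi * sqrt (\<epsilon>\<^sup>2 + s\<^sup>2)"
  proof -
    have "1 * sqrt (\<epsilon>\<^sup>2 + s\<^sup>2) \<le> (4 * pi) * sqrt (\<epsilon>\<^sup>2 + s\<^sup>2)"
      using pi_gt3 by (intro mult_right_mono) auto
    then show ?thesis by simp
  qed
  finally have "(4 * pi * sqrt (\<epsilon>\<^sup>2 + s\<^sup>2)) powr (- real DIM('a) / 2) \<le> \<bar>s\<bar> powr (- real DIM('a) / 2)"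
    using assms by (intro powr_mono2') auto
  moreover have "exp (- (\<epsilon> / (4 * (\<epsilon>\<^sup>2 + s\<^sup>2))) * (norm z)\<^sup>2) \<le> 1" using \<epsilon> by simp
  ultimately show ?thesis unfolding norm_K
    by (meson mult_left_le order_trans powr_ge_zero)
qed

lemma norm_K_le:
  assumes "\<bar>s\<bar> \<le> T"
  shows "norm (K s z) \<le> (4 * pi * \<epsilon>) powr (- real DIM('a) / 2) * exp (- (\<epsilon> / (4 * (\<epsilon>\<^sup>2 + T\<^sup>2))) * (norm z)\<^sup>2)"
  unfolding norm_K
proof (intro mult_mono)
  have "\<epsilon> \<le> sqrt (\<epsilon>\<^sup>2 + s\<^sup>2)" by (rule real_le_rsqrt) auto
  then show "(4 * pi * sqrt (\<epsilon>\<^sup>2 + s\<^sup>2)) powr (- real DIM('a) / 2) \<le> (4 * pi * \<epsilon>) powr (- real DIM('a) / 2)"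
    using \<epsilon> by (intro powr_mono2') auto
  have "s\<^sup>2 \<le> T\<^sup>2" using assms abs_le_square_iff[of s T] by linarith
  then have "\<epsilon> / (4 * (\<epsilon>\<^sup>2 + T\<^sup>2)) \<le> \<epsilon> / (4 * (\<epsilon>\<^sup>2 + s\<^sup>2))"
    using \<epsilon> by (intro divide_left_mono) (auto intro!: mult_pos_pos add_pos_nonneg)
  then show "exp (- (\<epsilon> / (4 * (\<epsilon>\<^sup>2 + s\<^sup>2))) * (norm z)\<^sup>2) \<le> exp (- (\<epsilon> / (4 * (\<epsilon>\<^sup>2 + T\<^sup>2))) * (norm z)\<^sup>2)"
    unfolding exp_le_cancel_iff minus_mult_left[symmetric] neg_le_iff_le by (intro mult_right_mono) auto
qed auto

lemma norm_K1_le: "b \<in> Basis \<Longrightarrow> norm (K1 s b z) \<le> (1 / \<epsilon> + 1 / \<epsilon>\<^sup>2) * (1 + (norm z)\<^sup>2) * norm (K s z)"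
  and norm_K2_le: "b \<in> Basis \<Longrightarrow> norm (K2 s b z) \<le> (1 / \<epsilon> + 1 / \<epsilon>\<^sup>2) * (1 + (norm z)\<^sup>2) * norm (K s z)"
proof -
  assume b: "b \<in> Basis"
  have zb: "\<bar>z \<bullet> b\<bar> \<le> norm z" using Basis_le_norm[OF b] .
  have zb2: "(z \<bullet> b)\<^sup>2 \<le> (norm z)\<^sup>2" using zb power_mono[of "\<bar>z \<bullet> b\<bar>" "norm z" 2] by simp
  have n1: "norm z \<le> 1 + (norm z)\<^sup>2"
    \<comment> \<open>The square of |z| - 1/2 being nonnegative gives |z| \<le> |z|^2 + 1/4.\<close>
    using zero_le_power2[of "norm z - 1/2"] by (simp add: power2_eq_square algebra_simps)
  have i1: "1 / norm (\<zeta> b s) \<le> 1 / \<epsilon>" using norm_\<zeta>_ge[of b s] \<epsilon> by (intro divide_left_mono) auto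
  have i2: "1 / (norm (\<zeta> b s))\<^sup>2 \<le> 1 / \<epsilon>\<^sup>2" using norm_\<zeta>_ge[of b s] \<epsilon> by (intro divide_left_mono power_mono) auto
  have "norm (- of_real (z \<bullet> b) / (2 * \<zeta> b s)) = \<bar>z \<bullet> b\<bar> * (1 / norm (\<zeta> b s)) / 2"
    by (simp add: norm_divide norm_mult)
  also have "... \<le> (1 + (norm z)\<^sup>2) * (1 / \<epsilon>) / 2"
    using zb n1 i1 \<epsilon> by (intro divide_right_mono mult_mono) auto
  also have "... \<le> (1 / \<epsilon> + 1 / \<epsilon>\<^sup>2) * (1 + (norm z)\<^sup>2)"
  proof -
    have "0 \<le> (1 / \<epsilon>) * (1 + (norm z)\<^sup>2)" "0 \<le> (1 / \<epsilon>\<^sup>2) * (1 + (norm z)\<^sup>2)" using \<epsilon> by auto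
    moreover have "x / 2 \<le> x + y" if "0 \<le> x" "0 \<le> y" for x y :: real using that by linarith
    ultimately show ?thesis unfolding distrib_right[of "1 / \<epsilon>" "1 / \<epsilon>\<^sup>2"] mult.commute[of "1 + (norm z)\<^sup>2" "1 / \<epsilon>"] by blast
  qed
  finally show "norm (K1 s b z) \<le> (1 / \<epsilon> + 1 / \<epsilon>\<^sup>2) * (1 + (norm z)\<^sup>2) * norm (K s z)"
    unfolding K1_def norm_mult by (intro mult_right_mono) auto
  have "norm ((of_real (z \<bullet> b))\<^sup>2 / (4 * (\<zeta> b s)\<^sup>2) - 1 / (2 * \<zeta> b s))
    \<le> norm ((of_real (z \<bullet> b) :: complex)\<^sup>2 / (4 * (\<zeta> b s)\<^sup>2)) + norm (1 / (2 * \<zeta> b s))" by (rule norm_triangle_ineq4)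
  also have "... = (z \<bullet> b)\<^sup>2 * (1 / (norm (\<zeta> b s))\<^sup>2) / 4 + (1 / norm (\<zeta> b s)) / 2"
    by (simp add: norm_divide norm_mult norm_power)
  also have "... \<le> (norm z)\<^sup>2 * (1 / \<epsilon>\<^sup>2) / 4 + (1 / \<epsilon>) / 2"
    using zb2 i1 i2 \<epsilon> by (intro add_mono divide_right_mono mult_mono) auto
  also have "... \<le> (1 / \<epsilon> + 1 / \<epsilon>\<^sup>2) * (1 + (norm z)\<^sup>2)"
  proof -
    have "n * y / 4 + x / 2 \<le> (x + y) * (1 + n)" if "0 \<le> x" "0 \<le> y" "0 \<le> n" for x y n :: real
    proof -
      have "0 \<le> x * n" "0 \<le> n * y" using that by auto
      moreover have "(x + y) * (1 + n) = x + y + x * n + n * y" by (simp add: algebra_simps)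
      ultimately show ?thesis using that by linarith
    qed
    from this[of "1 / \<epsilon>" "1 / \<epsilon>\<^sup>2" "(norm z)\<^sup>2"] show ?thesis using \<epsilon> by auto
  qed
  finally show "norm (K2 s b z) \<le> (1 / \<epsilon> + 1 / \<epsilon>\<^sup>2) * (1 + (norm z)\<^sup>2) * norm (K s z)"
    unfolding K2_def norm_mult by (intro mult_right_mono) auto
qed

text \<open>The constant may blow up as \<epsilon> tends to 0 or T grows. The bound serves
  qualitative purposes only: integrability, Fubini and common majorants on a bounded time
  interval.\<close>

lemma kernels_le_cauchy_weight:
  obtains C where "0 < C" "\<And>s z. \<bar>s\<bar> \<le> T \<Longrightarrow> norm (K s z) \<le> C * cauchy_weight z"
    "\<And>s z b. \<bar>s\<bar> \<le> T \<Longrightarrow> b \<in> Basis \<Longrightarrow> norm (K1 s b z) \<le> C * cauchy_weight z"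
    "\<And>s z b. \<bar>s\<bar> \<le> T \<Longrightarrow> b \<in> Basis \<Longrightarrow> norm (K2 s b z) \<le> C * cauchy_weight z"
    "\<And>s z. \<bar>s\<bar> \<le> T \<Longrightarrow> norm (KB s z) \<le> C * cauchy_weight z"
proof -
  define c where "c = \<epsilon> / (4 * (\<epsilon>\<^sup>2 + T\<^sup>2))"
  define A where "A = (4 * pi * \<epsilon>) powr (- real DIM('a) / 2)"
  define B where "B = 1 + 1 / \<epsilon> + 1 / \<epsilon>\<^sup>2"
  have c: "0 < c" unfolding c_def using \<epsilon> by (auto intro!: divide_pos_pos mult_pos_pos add_pos_nonneg)
  have A: "0 < A" unfolding A_def using \<epsilon> by simp
  have B: "1 \<le> B" "1 / \<epsilon> + 1 / \<epsilon>\<^sup>2 \<le> B" using \<epsilon> by (auto simp: B_def)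
  obtain C where C: "0 < C" "\<And>z::'a. (1 + (norm z)\<^sup>2) ^ 1 * exp (- c * (norm z)\<^sup>2) \<le> C * cauchy_weight z"
    using gaussian_le_cauchy_weight[OF c] by blast
  have KC: "B * (1 + (norm z)\<^sup>2) * norm (K s z) \<le> (B * A * C) * cauchy_weight z" if "\<bar>s\<bar> \<le> T" for s z
  proof -
    have "B * (1 + (norm z)\<^sup>2) * norm (K s z) \<le> B * (1 + (norm z)\<^sup>2) * (A * exp (- c * (norm z)\<^sup>2))"
      using norm_K_le[OF that, of z] B unfolding A_def c_def by (intro mult_left_mono) (auto intro!: mult_nonneg_nonneg add_nonneg_nonneg)
    also have "... = B * A * ((1 + (norm z)\<^sup>2) ^ 1 * exp (- c * (norm z)\<^sup>2))" by simp
    also have "... \<le> B * A * (C * cauchy_weight z)" using A B C(2)[of z] by (intro mult_left_mono) auto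
    finally show ?thesis by simp
  qed
  have K0: "norm (K s z) \<le> (B * A * C) * cauchy_weight z" if "\<bar>s\<bar> \<le> T" for s z
  proof -
    have "1 * 1 \<le> B * (1 + (norm z)\<^sup>2)" using B by (intro mult_mono) auto
    then have "1 * norm (K s z) \<le> B * (1 + (norm z)\<^sup>2) * norm (K s z)" by (intro mult_right_mono) auto
    then show ?thesis using KC[OF that, of z] by simp
  qed
  have K12: "norm k \<le> (B * A * C) * cauchy_weight z"
    if "\<bar>s\<bar> \<le> T" "norm k \<le> (1 / \<epsilon> + 1 / \<epsilon>\<^sup>2) * (1 + (norm z)\<^sup>2) * norm (K s z)" for k :: complex and s z
  proof -
    have "(1 / \<epsilon> + 1 / \<epsilon>\<^sup>2) * (1 + (norm z)\<^sup>2) * norm (K s z) \<le> B * (1 + (norm z)\<^sup>2) * norm (K s z)"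
      using B by (intro mult_right_mono) (auto intro!: add_nonneg_nonneg)
    then show ?thesis using KC[OF that(1), of z] that(2) by linarith
  qed
  define D where "D = B * A * C"
  have D: "0 < D" using A B C by (auto simp: D_def)
  have d1: "1 \<le> real DIM('a)" using DIM_positive[where 'a='a] by linarith
  show thesis
  \<comment> \<open>The factor \<open>DIM('a)\<close> is the number of terms in
    \<open>KB\<close>.\<close>
  proof (rule that[of "real DIM('a) * D"])
    show "0 < real DIM('a) * D" using D d1 by simp
    have up: "x \<le> real DIM('a) * D * cauchy_weight z" if "x \<le> B * A * C * cauchy_weight z" for x and z :: 'a
    proof -
      have "1 * (D * cauchy_weight z) \<le> real DIM('a) * (D * cauchy_weight z)"
        using d1 D cauchy_weight_pos[of z] by (intro mult_right_mono) auto
      then show ?thesis using that by (simp add: D_def mult.assoc)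
    qed
    show "norm (K s z) \<le> real DIM('a) * D * cauchy_weight z" if "\<bar>s\<bar> \<le> T" for s z
      by (rule up[OF K0[OF that]])
    show "norm (K1 s b z) \<le> real DIM('a) * D * cauchy_weight z" if "\<bar>s\<bar> \<le> T" "b \<in> Basis" for s z b
      by (rule up[OF K12[OF that(1) norm_K1_le[OF that(2)]]])
    show "norm (K2 s b z) \<le> real DIM('a) * D * cauchy_weight z" if "\<bar>s\<bar> \<le> T" "b \<in> Basis" for s z b
      by (rule up[OF K12[OF that(1) norm_K2_le[OF that(2)]]])
    show "norm (KB s z) \<le> real DIM('a) * D * cauchy_weight z" if "\<bar>s\<bar> \<le> T" for s z
    proof -
      have "norm (of_real (sg b) * K2 s b z) \<le> D * cauchy_weight z" if "b \<in> Basis" for b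
      proof -
        have "\<bar>sg b\<bar> = 1" using sg[OF that] by (metis abs_1 abs_power2 one_power2 power2_eq_iff_nonneg abs_ge_zero power2_abs zero_le_one)
        then show ?thesis using K12[OF \<open>\<bar>s\<bar> \<le> T\<close> norm_K2_le[OF that]] by (simp add: norm_mult D_def)
      qed
      then have "norm (KB s z) \<le> (\<Sum>b\<in>(Basis::'a set). D * cauchy_weight z)"
        unfolding KB_def by (rule sum_norm_le)
      then show ?thesis by simp
    qed
  qed
qed

lemma continuous_\<zeta>: "continuous_on S (\<lambda>p::real \<times> 'a. \<zeta> b (fst p))"
  unfolding \<zeta>_def Complex_eq by (intro continuous_intros)

lemma continuous_K: "continuous_on UNIV (\<lambda>p. K (fst p) (snd p))"
  unfolding K_def by (intro continuous_intros continuous_\<zeta>) (use \<zeta>_notin_nonpos in auto)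

lemma continuous_K2: "continuous_on UNIV (\<lambda>p. K2 (fst p) b (snd p))"
  unfolding K2_def by (intro continuous_intros continuous_K continuous_\<zeta>) auto

lemma continuous_K1: "continuous_on UNIV (\<lambda>p. K1 (fst p) b (snd p))"
  unfolding K1_def by (intro continuous_intros continuous_K continuous_\<zeta>) auto

lemma continuous_KB: "continuous_on UNIV (\<lambda>p. KB (fst p) (snd p))"
  unfolding KB_def by (intro continuous_intros continuous_K2)

lemma measurable_K [measurable]: "(\<lambda>p. K (fst p) (snd p)) \<in> borel_measurable (borel \<Otimes>\<^sub>M borel)"
  using borel_measurable_continuous_onI[OF continuous_K] by (simp add: borel_prod)

lemma continuous_slice:
  assumes "continuous_on UNIV (\<lambda>p::real \<times> 'a. F (fst p) (snd p) :: complex)"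
  shows "continuous_on UNIV (F s)"
proof -
  have "continuous_on UNIV (\<lambda>z::'a. (s, z))" by (intro continuous_intros)
  from continuous_on_compose2[OF assms this] show ?thesis by simp
qed

lemma K_has_dir_deriv:
  assumes b: "b \<in> Basis"
  shows "has_dir_deriv (K s) (K1 s b) b" "has_dir_deriv (K1 s b) (K2 s b) b"
proof -
  have K: "((\<lambda>r. K s (z + r *\<^sub>R b)) has_vector_derivative K1 s b z) (at 0)" for z
  proof -
    \<comment> \<open>The exponent of K along the line through z, as a holomorphic function of the
      displacement; by orthogonality only the direction b contributes to its derivative.\<close>
    define E where "E = (\<lambda>w::complex. \<Sum>c\<in>Basis. - (of_real (z \<bullet> c) + w * of_real (b \<bullet> c))\<^sup>2 / (4 * \<zeta> c s) - Ln (4 * of_real pi * \<zeta> c s) / 2)"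
    have "(E has_field_derivative (\<Sum>c\<in>Basis. - (2 * of_real (z \<bullet> c) * of_real (b \<bullet> c)) / (4 * \<zeta> c s))) (at 0)"
      unfolding E_def by (auto intro!: derivative_eq_intros sum.cong)
    also have "(\<Sum>c\<in>Basis. - (2 * of_real (z \<bullet> c) * of_real (b \<bullet> c)) / (4 * \<zeta> c s))
      = (\<Sum>c\<in>Basis. if c = b then - of_real (z \<bullet> b) / (2 * \<zeta> b s) else 0)"
      using b by (intro sum.cong) (auto simp: inner_Basis)
    also have "... = - of_real (z \<bullet> b) / (2 * \<zeta> b s)" using b by simp
    finally have "((\<lambda>w. exp (E w)) has_field_derivative exp (E 0) * (- of_real (z \<bullet> b) / (2 * \<zeta> b s))) (at 0)"
      by (rule DERIV_fun_exp)
    from has_vector_derivative_real_field[of _ _ 0, simplified, OF this]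
    have "((\<lambda>r. exp (E (of_real r))) has_vector_derivative exp (E 0) * (- of_real (z \<bullet> b) / (2 * \<zeta> b s))) (at 0)" .
    moreover have "exp (E (of_real r)) = K s (z + r *\<^sub>R b)" for r
      unfolding E_def K_def by (simp add: inner_add_left)
    moreover have "exp (E 0) * (- of_real (z \<bullet> b) / (2 * \<zeta> b s)) = K1 s b z"
      unfolding E_def K1_def K_def by simp
    ultimately show ?thesis by simp
  qed
  then show "has_dir_deriv (K s) (K1 s b) b" by (simp add: has_dir_deriv_def)
  show "has_dir_deriv (K1 s b) (K2 s b) b"
    unfolding has_dir_deriv_def
  proof
    fix z
    have "((\<lambda>r. of_real r) has_vector_derivative (1::complex)) (at 0)"
      by (auto intro!: derivative_eq_intros)
    then have "((\<lambda>r. - (of_real (z \<bullet> b) + of_real r) / (2 * \<zeta> b s)) has_vector_derivative - 1 / (2 * \<zeta> b s)) (at 0)"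
      by (auto intro!: derivative_eq_intros)
    from has_vector_derivative_mult[OF this K]
    have "((\<lambda>r. - (of_real (z \<bullet> b) + of_real r) / (2 * \<zeta> b s) * K s (z + r *\<^sub>R b)) has_vector_derivative
       - of_real (z \<bullet> b) / (2 * \<zeta> b s) * K1 s b z + - 1 / (2 * \<zeta> b s) * K s z) (at 0)" by simp
    moreover have "(of_real (z \<bullet> b) + of_real r :: complex) = of_real ((z + r *\<^sub>R b) \<bullet> b)" for r
      using b by (simp add: inner_add_left)
    moreover have "- of_real (z \<bullet> b) / (2 * \<zeta> b s) * K1 s b z + - 1 / (2 * \<zeta> b s) * K s z = K2 s b z"
      unfolding K1_def K2_def by (simp add: field_simps power2_eq_square)
    ultimately show "((\<lambda>r. K1 s b (z + r *\<^sub>R b)) has_vector_derivative K2 s b z) (at 0)"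
      by (simp add: K1_def)
  qed
qed

text \<open>The Schroedinger equation of the kernel. The time derivative of \<zeta> is \<i> times
  the sign, and differentiating the exponent with respect to \<zeta> gives x^2 / (4 \<zeta>^2) - 1 /
  (2 \<zeta>), the factor in \<open>K2\<close>; its second term stems from the normalising
  logarithm.\<close>

lemma K_has_time_derivative: "((\<lambda>s. K s z) has_vector_derivative \<i> * KB s z) (at s)"
proof -
  define Z where "Z = (\<lambda>b w. of_real \<epsilon> + \<i> * of_real (sg b) * w)"
  have Z: "\<zeta> b r = Z b (of_real r)" for b r by (simp add: Z_def \<zeta>_def Complex_eq mult_ac)
  have Z0: "Z b (of_real s) \<noteq> 0" "4 * of_real pi * Z b (of_real s) \<notin> \<real>\<^sub>\<le>\<^sub>0" for b
    using \<zeta>_nonzero[of b s] \<zeta>_notin_nonpos[of b s] by (simp_all add: Z)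
  have Zd: "(Z b has_field_derivative \<i> * of_real (sg b)) (at w)" for b w
    unfolding Z_def by (auto intro!: derivative_eq_intros)
  define E where "E = (\<lambda>w. \<Sum>b\<in>Basis. - (of_real (z \<bullet> b))\<^sup>2 / (4 * Z b w) - Ln (4 * of_real pi * Z b w) / 2)"
  have "((\<lambda>w. - (of_real (z \<bullet> b))\<^sup>2 / (4 * Z b w) - Ln (4 * of_real pi * Z b w) / 2) has_field_derivative
     \<i> * of_real (sg b) * ((of_real (z \<bullet> b))\<^sup>2 / (4 * (Z b (of_real s))\<^sup>2) - 1 / (2 * Z b (of_real s)))) (at (of_real s))" for b
    using Z0[of b]
    by (auto intro!: derivative_eq_intros Zd simp: field_simps power2_eq_square)
  then have "(E has_field_derivative (\<Sum>b\<in>Basis. \<i> * of_real (sg b) * ((of_real (z \<bullet> b))\<^sup>2 / (4 * (Z b (of_real s))\<^sup>2) - 1 / (2 * Z b (of_real s))))) (at (of_real s))"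
    unfolding E_def by (intro DERIV_sum)
  from has_vector_derivative_real_field[OF DERIV_fun_exp[OF this], of UNIV]
  have "((\<lambda>r. exp (E (of_real r))) has_vector_derivative
     exp (E (of_real s)) * (\<Sum>b\<in>Basis. \<i> * of_real (sg b) * ((of_real (z \<bullet> b))\<^sup>2 / (4 * (\<zeta> b s)\<^sup>2) - 1 / (2 * \<zeta> b s)))) (at s)"
    by (simp add: Z)
  moreover have "exp (E (of_real r)) = K r z" for r
    unfolding E_def K_def Z ..
  moreover have "K s z * (\<Sum>b\<in>Basis. \<i> * of_real (sg b) * ((of_real (z \<bullet> b))\<^sup>2 / (4 * (\<zeta> b s)\<^sup>2) - 1 / (2 * \<zeta> b s))) = \<i> * KB s z"
    unfolding KB_def K2_def by (simp add: sum_distrib_left mult_ac)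
  ultimately show ?thesis by simp
qed

lemma K_even: "K s (- z) = K s z" "KB s (- z) = KB s z"
  by (auto simp: KB_def K2_def K_def)

text \<open>Conjugation is time reversal: it maps \<zeta> at s to \<zeta> at -s, and positive real
  part keeps the logarithm off its branch cut.\<close>

lemma cnj_K: "cnj (K s z) = K (- s) z"
proof -
  have c: "cnj (\<zeta> b s) = \<zeta> b (- s)" for b by (simp add: complex_eq_iff)
  have "cnj (Ln (4 * of_real pi * \<zeta> b s)) = Ln (4 * of_real pi * \<zeta> b (- s))" for b
    using \<zeta>_notin_nonpos[of b s] by (simp add: cnj_Ln c)
  then show ?thesis unfolding K_def exp_cnj cnj_sum
    by (intro arg_cong[where f=exp] sum.cong) (simp_all add: c)
qed

lemma K_0: "K 0 z = of_real (norm (K 0 z))"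
proof -
  have z: "\<zeta> b 0 = of_real \<epsilon>" for b by (simp add: complex_eq_iff)
  have "Ln (4 * of_real pi * of_real \<epsilon>) = of_real (ln (4 * pi * \<epsilon>))"
    using Ln_of_real[of "4 * pi * \<epsilon>"] \<epsilon> by simp
  then have "K 0 z = of_real (exp (\<Sum>b\<in>Basis. - (z \<bullet> b)\<^sup>2 / (4 * \<epsilon>) - ln (4 * pi * \<epsilon>) / 2))"
    unfolding K_def z by (simp add: exp_of_real[symmetric])
  then show ?thesis by simp
qed

lemma has_bochner_integral_K_0: "has_bochner_integral lborel (\<lambda>z. norm (K 0 z)) 1"
proof -
  \<comment> \<open>At s = 0 the kernel is the heat kernel at time \<epsilon>, a product of normal
    densities of variance 2 \<epsilon>.\<close>
  have "has_bochner_integral lborel (\<lambda>z::'a. \<Prod>b\<in>Basis. normal_density 0 (sqrt (2 * \<epsilon>)) (z \<bullet> b))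
     ((LBINT x. normal_density 0 (sqrt (2 * \<epsilon>)) x) ^ DIM('a))"
    using \<epsilon> by (intro has_bochner_integral_prod_Basis integrable_normal_density) (auto simp: normal_density_nonneg)
  moreover have "(\<Prod>b\<in>Basis. normal_density 0 (sqrt (2 * \<epsilon>)) (z \<bullet> b)) = norm (K 0 z)" for z :: 'a
  proof -
    have "normal_density 0 (sqrt (2 * \<epsilon>)) x = (4 * pi * \<epsilon>) powr (- 1 / 2) * exp (- (1 / (4 * \<epsilon>)) * x\<^sup>2)" for x
      using \<epsilon> by (simp add: normal_density_def powr_minus_divide powr_half_sqrt mult_ac)
    then have "(\<Prod>b\<in>Basis. normal_density 0 (sqrt (2 * \<epsilon>)) (z \<bullet> b))
       = ((4 * pi * \<epsilon>) powr (- 1 / 2)) ^ DIM('a) * exp (\<Sum>b\<in>Basis. - (1 / (4 * \<epsilon>)) * (z \<bullet> b)\<^sup>2)"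
      by (simp add: prod.distrib exp_sum)
    also have "((4 * pi * \<epsilon>) powr (- 1 / 2)) ^ DIM('a) = (4 * pi * \<epsilon>) powr (- real DIM('a) / 2)"
      using \<epsilon> by (simp add: powr_power)
    also have "(\<Sum>b\<in>Basis. - (1 / (4 * \<epsilon>)) * (z \<bullet> b)\<^sup>2) = - (1 / (4 * \<epsilon>)) * (norm z)\<^sup>2"
      unfolding sum_distrib_left[symmetric]
      by (simp only: norm_sq_eq_sum_Basis)
    finally show ?thesis unfolding norm_K using \<epsilon> by (simp add: power2_eq_square)
  qed
  ultimately show ?thesis using \<epsilon> by simp
qed

text \<open>Half of the exponent absorbs the factor \<open>norm z\<close>.\<close>

lemma first_moment_K_0:
  "integrable lborel (\<lambda>z. norm (K 0 z) * norm z)"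
  "(LBINT z. norm (K 0 z) * norm z) \<le> 2 powr (real DIM('a) / 2) * sqrt (8 * \<epsilon>)"
proof -
  interpret H: oscillatory_kernel sg "2 * \<epsilon>" using sg \<epsilon> by unfold_locales auto
  have le: "norm (K 0 z) * norm z \<le> (2 powr (real DIM('a) / 2) * sqrt (8 * \<epsilon>)) * norm (H.K 0 z)" for z
  proof -
    have x: "x * exp (- (x\<^sup>2)) \<le> 1" for x :: real
    proof -
      have "x \<le> 1 + x\<^sup>2" using zero_le_power2[of "x - 1/2"] by (simp add: power2_eq_square algebra_simps)
      also have "... \<le> exp (x\<^sup>2)" by (rule exp_ge_add_one_self)
      finally show ?thesis by (simp add: exp_minus field_simps)
    qed
    define w where "w = norm z / sqrt (8 * \<epsilon>)"
    have w2: "w\<^sup>2 = (norm z)\<^sup>2 / (8 * \<epsilon>)" using \<epsilon> by (simp add: w_def power_divide)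
    have nz: "norm z = sqrt (8 * \<epsilon>) * w" using \<epsilon> by (simp add: w_def)
    have P: "(4 * pi * \<epsilon>) powr (- real DIM('a) / 2) = 2 powr (real DIM('a) / 2) * (4 * pi * (2 * \<epsilon>)) powr (- real DIM('a) / 2)"
    proof -
      have "(4 * pi * (2 * \<epsilon>)) powr (- real DIM('a) / 2) = (2 * (4 * pi * \<epsilon>)) powr (- real DIM('a) / 2)" by (simp add: mult_ac)
      also have "... = 2 powr (- real DIM('a) / 2) * (4 * pi * \<epsilon>) powr (- real DIM('a) / 2)" by (rule powr_mult)
      finally have "2 powr (real DIM('a) / 2) * (4 * pi * (2 * \<epsilon>)) powr (- real DIM('a) / 2)
        = (2 powr (real DIM('a) / 2) * 2 powr (- real DIM('a) / 2)) * (4 * pi * \<epsilon>) powr (- real DIM('a) / 2)" by simp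
      also have "2 powr (real DIM('a) / 2) * 2 powr (- real DIM('a) / 2) = (1::real)" by (simp flip: powr_add)
      finally show ?thesis by simp
    qed
    have K: "norm (K 0 z) = (4 * pi * \<epsilon>) powr (- real DIM('a) / 2) * (exp (- w\<^sup>2) * exp (- w\<^sup>2))"
      unfolding norm_K w2 using \<epsilon> by (simp add: power2_eq_square flip: exp_add)
    have HK: "norm (H.K 0 z) = (4 * pi * (2 * \<epsilon>)) powr (- real DIM('a) / 2) * exp (- w\<^sup>2)"
    proof -
      have "sqrt ((2 * \<epsilon>)\<^sup>2 + 0\<^sup>2) = 2 * \<epsilon>" by (rule real_sqrt_unique) (use \<epsilon> in auto)
      then show ?thesis unfolding H.norm_K w2 using \<epsilon> by (simp add: power2_eq_square)
    qed
    have "norm (K 0 z) * norm z = (2 powr (real DIM('a) / 2) * sqrt (8 * \<epsilon>)) * ((4 * pi * (2 * \<epsilon>)) powr (- real DIM('a) / 2) * exp (- w\<^sup>2)) * (w * exp (- w\<^sup>2))"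
      unfolding K P by (subst nz) (simp add: mult_ac)
    also have "... \<le> (2 powr (real DIM('a) / 2) * sqrt (8 * \<epsilon>)) * ((4 * pi * (2 * \<epsilon>)) powr (- real DIM('a) / 2) * exp (- w\<^sup>2)) * 1"
      using x[of w] \<epsilon> by (intro mult_left_mono) auto
    finally show ?thesis unfolding HK by simp
  qed
  have i: "has_bochner_integral lborel (\<lambda>z. (2 powr (real DIM('a) / 2) * sqrt (8 * \<epsilon>)) * norm (H.K 0 z)) ((2 powr (real DIM('a) / 2) * sqrt (8 * \<epsilon>)) * 1)"
    by (intro has_bochner_integral_mult_right H.has_bochner_integral_K_0)
  have m: "(\<lambda>z. norm (K 0 z) * norm z) \<in> borel_measurable lborel"
    using borel_measurable_continuous_onI[OF continuous_slice[OF continuous_K, of 0]] by simp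
  show int: "integrable lborel (\<lambda>z. norm (K 0 z) * norm z)"
    by (rule Bochner_Integration.integrable_bound[OF integrable.intros[OF i] m])
       (use le in \<open>auto intro!: AE_I2 order_trans[OF _ abs_ge_self]\<close>)
  have "(LBINT z. norm (K 0 z) * norm z) \<le> (LBINT z. (2 powr (real DIM('a) / 2) * sqrt (8 * \<epsilon>)) * norm (H.K 0 z))"
    by (intro integral_mono int integrable.intros[OF i] le)
  also have "... = 2 powr (real DIM('a) / 2) * sqrt (8 * \<epsilon>)"
    using has_bochner_integral_integral_eq[OF i] by simp
  finally show "(LBINT z. norm (K 0 z) * norm z) \<le> 2 powr (real DIM('a) / 2) * sqrt (8 * \<epsilon>)" .
qed

lemma K_C2_dir: "C2_dir (K s) (K1 s) (K2 s)"
proof -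
  obtain C where C: "0 < C" "\<And>z. norm (K s z) \<le> C * cauchy_weight z"
    "\<And>z b. b \<in> Basis \<Longrightarrow> norm (K1 s b z) \<le> C * cauchy_weight z"
    "\<And>z b. b \<in> Basis \<Longrightarrow> norm (K2 s b z) \<le> C * cauchy_weight z"
    using kernels_le_cauchy_weight[of "\<bar>s\<bar>"] by (metis order_refl)
  have bi: "L1_bdd g" if "continuous_on UNIV g" "\<And>z. norm (g z) \<le> C * cauchy_weight z" for g :: "'a \<Rightarrow> complex"
  proof (rule L1_bddI)
    show "g \<in> borel_measurable borel" by (rule borel_measurable_continuous_onI[OF that(1)])
    show "integrable lborel (\<lambda>z::'a. C * cauchy_weight z)" using integrable_cauchy_weight[where 'a='a] by simp
    show "norm (g z) \<le> C * cauchy_weight z" for z by (rule that(2))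
    show "norm (g z) \<le> C" for z
      using that(2)[of z] mult_left_mono[OF cauchy_weight_le_1[of z], of C] C(1) by linarith
  qed
  note c = continuous_slice[OF continuous_K] continuous_slice[OF continuous_K1] continuous_slice[OF continuous_K2]
  show ?thesis unfolding C2_dir_def
    using c K_has_dir_deriv bi[OF c(1) C(2)] bi[OF c(2) C(3)] bi[OF c(3) C(4)] by auto
qed

end

section \<open>The regularised group\<close>

lemma L1_bdd_translate: "L1_bdd g \<Longrightarrow> L1_bdd (\<lambda>z. g (z - c))"
  using lborel_integral_translate(2)[of g "-c"] by (auto simp: L1_bdd_def)

lemma L1_bdd_reflect: "L1_bdd g \<Longrightarrow> L1_bdd (\<lambda>z. g (c - z))"
  using lborel_integral_reflect(2)[of g c] by (auto simp: L1_bdd_def)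

lemma C2_dir_translate:
  assumes "C2_dir u u1 u2"
  shows "C2_dir (\<lambda>z. u (z - c)) (\<lambda>b z. u1 b (z - c)) (\<lambda>b z. u2 b (z - c))"
proof -
  have cont: "continuous_on UNIV (\<lambda>z. g (z - c))" if "continuous_on UNIV g" for g :: "'a \<Rightarrow> complex"
    by (rule continuous_on_compose2[OF that]) (auto intro!: continuous_intros)

  have der: "has_dir_deriv (\<lambda>z. g (z - c)) (\<lambda>z. g' (z - c)) b" if "has_dir_deriv g g' b" for g g' :: "'a \<Rightarrow> complex" and b
    unfolding has_dir_deriv_def
  proof
    fix z
    show "((\<lambda>r. g (z + r *\<^sub>R b - c)) has_vector_derivative g' (z - c)) (at 0)"
      using that[unfolded has_dir_deriv_def, rule_format, of "z - c"] by (simp add: algebra_simps)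
  qed
  show ?thesis using assms unfolding C2_dir_def by (auto intro: cont L1_bdd_translate der)
qed

context oscillatory_kernel
begin

text \<open>\<open>V 0\<close> is heat smoothing at time \<epsilon>, not the identity. Composition
  therefore adds smoothing, and \<open>V_comp\<close> keeps one factor \<open>V 0\<close>.\<close>

definition V :: "real \<Rightarrow> ('a \<Rightarrow> complex) \<Rightarrow> 'a \<Rightarrow> complex" where
  "V s f y = (LBINT z. K s (y - z) * f z)"

lemma L1_bdd_K: "L1_bdd (K s)"
  using K_C2_dir by (simp add: C2_dir_def)

lemma measurable_K' [measurable]: "K s \<in> borel_measurable borel"
  using L1_bdd_K by (rule L1_bdd_measurable)

lemma K_bound: obtains B where "0 < B" "\<And>z. norm (K s z) \<le> B"
  using L1_bdd_bound[OF L1_bdd_K] by blast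

lemma K_swap: "K s (y - z) = K s (z - y)"
  using K_even(1)[of s "z - y"] by simp

lemma integrable_V_kernel:
  assumes "L1_bdd f"
  shows "integrable lborel (\<lambda>z. K s (y - z) * f z)"
proof -
  obtain B where B: "0 < B" "\<And>z. norm (K s z) \<le> B" using K_bound by blast
  have "L1_bdd (\<lambda>z. f z * K s (y - z))"
    by (rule L1_bdd_mult_bounded[OF assms _ B(2)]) measurable
  then show ?thesis by (auto simp: mult.commute dest: L1_bdd_integrable)
qed

lemma measurable_V:
  assumes "f \<in> borel_measurable borel"
  shows "(\<lambda>(s, y). V s f y) \<in> borel_measurable (lborel \<Otimes>\<^sub>M lborel)"
proof -
  note assms [measurable]
  have m: "(\<lambda>p. K (fst (fst p)) (snd (fst p) - snd p)) \<in> borel_measurable ((borel \<Otimes>\<^sub>M borel) \<Otimes>\<^sub>M borel)"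
    using measurable_compose[OF _ measurable_K, of "\<lambda>p. (fst (fst p), snd (fst p) - snd p)" "(borel \<Otimes>\<^sub>M borel) \<Otimes>\<^sub>M borel"]
    by simp
  have "(\<lambda>p. K (fst (fst p)) (snd (fst p) - snd p) * f (snd p)) \<in> borel_measurable ((borel \<Otimes>\<^sub>M borel) \<Otimes>\<^sub>M borel)"
    by (intro borel_measurable_times m) measurable
  then have "(\<lambda>(x, z). K (fst x) (snd x - z) * f z) \<in> borel_measurable ((lborel \<Otimes>\<^sub>M lborel) \<Otimes>\<^sub>M lborel)"
    by (simp add: case_prod_beta' cong: measurable_cong_sets sets_pair_measure_cong)
  from lborel.borel_measurable_lebesgue_integral[OF this]
  show ?thesis unfolding V_def by (simp add: case_prod_beta')
qed

lemma measurable_V_slice: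
  assumes "f \<in> borel_measurable borel"
  shows "V s f \<in> borel_measurable borel"
proof -
  have "(\<lambda>y. case_prod (\<lambda>s y. V s f y) (s, y)) \<in> borel_measurable lborel"
    using measurable_V[OF assms] by measurable
  then show ?thesis by simp
qed

text \<open>Convolving |f| with the weight yields a single majorant for all times up to T, as the
  notion of a curve demands.\<close>

lemma V_dominated:
  assumes f: "L1_bdd f"
  obtains G B where "integrable lborel G" "\<And>y. G y \<le> B" "\<And>s y. \<bar>s\<bar> \<le> T \<Longrightarrow> norm (V s f y) \<le> G y"
proof -
  obtain C where C: "0 < C" "\<And>s z. \<bar>s\<bar> \<le> T \<Longrightarrow> norm (K s z) \<le> C * cauchy_weight z"
    using kernels_le_cauchy_weight[of T] by metis
  have i: "integrable lborel (\<lambda>z. C * cauchy_weight (z::'a))" using integrable_cauchy_weight[where 'a='a] by simp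
  have fi: "integrable lborel (\<lambda>z. norm (f z))" using f by (auto simp: L1_bdd_def)
  have [measurable]: "f \<in> borel_measurable borel" "(cauchy_weight :: 'a \<Rightarrow> real) \<in> borel_measurable borel"
    using L1_bdd_measurable[OF f] integrable_cauchy_weight[where 'a='a] by auto
  have ki: "integrable lborel (\<lambda>z. C * cauchy_weight (y - z) * norm (f z))" for y
  proof (rule Bochner_Integration.integrable_bound)
    show "integrable lborel (\<lambda>z. C * norm (f z))" using fi by simp
    show "AE z in lborel. norm (C * cauchy_weight (y - z) * norm (f z)) \<le> norm (C * norm (f z))"
      using C(1) cauchy_weight_pos[of "y - _"] cauchy_weight_le_1[of "y - _"]
      by (intro AE_I2) (simp add: abs_mult abs_of_pos mult_right_mono)
  qed measurable
  show thesis
  proof (rule that[of "\<lambda>y. LBINT z. C * cauchy_weight (y - z) * norm (f z)" "C * (LBINT z. norm (f z))"])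
    show "integrable lborel (\<lambda>y. LBINT z. C * cauchy_weight (y - z) * norm (f z))"
      by (rule convolution_integral(1)[OF i fi])
    show "(LBINT z. C * cauchy_weight (y - z) * norm (f z)) \<le> C * (LBINT z. norm (f z))" for y
    proof -
      have "(LBINT z. C * cauchy_weight (y - z) * norm (f z)) \<le> (LBINT z. C * norm (f z))"
      proof (intro integral_mono ki)
        show "C * cauchy_weight (y - z) * norm (f z) \<le> C * norm (f z)" for z
          using mult_left_mono[OF cauchy_weight_le_1[of "y - z"], of C] C(1) by (intro mult_right_mono) auto
      qed (use fi in simp)
      then show ?thesis by simp
    qed
    show "norm (V s f y) \<le> (LBINT z. C * cauchy_weight (y - z) * norm (f z))" if "\<bar>s\<bar> \<le> T" for s y
    proof -
      have "norm (V s f y) \<le> (LBINT z. norm (K s (y - z) * f z))"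
        unfolding V_def by (rule integral_norm_bound)
      also have "... \<le> (LBINT z. C * cauchy_weight (y - z) * norm (f z))"
        using C(2)[OF that]
        by (intro integral_mono ki integrable_norm[OF integrable_V_kernel[OF f]]) (auto simp: norm_mult intro!: mult_right_mono)
      finally show ?thesis .
    qed
  qed
qed

lemma L1_bdd_V:
  assumes "L1_bdd f" shows "L1_bdd (V s f)"
proof -
  obtain G B where "integrable lborel G" "\<And>y. G y \<le> B" "\<And>r y. \<bar>r\<bar> \<le> \<bar>s\<bar> \<Longrightarrow> norm (V r f y) \<le> G y"
    using V_dominated[OF assms] by blast
  then show ?thesis
    using measurable_V_slice[OF L1_bdd_measurable[OF assms]]
    by (intro L1_bddI[of _ G B]) (auto intro: order_trans)
qed

lemma curve_V:
  assumes f: "L1_bdd f" and w: "w \<in> borel_measurable borel" "\<And>s. s \<in> {0..T} \<Longrightarrow> norm (w s) \<le> 1"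
  shows "curve T (\<lambda>s y. indicator {0..T} s * w s * V s f y)"
proof -
  have f': "f \<in> borel_measurable borel" using L1_bdd_measurable[OF f] .
  obtain G B where G: "integrable lborel G" "\<And>y. G y \<le> B" "\<And>r y. \<bar>r\<bar> \<le> \<bar>T\<bar> \<Longrightarrow> norm (V r f y) \<le> G y"
    using V_dominated[OF f] by blast
  have m: "(\<lambda>p. indicator {0..T} (fst p) * w (fst p) * case_prod (\<lambda>s y. V s f y) p) \<in> borel_measurable (lborel \<Otimes>\<^sub>M lborel)"
  proof (intro borel_measurable_times measurable_V[OF f'])
    show "(\<lambda>p. w (fst p)) \<in> borel_measurable (lborel \<Otimes>\<^sub>M lborel)"
      using measurable_compose[OF measurable_fst, of w lborel borel lborel] w(1) by simp
  qed measurable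
  have "norm (indicator {0..T} s * w s * V s f y) \<le> indicator {0..T} s * G y" for s y
  proof (cases "s \<in> {0..T}")
    case True
    then have "norm (V s f y) \<le> G y" by (intro G(3)) auto
    moreover have "norm (w s) * norm (V s f y) \<le> 1 * norm (V s f y)" using w(2)[OF True] by (intro mult_right_mono) auto
    ultimately show ?thesis using True by (simp add: norm_mult)
  qed simp
  with G m show ?thesis unfolding curve_def by (auto simp: case_prod_beta')
qed

text \<open>The kernel is even, so V s is its own transpose for the bilinear pairing without
  conjugation.\<close>

lemma V_symmetric:
  assumes f: "L1_bdd f" and g: "L1_bdd g"
  shows "(LBINT y. V s f y * g y) = (LBINT y. f y * V s g y)"
proof -
  obtain B where B: "0 < B" "\<And>z. norm (K s z) \<le> B" using K_bound by blast
  have [measurable]: "f \<in> borel_measurable borel" "g \<in> borel_measurable borel"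
    using L1_bdd_measurable f g by auto
  have "(LBINT y. LBINT z. K s (y - z) * f z * g y) = (LBINT z. LBINT y. K s (y - z) * f z * g y)"
  proof (rule Fubini_dominated)
    show "integrable lborel (\<lambda>y. B * norm (g y))" "integrable lborel (\<lambda>z. norm (f z))"
      using f g by (auto simp: L1_bdd_def)
    show "norm (K s (y - z) * f z * g y) \<le> B * norm (g y) * norm (f z)" for y z
      using mult_right_mono[OF B(2)[of "y - z"], of "norm (f z) * norm (g y)"] by (simp add: norm_mult mult_ac)
  qed measurable
  moreover have "(LBINT y. K s (y - z) * f z * g y) = f z * V s g z" for z
    unfolding V_def integral_mult_right_zero[symmetric]
    by (intro Bochner_Integration.integral_cong refl) (simp add: K_swap[of s z] mult_ac)
  moreover have "(LBINT z. K s (y - z) * f z * g y) = V s f y * g y" for y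
    unfolding V_def by simp
  ultimately show ?thesis by (simp only:)
qed

lemma cnj_V: "cnj (V s f y) = V (- s) (\<lambda>z. cnj (f z)) y"
proof -
  have "V (- s) (\<lambda>z. cnj (f z)) y = (LBINT z. cnj (K s (y - z) * f z))"
    unfolding V_def by (simp add: cnj_K)
  also have "... = cnj (V s f y)" unfolding V_def by (rule Bochner_Integration.integral_cnj)
  finally show ?thesis ..
qed

lemma V_sum:
  assumes "\<And>k. k \<in> F \<Longrightarrow> L1_bdd (f k)"
  shows "V s (\<lambda>z. \<Sum>k\<in>F. f k z) y = (\<Sum>k\<in>F. V s (f k) y)"
  unfolding V_def sum_distrib_left
  by (rule Bochner_Integration.integral_sum) (rule integrable_V_kernel[OF assms])

lemma L1_bdd_KB: "L1_bdd (KB s)"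
  unfolding KB_def using K_C2_dir[of s] by (auto simp: C2_dir_def intro!: L1_bdd_sum L1_bdd_cmult)

text \<open>Evenness turns the reflected kernel into a translate, to which Green's identity applies
  direction by direction.\<close>

lemma Green_KB:
  assumes u: "C2_dir u u1 u2"
  shows "(LBINT z. KB s (x - z) * u z) = (LBINT z. K s (x - z) * (\<Sum>b\<in>Basis. of_real (sg b) * u2 b z))"
proof -
  have K: "C2_dir (\<lambda>z. K s (z - x)) (\<lambda>b z. K1 s b (z - x)) (\<lambda>b z. K2 s b (z - x))"
    by (rule C2_dir_translate[OF K_C2_dir])
  have i: "integrable lborel (\<lambda>z. K2 s b (z - x) * u z)" "integrable lborel (\<lambda>z. K s (z - x) * u2 b z)" if "b \<in> Basis" for b
    using that K u unfolding C2_dir_def by (auto intro!: L1_bdd_integrable L1_bdd_mult)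
  have e: "KB s (x - z) = KB s (z - x)" for z using K_even(2)[of s "z - x"] by simp
  have "(LBINT z. KB s (x - z) * u z) = (LBINT z. (\<Sum>b\<in>Basis. of_real (sg b) * (K2 s b (z - x) * u z)))"
    unfolding e by (simp add: KB_def sum_distrib_right mult.assoc)
  also have "... = (\<Sum>b\<in>Basis. of_real (sg b) * (LBINT z. K2 s b (z - x) * u z))"
    using i(1) by (subst Bochner_Integration.integral_sum) auto
  also have "... = (\<Sum>b\<in>Basis. of_real (sg b) * (LBINT z. K s (z - x) * u2 b z))"
    using Green_dir[OF K u] by (intro sum.cong) auto
  also have "... = (LBINT z. (\<Sum>b\<in>Basis. of_real (sg b) * (K s (z - x) * u2 b z)))"
    using i(2) by (subst Bochner_Integration.integral_sum) auto
  also have "... = (LBINT z. K s (x - z) * (\<Sum>b\<in>Basis. of_real (sg b) * u2 b z))"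
    by (simp add: sum_distrib_left mult_ac K_swap[of s x])
  finally show ?thesis .
qed

text \<open>The derivative in r of the composed kernel is \<i> times the integral of KB K - K KB,
  which vanishes by Green's identity; so the composition depends on s + t only. This is the
  semigroup law, obtained without evaluating an oscillatory Gaussian integral. Differentiation under
  the integral is replaced by the fundamental theorem of calculus and Fubini.\<close>

lemma kernel_composition_const:
  assumes "r\<^sub>1 \<le> r\<^sub>2"
  shows "(LBINT z. K (s + r\<^sub>1) (x - z) * K (t - r\<^sub>1) (z - y)) = (LBINT z. K (s + r\<^sub>2) (x - z) * K (t - r\<^sub>2) (z - y))"
proof -
  define P where "P = (\<lambda>r z. K (s + r) (x - z) * K (t - r) (z - y))"
  define P' where "P' = (\<lambda>r z. \<i> * (KB (s + r) (x - z) * K (t - r) (z - y) - K (s + r) (x - z) * KB (t - r) (z - y)))"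
  define ind where "ind = (indicator {r\<^sub>1..r\<^sub>2} :: real \<Rightarrow> real)"
  have cont: "continuous_on UNIV (\<lambda>p. P' (fst p) (snd p))"
    unfolding P'_def
    by (intro continuous_intros continuous_on_compose2[OF continuous_K, of _ "\<lambda>p. (s + fst p, x - snd p)", simplified]
       continuous_on_compose2[OF continuous_K, of _ "\<lambda>p. (t - fst p, snd p - y)", simplified]
       continuous_on_compose2[OF continuous_KB, of _ "\<lambda>p. (s + fst p, x - snd p)", simplified]
       continuous_on_compose2[OF continuous_KB, of _ "\<lambda>p. (t - fst p, snd p - y)", simplified])
  have der: "((\<lambda>r. P r z) has_vector_derivative P' r z) (at r)" for r z
  proof -
    have "((\<lambda>r. s + r) has_vector_derivative 1) (at r)" "((\<lambda>r. t - r) has_vector_derivative -1) (at r)"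
      by (auto intro!: derivative_eq_intros)
    from vector_diff_chain_at[OF this(1) K_has_time_derivative] vector_diff_chain_at[OF this(2) K_has_time_derivative]
    have "((\<lambda>r. K (s + r) (x - z)) has_vector_derivative \<i> * KB (s + r) (x - z)) (at r)"
      "((\<lambda>r. K (t - r) (z - y)) has_vector_derivative - (\<i> * KB (t - r) (z - y))) (at r)"
      by (simp_all add: o_def)
    from has_vector_derivative_mult[OF this] show ?thesis unfolding P_def P'_def by (simp add: algebra_simps)
  qed
  have ftc: "(LBINT r. ind r *\<^sub>R P' r z) = P r\<^sub>2 z - P r\<^sub>1 z" for z
    unfolding ind_def
    by (rule integral_FTC_atLeastAtMost[OF assms has_vector_derivative_at_within[OF der]])
       (use continuous_on_compose2[OF cont continuous_on_Pair[OF continuous_on_id continuous_on_const], of z "{r\<^sub>1..r\<^sub>2}"] in auto)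
  have P'0: "(LBINT z. P' r z) = 0" for r
  proof -
    have C2: "C2_dir (\<lambda>z. K (t - r) (z - y)) (\<lambda>b z. K1 (t - r) b (z - y)) (\<lambda>b z. K2 (t - r) b (z - y))"
      by (rule C2_dir_translate[OF K_C2_dir])
    have bi: "L1_bdd (\<lambda>z. K (t - r) (z - y))" "L1_bdd (\<lambda>z. KB (t - r) (z - y))"
      "L1_bdd (\<lambda>z. K (s + r) (x - z))" "L1_bdd (\<lambda>z. KB (s + r) (x - z))"
      by (rule L1_bdd_translate L1_bdd_reflect, rule L1_bdd_K L1_bdd_KB)+
    have "(LBINT z. KB (s + r) (x - z) * K (t - r) (z - y)) = (LBINT z. K (s + r) (x - z) * KB (t - r) (z - y))"
      using Green_KB[OF C2] by (simp add: KB_def)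
    then show ?thesis unfolding P'_def
      using L1_bdd_integrable[OF L1_bdd_mult[OF bi(4,1)]] L1_bdd_integrable[OF L1_bdd_mult[OF bi(3,2)]]
      by simp
  qed
  define T where "T = \<bar>s\<bar> + \<bar>t\<bar> + \<bar>r\<^sub>1\<bar> + \<bar>r\<^sub>2\<bar>"
  obtain C where C: "0 < C" "\<And>s z. \<bar>s\<bar> \<le> T \<Longrightarrow> norm (K s z) \<le> C * cauchy_weight z"
    "\<And>s z. \<bar>s\<bar> \<le> T \<Longrightarrow> norm (KB s z) \<le> C * cauchy_weight z"
    using kernels_le_cauchy_weight[of T] by metis
  have C1: "C * cauchy_weight z \<le> C" for z :: 'a using mult_left_mono[OF cauchy_weight_le_1[of z], of C] C(1) by simp
  have "(LBINT r. LBINT z. ind r *\<^sub>R P' r z) = (LBINT z. LBINT r. ind r *\<^sub>R P' r z)"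
  proof (rule Fubini_dominated)
    have m: "(\<lambda>p. P' (fst p) (snd p)) \<in> borel_measurable (lborel \<Otimes>\<^sub>M lborel)"
    proof -
      have "(\<lambda>p. P' (fst p) (snd p)) \<in> borel_measurable (borel \<Otimes>\<^sub>M borel)"
        using borel_measurable_continuous_onI[OF cont] by (simp add: borel_prod)
      then show ?thesis by (simp cong: measurable_cong_sets sets_pair_measure_cong)
    qed
    have "(\<lambda>p. ind (fst p) *\<^sub>R P' (fst p) (snd p)) \<in> borel_measurable (lborel \<Otimes>\<^sub>M lborel)"
      unfolding ind_def by (intro borel_measurable_scaleR m) measurable
    then show "(\<lambda>(r, z). ind r *\<^sub>R P' r z) \<in> borel_measurable (lborel \<Otimes>\<^sub>M lborel)" by (simp add: case_prod_beta')
    show "integrable lborel ind" unfolding ind_def by (rule integrable_indicator_Icc)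
    show "integrable lborel (\<lambda>z. 2 * C * (C * cauchy_weight (z - y)))"
      using lborel_integral_translate(2)[of cauchy_weight "-y"] integrable_cauchy_weight[where 'a='a] by simp
    show "norm (ind r *\<^sub>R P' r z) \<le> ind r * (2 * C * (C * cauchy_weight (z - y)))" for r z
    proof (cases "r \<in> {r\<^sub>1..r\<^sub>2}")
      case True
      then have T: "\<bar>s + r\<bar> \<le> T" "\<bar>t - r\<bar> \<le> T" unfolding T_def by auto
      have b: "norm (KB (s + r) (x - z) * K (t - r) (z - y)) \<le> C * (C * cauchy_weight (z - y))"
        "norm (K (s + r) (x - z) * KB (t - r) (z - y)) \<le> C * (C * cauchy_weight (z - y))"
        unfolding norm_mult using order_trans[OF C(2)[OF T(1)] C1] order_trans[OF C(3)[OF T(1)] C1] C(2,3)[OF T(2), of "z - y"] C(1)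
        by (auto intro!: mult_mono)
      have "norm (P' r z) \<le> norm (KB (s + r) (x - z) * K (t - r) (z - y)) + norm (K (s + r) (x - z) * KB (t - r) (z - y))"
        unfolding P'_def norm_mult[of \<i>] by (simp add: norm_triangle_ineq4)
      then show ?thesis using b True by (simp add: ind_def)
    qed (simp add: ind_def)
  qed
  then have "(LBINT z. P r\<^sub>2 z - P r\<^sub>1 z) = 0" by (simp add: ftc P'0)
  moreover have "integrable lborel (P r)" for r
  proof -
    have "L1_bdd (\<lambda>z. K (t - r) (z - y))" "L1_bdd (\<lambda>z. K (s + r) (x - z))"
      by (rule L1_bdd_translate L1_bdd_reflect, rule L1_bdd_K)+
    then show ?thesis unfolding P_def by (intro L1_bdd_integrable L1_bdd_mult)
  qed
  ultimately show ?thesis by (simp add: P_def)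
qed

text \<open>All of t is slid into the first factor; the sign of t decides in which
  direction.\<close>

lemma kernel_composition:
  "(LBINT z. K s (x - z) * K t (z - y)) = (LBINT z. K (s + t) (x - z) * K 0 (z - y))"
proof (cases "0 \<le> t")
  case True
  then show ?thesis using kernel_composition_const[of 0 t s x t y] by simp
next
  case False
  then show ?thesis using kernel_composition_const[of t 0 s x t y] by simp
qed

lemma V_comp_kernel:
  assumes f: "L1_bdd f"
  shows "V s (V t f) x = (LBINT y. (LBINT z. K s (x - z) * K t (z - y)) * f y)"
proof -
  obtain B where B: "0 < B" "\<And>z. norm (K t z) \<le> B" using K_bound by blast
  have [measurable]: "f \<in> borel_measurable borel" using L1_bdd_measurable f by auto
  have "(LBINT z. LBINT y. K s (x - z) * K t (z - y) * f y) = (LBINT y. LBINT z. K s (x - z) * K t (z - y) * f y)"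
  proof (rule Fubini_dominated)
    show "integrable lborel (\<lambda>z. norm (K s (x - z)) * B)" "integrable lborel (\<lambda>y. norm (f y))"
      using f lborel_integral_reflect(2)[of "K s" x] L1_bdd_K by (auto simp: L1_bdd_def)
    show "norm (K s (x - z) * K t (z - y) * f y) \<le> norm (K s (x - z)) * B * norm (f y)" for y z
      unfolding norm_mult using B by (intro mult_right_mono mult_left_mono) auto
  qed measurable
  moreover have "(LBINT y. K s (x - z) * K t (z - y) * f y) = K s (x - z) * V t f z" for z
    unfolding V_def by (simp add: mult.assoc)
  moreover have "(LBINT z. K s (x - z) * K t (z - y) * f y) = (LBINT z. K s (x - z) * K t (z - y)) * f y" for y
    by simp
  ultimately show ?thesis unfolding V_def[of s] by simp
qed

lemma V_comp:
  assumes "L1_bdd f"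
  shows "V s (V t f) x = V (s + t) (V 0 f) x"
  using V_comp_kernel[OF assms, of s t x] V_comp_kernel[OF assms, of "s + t" 0 x]
  by (simp only: kernel_composition[of s x t])

lemma norm_V_0_le: "norm (V 0 f y) \<le> (LBINT z. norm (K 0 (y - z)) * norm (f z))"
  unfolding V_def norm_mult[symmetric] by (rule integral_norm_bound)

lemma L1_V_0_le:
  assumes "L1_bdd f"
  shows "(LBINT y. norm (V 0 f y)) \<le> (LBINT y. norm (f y))"
proof -
  have k: "integrable lborel (\<lambda>z. norm (K 0 z))" "(LBINT z. norm (K 0 z)) = 1"
    using has_bochner_integral_K_0 by (auto simp: has_bochner_integral_iff)
  have fi: "integrable lborel (\<lambda>z. norm (f z))" using assms by (auto simp: L1_bdd_def)
  have "(LBINT y. norm (V 0 f y)) \<le> (LBINT y. LBINT z. norm (K 0 (y - z)) * norm (f z))"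
    using convolution_integral(1)[OF k(1) fi] L1_bdd_integrable[OF L1_bdd_V[OF assms, of 0]] norm_V_0_le
    by (intro integral_mono) auto
  then show ?thesis using convolution_integral(2)[OF k(1) fi] k(2) by simp
qed

lemma l2sq_V_0_le:
  assumes f: "L1_bdd f"
  shows "l2sq (V 0 f) \<le> l2sq f"
proof -
  have k: "integrable lborel (\<lambda>z. norm (K 0 z))" "(LBINT z. norm (K 0 z)) = 1"
    using has_bochner_integral_K_0 by (auto simp: has_bochner_integral_iff)
  note f2 = integrable_norm_sq[OF f]
  have ptw: "(norm (V 0 f y))\<^sup>2 \<le> (LBINT z. norm (K 0 (y - z)) * (norm (f z))\<^sup>2)" for y
  proof -
    define c where "c = (LBINT z. norm (K 0 (y - z)) * norm (f z))"
    have ky: "integrable lborel (\<lambda>z. norm (K 0 (y - z)))" "(LBINT z. norm (K 0 (y - z))) = 1"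
      using lborel_integral_reflect[OF k(1), of y] k(2) by auto
    have k1: "integrable lborel (\<lambda>z. norm (K 0 (y - z)) * norm (f z))"
      using integrable_norm[OF integrable_V_kernel[OF f, of 0 y]] by (simp add: norm_mult)
    have k2: "integrable lborel (\<lambda>z. norm (K 0 (y - z)) * (norm (f z))\<^sup>2)"
      using integrable_norm[OF integrable_V_kernel[OF L1_bdd_mult[OF f f], of 0 y]]
      by (simp add: norm_mult power2_eq_square)
    \<comment> \<open>Jensen's inequality as nonnegativity of a variance:
      \<open>norm (K 0 (y - z))\<close> is a probability density in z and c is the mean of
      |f|.\<close>
    have "0 \<le> (LBINT z. norm (K 0 (y - z)) * (norm (f z) - c)\<^sup>2)" by simp
    also have "... = (LBINT z. norm (K 0 (y - z)) * (norm (f z))\<^sup>2 - 2 * c * (norm (K 0 (y - z)) * norm (f z)) + c\<^sup>2 * norm (K 0 (y - z)))"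
      by (intro Bochner_Integration.integral_cong) (auto simp: power2_eq_square algebra_simps)
    also have "... = (LBINT z. norm (K 0 (y - z)) * (norm (f z))\<^sup>2) - 2 * c * c + c\<^sup>2 * 1"
      using ky k1 k2 by (simp add: c_def)
    finally have "c\<^sup>2 \<le> (LBINT z. norm (K 0 (y - z)) * (norm (f z))\<^sup>2)" by (simp add: power2_eq_square)
    moreover have "(norm (V 0 f y))\<^sup>2 \<le> c\<^sup>2" using norm_V_0_le unfolding c_def by (intro power_mono) auto
    ultimately show ?thesis by linarith
  qed
  have "l2sq (V 0 f) \<le> (LBINT y. LBINT z. norm (K 0 (y - z)) * (norm (f z))\<^sup>2)"
    unfolding l2sq_def
    using convolution_integral(1)[OF k(1) f2] integrable_norm_sq[OF L1_bdd_V[OF f, of 0]] ptw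
    by (intro integral_mono) auto
  then show ?thesis using convolution_integral(2)[OF k(1) f2] k(2) by (simp add: l2sq_def)
qed

text \<open>Conjugation reverses time and transposition moves V s across, so the two evolutions
  merge and the pairing sees s and t only through s - t.\<close>

lemma inner_V:
  assumes f: "L1_bdd f" and h: "L1_bdd h"
  shows "(LBINT y. V s f y * cnj (V t h y)) = (LBINT y. f y * V (s - t) (V 0 (\<lambda>z. cnj (h z))) y)"
proof -
  have h': "L1_bdd (\<lambda>z. cnj (h z))" using h by simp
  show ?thesis
    unfolding cnj_V V_symmetric[OF f L1_bdd_V[OF h']] V_comp[OF h', of s "-t"] by simp
qed

text \<open>By \<open>inner_V\<close> the pairing at equal times does not depend on the time, so V s
  f and V 0 f have the same norm, and V 0 is a contraction. This takes the place of
  Plancherel.\<close>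

lemma l2sq_V_le:
  assumes f: "L1_bdd f"
  shows "l2sq (V s f) \<le> l2sq f"
proof -
  have "complex_of_real (l2sq (V s f)) = complex_of_real (l2sq (V 0 f))"
    unfolding l2sq_eq_inner[OF L1_bdd_V[OF f]] inner_V[OF f f] by simp
  then show ?thesis using l2sq_V_0_le[OF f] by simp
qed

text \<open>The sup bound of the kernel maps L^1 to bounded functions with the decay rate; the extra
  V 0 is harmless since it contracts L^1.\<close>

lemma dispersive_inner_V:
  assumes f: "L1_bdd f" and h: "L1_bdd h" and "s \<noteq> t"
  shows "norm (LBINT y. V s f y * cnj (V t h y))
    \<le> \<bar>s - t\<bar> powr (- real DIM('a) / 2) * (LBINT y. norm (f y)) * (LBINT y. norm (h y))"
proof -
  define k where "k = \<bar>s - t\<bar> powr (- real DIM('a) / 2)"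
  define g where "g = V 0 (\<lambda>z. cnj (h z))"
  have g: "L1_bdd g" unfolding g_def using h by (intro L1_bdd_V) simp
  have gi: "integrable lborel (\<lambda>y. norm (g y))" and fi: "integrable lborel (\<lambda>y. norm (f y))"
    using g f by (auto simp: L1_bdd_def)
  have V: "norm (V (s - t) g y) \<le> k * (LBINT z. norm (h z))" for y
  proof -
    have "norm (V (s - t) g y) \<le> (LBINT z. norm (K (s - t) (y - z) * g z))"
      unfolding V_def by (rule integral_norm_bound)
    also have "... \<le> (LBINT z. k * norm (g z))"
      using norm_K_le_dispersive[of "s - t"] \<open>s \<noteq> t\<close> gi
      by (intro integral_mono integrable_norm[OF integrable_V_kernel[OF g]]) (auto simp: norm_mult k_def intro!: mult_right_mono)
    also have "... \<le> k * (LBINT z. norm (h z))"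
      using L1_V_0_le[of "\<lambda>z. cnj (h z)"] h by (simp add: g_def k_def mult_left_mono)
    finally show ?thesis .
  qed
  have "norm (LBINT y. f y * V (s - t) g y) \<le> (LBINT y. norm (f y * V (s - t) g y))"
    by (rule integral_norm_bound)
  also have "... \<le> (LBINT y. norm (f y) * (k * (LBINT z. norm (h z))))"
    using V fi
    by (intro integral_mono integrable_norm[OF L1_bdd_integrable[OF L1_bdd_mult[OF f L1_bdd_V[OF g]]]])
       (auto simp: norm_mult intro!: mult_left_mono)
  finally show ?thesis unfolding inner_V[OF f h] g_def[symmetric] k_def[symmetric] by (simp add: mult_ac)
qed

end

section \<open>Averaging in time\<close>

context oscillatory_kernel
begin

text \<open>Integrate \<open>d/ds ((1 - s/T) V s u)\<close> over \<open>[0, T]\<close>; the time derivative of \<open>V\<close> falls on \<open>u\<close> as \<open>\<i> (\<Sum>b. sg b \<partial>\<^sub>b\<^sup>2)\<close>.\<close>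

lemma V_0_average:
  assumes u: "C2_dir u u1 u2" and T: "0 < T"
  defines "Bu \<equiv> (\<lambda>z. \<Sum>b\<in>Basis. of_real (sg b) * u2 b z)"
  shows "V 0 u x = (LBINT s. indicator {0..T} s * (V s u x / of_real T - \<i> * of_real (1 - s / T) * V s Bu x))"
proof -
  have ui: "L1_bdd u" and u2i: "\<And>b. b \<in> Basis \<Longrightarrow> L1_bdd (u2 b)" using u by (auto simp: C2_dir_def)
  have um: "u \<in> borel_measurable borel" using L1_bdd_measurable[OF ui] .
  define P where "P = (\<lambda>s z. of_real (1 - s / T) * K s (x - z))"
  define P' where "P' = (\<lambda>s z. of_real (1 - s / T) * (\<i> * KB s (x - z)) - K s (x - z) / of_real T)"
  define ind where "ind = (indicator {0..T} :: real \<Rightarrow> real)"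
  have cont: "continuous_on UNIV (\<lambda>p. P' (fst p) (snd p))"
    unfolding P'_def
    by (intro continuous_intros continuous_on_compose2[OF continuous_K, of _ "\<lambda>p. (fst p, x - snd p)", simplified]
       continuous_on_compose2[OF continuous_KB, of _ "\<lambda>p. (fst p, x - snd p)", simplified]) (use T in auto)
  have der: "((\<lambda>s. P s z) has_vector_derivative P' s z) (at s)" for s z
  proof -
    have "((\<lambda>s. complex_of_real (1 - s / T)) has_vector_derivative of_real (- 1 / T)) (at s)"
      by (rule has_vector_derivative_of_real) (use T in \<open>auto intro!: derivative_eq_intros\<close>)
    from has_vector_derivative_mult[OF this K_has_time_derivative]
    show ?thesis unfolding P_def P'_def by simp
  qed
  \<comment> \<open>The weight 1 - s/T vanishes at s = T, so only the term at s = 0 survives; that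
    term produces V 0 u.\<close>
  have ftc: "(LBINT s. ind s *\<^sub>R P' s z) = P T z - P 0 z" for z
    unfolding ind_def
    by (rule integral_FTC_atLeastAtMost[OF less_imp_le[OF T] has_vector_derivative_at_within[OF der]])
       (use continuous_on_compose2[OF cont continuous_on_Pair[OF continuous_on_id continuous_on_const], of z "{0..T}"] in auto)
  obtain C where C: "0 < C" "\<And>s z. \<bar>s\<bar> \<le> T \<Longrightarrow> norm (K s z) \<le> C * cauchy_weight z"
    "\<And>s z. \<bar>s\<bar> \<le> T \<Longrightarrow> norm (KB s z) \<le> C * cauchy_weight z"
    using kernels_le_cauchy_weight[of T] by metis
  have C1: "C * cauchy_weight z \<le> C" for z :: 'a using mult_left_mono[OF cauchy_weight_le_1[of z], of C] C(1) by simp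
  have "(LBINT s. LBINT z. ind s *\<^sub>R P' s z * u z) = (LBINT z. LBINT s. ind s *\<^sub>R P' s z * u z)"
  proof (rule Fubini_dominated)
    have m: "(\<lambda>p. P' (fst p) (snd p)) \<in> borel_measurable (lborel \<Otimes>\<^sub>M lborel)"
    proof -
      have "(\<lambda>p. P' (fst p) (snd p)) \<in> borel_measurable (borel \<Otimes>\<^sub>M borel)"
        using borel_measurable_continuous_onI[OF cont] by (simp add: borel_prod)
      then show ?thesis by (simp cong: measurable_cong_sets sets_pair_measure_cong)
    qed
    have "(\<lambda>p. ind (fst p) *\<^sub>R P' (fst p) (snd p) * u (snd p)) \<in> borel_measurable (lborel \<Otimes>\<^sub>M lborel)"
    proof (intro borel_measurable_times borel_measurable_scaleR m)
      show "(\<lambda>p. u (snd p)) \<in> borel_measurable (lborel \<Otimes>\<^sub>M lborel)"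
        using measurable_compose[OF measurable_snd, of u lborel borel lborel] um by simp
    qed (unfold ind_def, measurable)
    then show "(\<lambda>(s, z). ind s *\<^sub>R P' s z * u z) \<in> borel_measurable (lborel \<Otimes>\<^sub>M lborel)" by (simp add: case_prod_beta')
    show "integrable lborel ind" unfolding ind_def by (rule integrable_indicator_Icc)
    show "integrable lborel (\<lambda>z. (C + C / T) * norm (u z))" using ui by (auto simp: L1_bdd_def)
    show "norm (ind s *\<^sub>R P' s z * u z) \<le> ind s * ((C + C / T) * norm (u z))" for s z
    proof (cases "s \<in> {0..T}")
      case True
      then have s: "\<bar>s\<bar> \<le> T" and s1: "\<bar>1 - s / T\<bar> \<le> 1" using T by auto
      have "norm (P' s z) \<le> norm (of_real (1 - s / T) * (\<i> * KB s (x - z))) + norm (K s (x - z) / of_real T)"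
        unfolding P'_def by (rule norm_triangle_ineq4)
      also have "... = \<bar>1 - s / T\<bar> * norm (KB s (x - z)) + norm (K s (x - z)) / T"
        using T unfolding norm_mult norm_divide norm_of_real by simp
      also have "... \<le> 1 * C + C / T"
        using s1 T order_trans[OF C(2)[OF s] C1] order_trans[OF C(3)[OF s] C1]
        by (intro add_mono mult_mono divide_right_mono) auto
      finally show ?thesis using True by (simp add: ind_def norm_mult mult_right_mono)
    qed (simp add: ind_def)
  qed
  moreover have "(LBINT s. ind s *\<^sub>R P' s z * u z) = - (K 0 (x - z) * u z)" for z
  proof -
    have "(LBINT s. ind s *\<^sub>R P' s z * u z) = (LBINT s. ind s *\<^sub>R P' s z) * u z" by (rule integral_mult_left_zero)
    also have "... = - (K 0 (x - z) * u z)" unfolding ftc P_def using T by simp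
    finally show ?thesis .
  qed
  moreover have "(LBINT z. ind s *\<^sub>R P' s z * u z) = - (indicator {0..T} s * (V s u x / of_real T - \<i> * of_real (1 - s / T) * V s Bu x))" for s
  proof -
    have i1: "integrable lborel (\<lambda>z. KB s (x - z) * u z)"
      by (intro L1_bdd_integrable L1_bdd_mult ui L1_bdd_reflect[OF L1_bdd_KB])
    have "(LBINT z. ind s *\<^sub>R P' s z * u z)
      = (LBINT z. of_real (ind s) * (of_real (1 - s / T) * \<i>) * (KB s (x - z) * u z) - of_real (ind s) / of_real T * (K s (x - z) * u z))"
      unfolding P'_def by (intro Bochner_Integration.integral_cong) (auto simp: scaleR_conv_of_real algebra_simps)
    also have "... = of_real (ind s) * (of_real (1 - s / T) * \<i>) * (LBINT z. KB s (x - z) * u z) - of_real (ind s) / of_real T * V s u x"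
      unfolding V_def using i1 integrable_V_kernel[OF ui, of s x]
      by (subst Bochner_Integration.integral_diff) (auto intro!: integrable_mult_right)
    also have "(LBINT z. KB s (x - z) * u z) = V s Bu x"
      unfolding Green_KB[OF u] V_def Bu_def ..
    finally have e: "(LBINT z. ind s *\<^sub>R P' s z * u z)
      = of_real (ind s) * (of_real (1 - s / T) * \<i>) * V s Bu x - of_real (ind s) / of_real T * V s u x" .
    show ?thesis unfolding e by (simp add: ind_def indicator_def algebra_simps)
  qed
  ultimately have "- (LBINT s. indicator {0..T} s * (V s u x / of_real T - \<i> * of_real (1 - s / T) * V s Bu x)) = - (LBINT z. K 0 (x - z) * u z)"
    by (simp only: Bochner_Integration.integral_minus)
  then show ?thesis unfolding V_def[of 0] by simp
qed

text \<open>Two weights will occur: 1 - s/T, and the constant 1 that comes from differentiating it.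
  Both are bounded by 1 on [0, T], which is all that the estimates see.\<close>

definition time_int :: "real \<Rightarrow> (real \<Rightarrow> complex) \<Rightarrow> ('a \<Rightarrow> complex) \<Rightarrow> 'a \<Rightarrow> complex" where
  "time_int T w f y = (LBINT s. indicator {0..T} s * w s * V s f y)"

lemma L1_bdd_time_int:
  assumes f: "L1_bdd f" and w: "w \<in> borel_measurable borel" "\<And>s. s \<in> {0..T} \<Longrightarrow> norm (w s) \<le> 1"
  shows "L1_bdd (time_int T w f)"
  unfolding time_int_def[abs_def] by (rule curve_integral_L1_bdd[OF curve_V[OF f w]])

lemma time_int_symmetric:
  assumes f: "L1_bdd f" and h: "L1_bdd h"
    and w: "w \<in> borel_measurable borel" "\<And>s. s \<in> {0..T} \<Longrightarrow> norm (w s) \<le> 1"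
  shows "(LBINT y. time_int T w f y * h y) = (LBINT y. f y * time_int T w h y)"
proof -
  have "(LBINT y. time_int T w f y * h y) = (LBINT s. LBINT y. indicator {0..T} s * w s * V s f y * h y)"
    unfolding time_int_def by (rule curve_swap[OF curve_V[OF f w] h])
  also have "... = (LBINT s. indicator {0..T} s * w s * (LBINT y. V s f y * h y))"
    by (simp add: mult.assoc)
  also have "... = (LBINT s. indicator {0..T} s * w s * (LBINT y. V s h y * f y))"
  proof -
    have "(LBINT y. V s f y * h y) = (LBINT y. V s h y * f y)" for s
      unfolding V_symmetric[OF f h] by (intro Bochner_Integration.integral_cong refl mult.commute)
    then show ?thesis by (simp only:)
  qed
  also have "... = (LBINT s. LBINT y. indicator {0..T} s * w s * V s h y * f y)"
    by (simp add: mult.assoc)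
  also have "... = (LBINT y. time_int T w h y * f y)"
    unfolding time_int_def by (rule curve_swap[OF curve_V[OF h w] f, symmetric])
  finally show ?thesis by (simp only: mult.commute)
qed

text \<open>Time averages are their own transposes, so they move from u and Bu onto f.
  Cauchy-Schwarz then isolates averages of f alone, which can be estimated through the level
  structure that f will be given.\<close>

lemma norm_pairing_V_0_le:
  assumes u: "C2_dir u u1 u2" and f: "L1_bdd f" and T: "0 < T"
  defines "Bu \<equiv> (\<lambda>z. \<Sum>b\<in>Basis. of_real (sg b) * u2 b z)"
  shows "norm (LBINT x. V 0 u x * f x)
    \<le> sqrt (l2sq u) * sqrt (l2sq (time_int T (\<lambda>s. 1) f)) / T
      + sqrt (l2sq Bu) * sqrt (l2sq (time_int T (\<lambda>s. of_real (1 - s / T)) f))"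
proof -
  define w where "w = (\<lambda>s. complex_of_real (1 - s / T))"
  have w: "w \<in> borel_measurable borel" "\<And>s. s \<in> {0..T} \<Longrightarrow> norm (w s) \<le> 1"
    unfolding w_def norm_of_real using T by (auto intro!: borel_measurable_of_real)
  have o: "(\<lambda>s::real. 1::complex) \<in> borel_measurable borel" "\<And>s. s \<in> {0..T} \<Longrightarrow> norm (1::complex) \<le> 1" by auto
  have ui: "L1_bdd u" and u2i: "\<And>b. b \<in> Basis \<Longrightarrow> L1_bdd (u2 b)" using u by (auto simp: C2_dir_def)
  have Bi: "L1_bdd Bu" unfolding Bu_def by (intro L1_bdd_sum L1_bdd_cmult u2i)
  have si: "integrable lborel (\<lambda>s. indicator {0..T} s * v s * V s h x)"
    if v: "v \<in> borel_measurable borel" "\<And>s. s \<in> {0..T} \<Longrightarrow> norm (v s) \<le> 1" and h: "L1_bdd h" for v h x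
    by (rule integrable_curve_time[OF curve_V[OF h v]])
  have V0: "V 0 u x = time_int T (\<lambda>s. 1) u x / of_real T - \<i> * time_int T w Bu x" for x
  proof -
    have "V 0 u x = (LBINT s. (indicator {0..T} s * 1 * V s u x) / of_real T - \<i> * (indicator {0..T} s * w s * V s Bu x))"
      unfolding V_0_average[OF u T] Bu_def[symmetric] w_def
      by (intro Bochner_Integration.integral_cong) (auto simp: algebra_simps)
    also have "... = time_int T (\<lambda>s. 1) u x / of_real T - \<i> * time_int T w Bu x"
    proof -
      have "(LBINT s. (indicator {0..T} s * 1 * V s u x) / of_real T) = (LBINT s. indicator {0..T} s * 1 * V s u x) / of_real T"
        by (rule integral_divide_zero)
      moreover have "(LBINT s. \<i> * (indicator {0..T} s * w s * V s Bu x)) = \<i> * (LBINT s. indicator {0..T} s * w s * V s Bu x)"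
        by (rule integral_mult_right_zero)
      moreover have "integrable lborel (\<lambda>s. (indicator {0..T} s * 1 * V s u x) / of_real T)"
        using si[OF o ui, where x=x] by (rule integrable_divide)
      moreover have "integrable lborel (\<lambda>s. \<i> * (indicator {0..T} s * w s * V s Bu x))"
        using si[OF w Bi, where x=x] by (rule integrable_mult_right)
      ultimately show ?thesis
        unfolding time_int_def by (simp only: Bochner_Integration.integral_diff)
    qed
    finally show ?thesis .
  qed
  have "integrable lborel (\<lambda>x. time_int T (\<lambda>s. 1) u x * f x)"
    by (rule L1_bdd_integrable[OF L1_bdd_mult[OF L1_bdd_time_int[OF ui o] f]])
  moreover have "integrable lborel (\<lambda>x. time_int T w Bu x * f x)"
    by (rule L1_bdd_integrable[OF L1_bdd_mult[OF L1_bdd_time_int[OF Bi w] f]])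
  ultimately have i: "integrable lborel (\<lambda>x. time_int T (\<lambda>s. 1) u x * f x)" "integrable lborel (\<lambda>x. time_int T w Bu x * f x)" .
  have "(LBINT x. V 0 u x * f x) = (LBINT x. (time_int T (\<lambda>s. 1) u x * f x) / of_real T - \<i> * (time_int T w Bu x * f x))"
    unfolding V0 by (intro Bochner_Integration.integral_cong) (auto simp: algebra_simps)
  also have "... = (LBINT x. u x * time_int T (\<lambda>s. 1) f x) / of_real T - \<i> * (LBINT x. Bu x * time_int T w f x)"
    using i time_int_symmetric[OF ui f o] time_int_symmetric[OF Bi f w]
    by (subst Bochner_Integration.integral_diff) auto
  finally have e: "(LBINT x. V 0 u x * f x)
    = (LBINT x. u x * time_int T (\<lambda>s. 1) f x) / of_real T - \<i> * (LBINT x. Bu x * time_int T w f x)" .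
  have "norm (A / of_real T - \<i> * B) \<le> norm A / T + norm B" for A B
    using norm_triangle_ineq4[of "A / of_real T" "\<i> * B"] T by (simp add: norm_divide norm_mult)
  then have "norm (LBINT x. V 0 u x * f x)
    \<le> norm (LBINT x. u x * time_int T (\<lambda>s. 1) f x) / T + norm (LBINT x. Bu x * time_int T w f x)"
    unfolding e .
  also have "... \<le> sqrt (l2sq u) * sqrt (l2sq (time_int T (\<lambda>s. 1) f)) / T + sqrt (l2sq Bu) * sqrt (l2sq (time_int T w f))"
    using T by (intro add_mono divide_right_mono Cauchy_Schwarz_l2sq ui Bi L1_bdd_time_int[OF f o] L1_bdd_time_int[OF f w]) auto
  finally show ?thesis unfolding w_def .
qed

text \<open>V 0 u x averages u against a probability density; the Lipschitz bound turns the error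
  into its first moment, of order sqrt \<epsilon> uniformly in x.\<close>

lemma norm_V_0_diff_le:
  assumes u: "L1_bdd u" and L: "0 \<le> L" "\<And>x z. norm (u (x - z) - u x) \<le> L * norm z"
  shows "norm (V 0 u x - u x) \<le> L * (2 powr (real DIM('a) / 2) * sqrt (8 * \<epsilon>))"
proof -
  have k: "integrable lborel (\<lambda>z. norm (K 0 z))" "(LBINT z. norm (K 0 z)) = 1"
    using has_bochner_integral_K_0 by (auto simp: has_bochner_integral_iff)
  have Ki: "integrable lborel (K 0)" by (rule L1_bdd_integrable[OF L1_bdd_K])
  have K1: "(LBINT z. K 0 z) = 1"
  proof -
    have "(LBINT z. K 0 z) = (LBINT z. complex_of_real (norm (K 0 z)))"
      by (intro Bochner_Integration.integral_cong refl K_0)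
    then show ?thesis by (simp only: integral_complex_of_real k(2) of_real_1)
  qed
  have i1: "integrable lborel (\<lambda>z. K 0 z * u (x - z))"
    by (intro L1_bdd_integrable L1_bdd_mult L1_bdd_K L1_bdd_reflect[OF u])
  have "V 0 u x = (LBINT z. K 0 (x - (x - z)) * u (x - z))"
    unfolding V_def using lborel_integral_reflect(1)[OF integrable_V_kernel[OF u, of 0 x], of x] by simp
  then have V: "V 0 u x = (LBINT z. K 0 z * u (x - z))" by simp
  have "V 0 u x - u x = (LBINT z. K 0 z * u (x - z) - K 0 z * u x)"
    unfolding V using i1 Ki K1 by simp
  also have "... = (LBINT z. K 0 z * (u (x - z) - u x))" by (simp add: algebra_simps)
  finally have "norm (V 0 u x - u x) \<le> (LBINT z. norm (K 0 z * (u (x - z) - u x)))"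
    by (simp only: integral_norm_bound)
  also have "... \<le> (LBINT z. L * (norm (K 0 z) * norm z))"
  proof (rule integral_mono')
    show "integrable lborel (\<lambda>z. L * (norm (K 0 z) * norm z))" using first_moment_K_0(1) by simp
    show "norm (K 0 z * (u (x - z) - u x)) \<le> L * (norm (K 0 z) * norm z)" for z
      using mult_left_mono[OF L(2)[of x z], of "norm (K 0 z)"] by (simp add: norm_mult mult_ac)
  qed (use L in auto)
  also have "... \<le> L * (2 powr (real DIM('a) / 2) * sqrt (8 * \<epsilon>))"
    using first_moment_K_0(2) L(1) by (simp add: mult_left_mono)
  finally show ?thesis .
qed

end

section \<open>Level sets\<close>

lemma L1_bdd_of_indicator_bound:
  assumes f: "f \<in> borel_measurable borel" "\<And>z. norm (f z) \<le> h * indicator E z"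
    and E: "E \<in> sets borel" "emeasure lborel E < \<infinity>" and h: "0 \<le> h"
  shows "L1_bdd f" "(LBINT z. norm (f z)) \<le> h * measure lborel E" "l2sq f \<le> h\<^sup>2 * measure lborel E"
proof -
  have iE: "integrable lborel (indicator E :: 'a \<Rightarrow> real)" using E by (intro integrable_real_indicator) auto
  show b: "L1_bdd f"
  proof (rule L1_bddI[OF f(1) _ f(2)])
    show "integrable lborel (\<lambda>z. h * indicator E z)" using iE by simp
    show "norm (f z) \<le> h" for z using f(2)[of z] h by (cases "z \<in> E") auto
  qed
  have "(LBINT z. norm (f z)) \<le> (LBINT z. h * indicator E z)"
    using iE f(2) h by (intro integral_mono') auto
  also have "... = h * measure lborel E" using E by simp
  finally show "(LBINT z. norm (f z)) \<le> h * measure lborel E" .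
  have "l2sq f \<le> (LBINT z. h\<^sup>2 * indicator E z)"
    unfolding l2sq_def
  proof (rule integral_mono')
    show "(norm (f z))\<^sup>2 \<le> h\<^sup>2 * indicator E z" for z
      using power_mono[OF f(2)[of z], of 2] by (auto simp: indicator_def)
  qed (use iE in auto)
  also have "... = h\<^sup>2 * measure lborel E" using E by simp
  finally show "l2sq f \<le> h\<^sup>2 * measure lborel E" .
qed

text \<open>On \<open>[0, T]\<close> the decay \<open>\<bar>s\<bar> powr (-d/2)\<close> is weakened to \<open>T powr (\<gamma> - d/2) * \<bar>s\<bar> powr (-\<gamma>)\<close>. This makes
  the non-endpoint exponents, and in particular \<open>d = 2\<close>, endpoint cases for \<open>\<gamma>\<close>.\<close>

lemma (in oscillatory_kernel) l2sq_time_int_levels: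
  fixes \<gamma> b x\<^sub>0 T :: real and f :: "nat \<Rightarrow> 'a \<Rightarrow> complex" and w :: "real \<Rightarrow> complex"
  assumes \<gamma>: "1 < \<gamma>" "real DIM('a) / 2 \<le> \<gamma>" and b: "1 < b" and F: "finite F" and pos: "0 < x\<^sub>0" "0 < T"
    and f: "\<And>k. k \<in> F \<Longrightarrow> f k \<in> borel_measurable borel" "\<And>k z. k \<in> F \<Longrightarrow> norm (f k z) \<le> h k * indicator (E k) z"
    and E: "\<And>k. k \<in> F \<Longrightarrow> E k \<in> sets borel \<and> emeasure lborel (E k) < \<infinity> \<and> 0 < measure lborel (E k)"
    and h: "\<And>k. k \<in> F \<Longrightarrow> h k = x\<^sub>0 * b ^ k"
    and w: "w \<in> borel_measurable borel" "\<And>s. s \<in> {0..T} \<Longrightarrow> norm (w s) \<le> 1"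
  shows "l2sq (time_int T w (\<lambda>z. \<Sum>k\<in>F. f k z))
    \<le> curve_sum_const \<gamma> b * T * (\<Sum>k\<in>F. (h k)\<^sup>2 * measure lborel (E k) * (T powr (\<gamma> - real DIM('a) / 2) * measure lborel (E k)) powr (1 / \<gamma>))"
proof -
  define D where "D = T powr (\<gamma> - real DIM('a) / 2)"
  define m where "m = (\<lambda>k. measure lborel (E k))"
  define v where "v = (\<lambda>k s y. indicator {0..T} s * w s * V s (f k) y)"
  have h0: "0 \<le> h k" if "k \<in> F" for k using h[OF that] pos b by simp
  have fb: "L1_bdd (f k)" "(LBINT z. norm (f k z)) \<le> h k * m k" "l2sq (f k) \<le> (h k)\<^sup>2 * m k" if "k \<in> F" for k
    using L1_bdd_of_indicator_bound[OF f(1)[OF that] f(2)[OF that]] E[OF that] h0[OF that] by (auto simp: m_def)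
  have cur: "curve T (v k)" if "k \<in> F" for k unfolding v_def by (rule curve_V[OF fb(1)[OF that] w])
  have "l2sq (\<lambda>y. \<Sum>k\<in>F. LBINT s. v k s y) \<le> curve_sum_const \<gamma> b * T * (\<Sum>k\<in>F. (h k)\<^sup>2 * m k * (D * m k) powr (1 / \<gamma>))"
  proof (rule l2sq_sum_integral_curve_le[OF \<gamma>(1) b F pos(1) _ _ cur h])
    show "0 < D" "0 \<le> T" using pos by (auto simp: D_def)
    show "0 < m k" if "k \<in> F" for k using E[OF that] by (simp add: m_def)
    show "l2sq (v k t) \<le> (h k)\<^sup>2 * m k" if k: "k \<in> F" for k t
    proof -
      have "norm (v k t y) \<le> norm (V t (f k) y)" for y
        using w(2)[of t] mult_right_mono[of "norm (w t)" 1 "norm (V t (f k) y)"] by (auto simp: v_def norm_mult indicator_def)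
      then have "l2sq (v k t) \<le> l2sq (V t (f k))"
        unfolding l2sq_def by (intro integral_mono' integrable_norm_sq L1_bdd_V fb k power_mono) auto
      then show ?thesis using l2sq_V_le[OF fb(1)[OF k], of t] fb(3)[OF k] by linarith
    qed
    show "norm (LBINT y. v k s y * cnj (v l t y)) \<le> D * h k * h l * m k * m l * \<bar>s - t\<bar> powr (-\<gamma>)"
      if k: "k \<in> F" and l: "l \<in> F" and st: "s \<noteq> t" for k l s t
    proof (cases "s \<in> {0..T} \<and> t \<in> {0..T}")
      case False
      then have "(LBINT y. v k s y * cnj (v l t y)) = 0" by (auto simp: v_def)
      then show ?thesis using h0[OF k] h0[OF l] by (auto simp: D_def m_def intro!: mult_nonneg_nonneg)
    next
      case True
      have "(LBINT y. v k s y * cnj (v l t y)) = w s * cnj (w t) * (LBINT y. V s (f k) y * cnj (V t (f l) y))"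
        unfolding integral_mult_right_zero[symmetric] using True by (simp add: v_def mult_ac)
      then have "norm (LBINT y. v k s y * cnj (v l t y)) = norm (w s) * norm (w t) * norm (LBINT y. V s (f k) y * cnj (V t (f l) y))"
        by (simp add: norm_mult)
      also have "... \<le> 1 * 1 * norm (LBINT y. V s (f k) y * cnj (V t (f l) y))"
        using w(2) True by (intro mult_mono) auto
      also have "... \<le> \<bar>s - t\<bar> powr (- real DIM('a) / 2) * (LBINT y. norm (f k y)) * (LBINT y. norm (f l y))"
        using dispersive_inner_V[OF fb(1)[OF k] fb(1)[OF l] st] by simp
      also have "... \<le> (D * \<bar>s - t\<bar> powr (-\<gamma>)) * (h k * m k) * (h l * m l)"
      proof (intro mult_mono fb(2) k l)
        have "\<bar>s - t\<bar> powr (- real DIM('a) / 2) = \<bar>s - t\<bar> powr (\<gamma> - real DIM('a) / 2) * \<bar>s - t\<bar> powr (-\<gamma>)"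
          by (simp flip: powr_add)
        also have "... \<le> D * \<bar>s - t\<bar> powr (-\<gamma>)"
          unfolding D_def using True \<gamma> by (intro mult_right_mono powr_mono2) auto
        finally show "\<bar>s - t\<bar> powr (- real DIM('a) / 2) \<le> D * \<bar>s - t\<bar> powr (-\<gamma>)" .
      qed (use h0[OF k] in \<open>auto simp: D_def m_def\<close>)
      finally show ?thesis by (simp add: mult_ac)
    qed
  qed
  also have "(\<lambda>y. \<Sum>k\<in>F. LBINT s. v k s y) = time_int T w (\<lambda>z. \<Sum>k\<in>F. f k z)"
  proof
    fix y
    have "(\<Sum>k\<in>F. LBINT s. v k s y) = (LBINT s. (\<Sum>k\<in>F. v k s y))"
      by (rule Bochner_Integration.integral_sum[symmetric]) (rule integrable_curve_time[OF cur])
    also have "... = time_int T w (\<lambda>z. \<Sum>k\<in>F. f k z) y"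
      unfolding time_int_def v_def by (simp add: V_sum[of F f, OF fb(1)] sum_distrib_left)
    finally show "(\<Sum>k\<in>F. LBINT s. v k s y) = time_int T w (\<lambda>z. \<Sum>k\<in>F. f k z) y" .
  qed
  finally show "l2sq (time_int T w (\<lambda>z. \<Sum>k\<in>F. f k z))
    \<le> curve_sum_const \<gamma> b * T * (\<Sum>k\<in>F. (h k)\<^sup>2 * measure lborel (E k) * (T powr (\<gamma> - real DIM('a) / 2) * measure lborel (E k)) powr (1 / \<gamma>))"
    by (simp add: D_def m_def)
qed

text \<open>The inclusion of l^1 in l^p, from \<open>x powr p = x * x powr (p - 1)\<close> and the
  bound of each term by the sum. It will be used with p = (\<gamma> + 1) / \<gamma>.\<close>

lemma sum_powr_le:
  fixes x :: "'i \<Rightarrow> real"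
  assumes "finite F" "\<And>k. k \<in> F \<Longrightarrow> 0 \<le> x k" "1 \<le> p"
  shows "(\<Sum>k\<in>F. x k powr p) \<le> (\<Sum>k\<in>F. x k) powr p"
proof -
  have S: "0 \<le> (\<Sum>k\<in>F. x k)" using assms by (intro sum_nonneg)
  have "(\<Sum>k\<in>F. x k powr p) \<le> (\<Sum>k\<in>F. x k * (\<Sum>k\<in>F. x k) powr (p - 1))"
  proof (rule sum_mono)
    fix k assume k: "k \<in> F"
    have "x k powr p = x k * x k powr (p - 1)"
      using powr_add[of "x k" 1 "p - 1"] assms(2)[OF k] by simp
    also have "... \<le> x k * (\<Sum>k\<in>F. x k) powr (p - 1)"
      using assms k by (intro mult_left_mono powr_mono2 member_le_sum) auto
    finally show "x k powr p \<le> x k * (\<Sum>k\<in>F. x k) powr (p - 1)" .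
  qed
  also have "... = (\<Sum>k\<in>F. x k) powr p"
    using powr_add[of "\<Sum>k\<in>F. x k" 1 "p - 1"] S by (simp add: sum_distrib_right)
  finally show ?thesis .
qed

lemma le_if_le_add_sqrt:
  fixes S X Y :: real
  assumes "\<And>\<epsilon>. 0 < \<epsilon> \<Longrightarrow> S \<le> X * sqrt \<epsilon> + Y" "0 \<le> X"
  shows "S \<le> Y"
proof (rule field_le_epsilon)
  fix e :: real assume e: "0 < e"
  define d where "d = e / (X + 1)"
  have d: "0 < d" "X * d \<le> e" using e assms(2) by (auto simp: d_def field_simps)
  show "S \<le> Y + e" using assms(1)[of "d\<^sup>2"] d by simp
qed

lemma integrable_indicator_superlevel:
  assumes u: "L1_bdd u" and a: "0 < a" and E: "E \<in> sets borel" "\<And>z. z \<in> E \<Longrightarrow> a < norm (u z)"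
  shows "integrable lborel (indicator E :: 'a::euclidean_space \<Rightarrow> real)"
proof (rule Bochner_Integration.integrable_bound)
  show "integrable lborel (\<lambda>z. norm (u z) / a)" using L1_bdd_integrable[OF u] by simp
  have "norm (indicator E z :: real) \<le> norm (norm (u z) / a)" for z
    using a E(2)[of z] by (cases "z \<in> E") (auto simp: field_simps)
  then show "AE z in lborel. norm (indicator E z :: real) \<le> norm (norm (u z) / a)" by (intro AE_I2)
qed (use E in simp)

text \<open>The regularisation is removed here: X does not depend on \<epsilon>, while replacing V 0
  u by u costs O(sqrt \<epsilon>) after pairing with an integrable function. The kernel locale is
  therefore entered afresh for every \<epsilon>.\<close>

lemma norm_pairing_levels_le:
  fixes \<gamma> b x\<^sub>0 T L :: real and f :: "nat \<Rightarrow> 'a::euclidean_space \<Rightarrow> complex"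
  assumes sg: "\<And>b. b \<in> Basis \<Longrightarrow> (sg b)\<^sup>2 = 1"
    and u: "C2_dir u u1 u2" and L: "0 \<le> L" "\<And>x z. norm (u (x - z) - u x) \<le> L * norm z"
    and \<gamma>: "1 < \<gamma>" "real DIM('a) / 2 \<le> \<gamma>" and b: "1 < b" and F: "finite F" and pos: "0 < x\<^sub>0" "0 < T"
    and f: "\<And>k. k \<in> F \<Longrightarrow> f k \<in> borel_measurable borel" "\<And>k z. k \<in> F \<Longrightarrow> norm (f k z) \<le> h k * indicator (E k) z"
    and E: "\<And>k. k \<in> F \<Longrightarrow> E k \<in> sets borel \<and> emeasure lborel (E k) < \<infinity> \<and> 0 < measure lborel (E k)"
    and h: "\<And>k. k \<in> F \<Longrightarrow> h k = x\<^sub>0 * b ^ k"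
  defines "Bu \<equiv> (\<lambda>z. \<Sum>b\<in>Basis. of_real (sg b) * u2 b z)"
    and "X \<equiv> curve_sum_const \<gamma> b * T * (\<Sum>k\<in>F. (h k)\<^sup>2 * measure lborel (E k) * (T powr (\<gamma> - real DIM('a) / 2) * measure lborel (E k)) powr (1 / \<gamma>))"
  shows "norm (LBINT x. u x * (\<Sum>k\<in>F. f k x)) \<le> (sqrt (l2sq u) / T + sqrt (l2sq Bu)) * sqrt X"
proof -
  define g where "g = (\<lambda>x. \<Sum>k\<in>F. f k x)"
  have h0: "0 \<le> h k" if "k \<in> F" for k using h[OF that] pos b by simp
  have fb: "L1_bdd (f k)" if "k \<in> F" for k
    using L1_bdd_of_indicator_bound(1)[OF f(1)[OF that] f(2)[OF that]] E[OF that] h0[OF that] by auto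
  have g: "L1_bdd g" unfolding g_def by (rule L1_bdd_sum[OF fb])
  have ui: "L1_bdd u" using u by (simp add: C2_dir_def)
  define c where "c = L * (2 powr (real DIM('a) / 2) * sqrt 8) * (LBINT x. norm (g x))"
  have "norm (LBINT x. u x * g x) \<le> (sqrt (l2sq u) / T + sqrt (l2sq Bu)) * sqrt X"
  proof (rule le_if_le_add_sqrt)
    show "0 \<le> c" using L by (simp add: c_def)
    fix \<epsilon> :: real assume \<epsilon>: "0 < \<epsilon>"
    interpret oscillatory_kernel sg \<epsilon> using sg \<epsilon> by unfold_locales
    have V0: "L1_bdd (V 0 u)" by (rule L1_bdd_V[OF ui])
    have i: "integrable lborel (\<lambda>x. u x * g x)" "integrable lborel (\<lambda>x. V 0 u x * g x)"
      using L1_bdd_mult[OF ui g] L1_bdd_mult[OF V0 g] by (auto dest: L1_bdd_integrable)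
    have gi: "integrable lborel (\<lambda>x. norm (g x))" using L1_bdd_integrable[OF g] by simp
    have "norm (LBINT x. V 0 u x * g x - u x * g x) \<le> (LBINT x. norm (V 0 u x * g x - u x * g x))"
      by (rule integral_norm_bound)
    also have "... \<le> (LBINT x. L * (2 powr (real DIM('a) / 2) * sqrt (8 * \<epsilon>)) * norm (g x))"
    proof (rule integral_mono')
      show "norm (V 0 u x * g x - u x * g x) \<le> L * (2 powr (real DIM('a) / 2) * sqrt (8 * \<epsilon>)) * norm (g x)" for x
        using mult_right_mono[OF norm_V_0_diff_le[OF ui L, of x], of "norm (g x)"]
        by (simp add: norm_mult left_diff_distrib[symmetric])
    qed (use gi L \<epsilon> in auto)
    also have "... = c * sqrt \<epsilon>" by (simp add: c_def real_sqrt_mult mult_ac)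
    finally have 1: "norm ((LBINT x. V 0 u x * g x) - (LBINT x. u x * g x)) \<le> c * sqrt \<epsilon>" using i by simp
    have w: "(\<lambda>s. complex_of_real (1 - s / T)) \<in> borel_measurable borel"
      "\<And>s. s \<in> {0..T} \<Longrightarrow> norm (complex_of_real (1 - s / T)) \<le> 1"
      unfolding norm_of_real using pos by (auto intro!: borel_measurable_of_real)
    have l1: "l2sq (time_int T (\<lambda>s. 1) g) \<le> X"
      unfolding g_def X_def by (rule l2sq_time_int_levels[OF \<gamma> b F pos f E h]) auto
    have l2: "l2sq (time_int T (\<lambda>s. of_real (1 - s / T)) g) \<le> X"
      unfolding g_def X_def by (rule l2sq_time_int_levels[OF \<gamma> b F pos f E h w])
    have "norm (LBINT x. V 0 u x * g x)
      \<le> sqrt (l2sq u) * sqrt (l2sq (time_int T (\<lambda>s. 1) g)) / T + sqrt (l2sq Bu) * sqrt (l2sq (time_int T (\<lambda>s. of_real (1 - s / T)) g))"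
      unfolding Bu_def by (rule norm_pairing_V_0_le[OF u g pos(2)])
    also have "... \<le> sqrt (l2sq u) * sqrt X / T + sqrt (l2sq Bu) * sqrt X"
      using pos l1 l2 by (intro add_mono divide_right_mono mult_left_mono real_sqrt_le_mono) auto
    also have "... = (sqrt (l2sq u) / T + sqrt (l2sq Bu)) * sqrt X" by (simp add: algebra_simps)
    finally show "norm (LBINT x. u x * g x) \<le> c * sqrt \<epsilon> + (sqrt (l2sq u) / T + sqrt (l2sq Bu)) * sqrt X"
      using 1 norm_triangle_ineq3[of "LBINT x. V 0 u x * g x" "LBINT x. u x * g x"] by linarith
  qed
  then show ?thesis by (simp add: g_def)
qed

text \<open>Duality with an explicit test function, the conjugate phase of u times a step version of
  |u|^(q-1). The pairing is at least the level sum S and, by \<open>norm_pairing_levels_le\<close>,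
  at most a multiple of S^((\<gamma>+1)/(2\<gamma>)); dividing leaves S^(1/q). The division is
  legitimate since F is finite, and the resulting bound depends neither on F nor on a.\<close>

lemma level_sum_le:
  fixes \<gamma> a T L :: real and u :: "'a::euclidean_space \<Rightarrow> complex"
  assumes sg: "\<And>b. b \<in> Basis \<Longrightarrow> (sg b)\<^sup>2 = 1"
    and u: "C2_dir u u1 u2" and L: "0 \<le> L" "\<And>x z. norm (u (x - z) - u x) \<le> L * norm z"
    and \<gamma>: "1 < \<gamma>" "real DIM('a) / 2 \<le> \<gamma>" and F: "finite F" and pos: "0 < a" "0 < T"
  defines "q \<equiv> 2 * \<gamma> / (\<gamma> - 1)" and "E \<equiv> (\<lambda>k::nat. {z. a * 2 ^ k < norm (u z) \<and> norm (u z) \<le> a * 2 ^ Suc k})"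
    and "Bu \<equiv> (\<lambda>z. \<Sum>b\<in>Basis. of_real (sg b) * u2 b z)"
  shows "(\<Sum>k\<in>F. (a * 2 ^ k) powr q * measure lborel (E k)) powr (1 / q)
    \<le> (sqrt (l2sq u) / T + sqrt (l2sq Bu)) * sqrt (curve_sum_const \<gamma> (2 powr (q - 1))) * T powr (1 - real DIM('a) / (4 * \<gamma>))"
proof -
  define m where "m = (\<lambda>k. measure lborel (E k))"
  \<comment> \<open>A null level set has M k = 0, which would spoil the ratios M k / M l; it
    contributes nothing to the sum.\<close>
  define F' where "F' = {k\<in>F. 0 < m k}"
  define x where "x = (\<lambda>k. (a * 2 ^ k) powr q * m k)"
  define S where "S = (\<Sum>k\<in>F'. x k)"
  define h where "h = (\<lambda>k::nat. (a * 2 ^ k) powr (q - 1))"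
  \<comment> \<open>At zeros of u the quotient is 0 by convention, and no \<open>E k\<close>
    contains such a point.\<close>
  define f where "f = (\<lambda>k z. of_real (h k) * (cnj (u z) / of_real (norm (u z))) * indicator (E k) z :: complex)"
  define A where "A = sqrt (l2sq u) / T + sqrt (l2sq Bu)"
  define c where "c = curve_sum_const \<gamma> (2 powr (q - 1))"
  have q: "2 < q" using \<gamma> by (simp add: q_def field_simps)
  have b: "1 < 2 powr (q - 1)" using q by simp
  have c: "0 < c" unfolding c_def by (rule curve_sum_const_pos[OF \<gamma>(1) b])
  have A: "0 \<le> A" using pos by (simp add: A_def)
  have F': "finite F'" using F by (simp add: F'_def)
  have ui: "L1_bdd u" and uc: "continuous_on UNIV u" using u by (auto simp: C2_dir_def)
  have um [measurable]: "u \<in> borel_measurable borel" using L1_bdd_measurable[OF ui] .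
  have Em [measurable]: "E k \<in> sets borel" for k unfolding E_def by measurable
  have Ef: "emeasure lborel (E k) < \<infinity>" for k
    using integrable_indicator_superlevel[OF ui _ Em, of "a * 2 ^ k" k] pos
    by (simp add: E_def integrable_indicator_iff)
  \<comment> \<open>The heights of the test function are geometric with ratio
    \<open>2 powr (q - 1)\<close>, which becomes the b of the level estimate.\<close>
  have hk: "h k = a powr (q - 1) * (2 powr (q - 1)) ^ k" for k
  proof -
    have "h k = a powr (q - 1) * (2 ^ k) powr (q - 1)" unfolding h_def by (rule powr_mult)
    also have "(2 ^ k :: real) powr (q - 1) = (2 powr (q - 1)) ^ k"
    proof -
      have "(2 ^ k :: real) powr (q - 1) = 2 powr (real k * (q - 1))" by (simp only: powr_powr[symmetric] powr_realpow)
      also have "... = (2 powr (q - 1)) ^ k" by (simp add: powr_power mult.commute)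
      finally show ?thesis .
    qed
    finally show ?thesis .
  qed
  have h0: "0 < h k" for k using pos by (simp add: h_def)
  have x0: "0 \<le> x k" for k by (simp add: x_def m_def)
  have fm: "f k \<in> borel_measurable borel" for k
  proof -
    have c [measurable]: "(\<lambda>z. cnj (u z)) \<in> borel_measurable borel" using ui by (intro L1_bdd_measurable) simp
    have n [measurable]: "(\<lambda>z. complex_of_real (norm (u z))) \<in> borel_measurable borel"
      by (intro borel_measurable_continuous_onI continuous_intros uc)
    have "(indicator (E k) :: 'a \<Rightarrow> complex) \<in> borel_measurable borel" using Em by (rule borel_measurable_indicator)
    then show ?thesis unfolding f_def by (intro borel_measurable_times borel_measurable_divide borel_measurable_const c n)
  qed
  have fle: "norm (f k z) \<le> h k * indicator (E k) z" for k z
    using h0[of k] by (auto simp: f_def norm_mult norm_divide indicator_def)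
  have fb: "L1_bdd (f k)" for k
    using L1_bdd_of_indicator_bound(1)[OF fm fle Em Ef less_imp_le[OF h0]] .
  have low: "h k * (a * 2 ^ k) * m k \<le> Re (LBINT z. u z * f k z)" for k
  proof -
    have i: "integrable lborel (\<lambda>z. u z * f k z)" by (rule L1_bdd_integrable[OF L1_bdd_mult[OF ui fb]])
    have "(LBINT z. (h k * (a * 2 ^ k)) * indicator (E k) z) \<le> (LBINT z. Re (u z * f k z))"
    proof (rule integral_mono)
      show "integrable lborel (\<lambda>z. (h k * (a * 2 ^ k)) * indicator (E k) z)"
        using Ef[of k] Em[of k] by (intro integrable_mult_right integrable_real_indicator) auto
      show "integrable lborel (\<lambda>z. Re (u z * f k z))" using i by (rule integrable_Re)
      fix z
      have "u z * f k z = of_real (h k * norm (u z) * indicator (E k) z)"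
      proof (cases "u z = 0")
        case False
        have "u z * cnj (u z) = of_real (norm (u z) * norm (u z))"
          using complex_norm_square[of "u z"] by (simp add: power2_eq_square)
        then have "u z * (cnj (u z) / of_real (norm (u z))) = of_real (norm (u z))"
          using False by (simp add: field_simps)
        then have "u z * f k z = of_real (h k) * of_real (norm (u z)) * indicator (E k) z"
        proof -
          have "u z * f k z = of_real (h k) * (u z * (cnj (u z) / of_real (norm (u z)))) * indicator (E k) z"
            unfolding f_def by (simp only: mult_ac)
          then show ?thesis using \<open>u z * (cnj (u z) / of_real (norm (u z))) = of_real (norm (u z))\<close> by (simp only:)
        qed
        then show ?thesis by (simp add: indicator_def)
      qed (simp add: f_def)
      then have "Re (u z * f k z) = h k * norm (u z) * indicator (E k) z" by (simp only: Re_complex_of_real)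
      then show "(h k * (a * 2 ^ k)) * indicator (E k) z \<le> Re (u z * f k z)"
        using h0[of k] by (auto simp: E_def indicator_def)
    qed
    also have "(LBINT z. Re (u z * f k z)) = Re (LBINT z. u z * f k z)" using i by (rule integral_Re)
    also have "(LBINT z. (h k * (a * 2 ^ k)) * indicator (E k) z) = h k * (a * 2 ^ k) * m k"
      using Ef[of k] by (simp add: m_def)
    finally show ?thesis .
  qed
  have xk: "h k * (a * 2 ^ k) * m k = x k" for k
  proof -
    have "(a * 2 ^ k) powr (q - 1) * (a * 2 ^ k) powr 1 = (a * 2 ^ k) powr q" by (simp only: powr_add[symmetric]) simp
    then show ?thesis using pos by (simp add: h_def x_def)
  qed
  have "S \<le> Re (LBINT z. u z * (\<Sum>k\<in>F'. f k z))"
  proof -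
    have "(LBINT z. u z * (\<Sum>k\<in>F'. f k z)) = (\<Sum>k\<in>F'. LBINT z. u z * f k z)"
      unfolding sum_distrib_left
      by (rule Bochner_Integration.integral_sum) (rule L1_bdd_integrable[OF L1_bdd_mult[OF ui fb]])
    then show ?thesis unfolding S_def using low xk by (simp add: sum_mono)
  qed
  also have "... \<le> norm (LBINT z. u z * (\<Sum>k\<in>F'. f k z))" by (rule complex_Re_le_cmod)
  also have "... \<le> A * sqrt (c * T * (\<Sum>k\<in>F'. (h k)\<^sup>2 * m k * (T powr (\<gamma> - real DIM('a) / 2) * m k) powr (1 / \<gamma>)))"
    unfolding A_def c_def m_def Bu_def
  proof (rule norm_pairing_levels_le[OF sg u L \<gamma> b F' _ pos(2) fm fle _ hk])
    show "0 < a powr (q - 1)" using pos by simp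
    show "E k \<in> sets borel \<and> emeasure lborel (E k) < \<infinity> \<and> 0 < measure lborel (E k)" if "k \<in> F'" for k
      using that Em Ef by (simp add: F'_def m_def)
  qed
  also have "(\<Sum>k\<in>F'. (h k)\<^sup>2 * m k * (T powr (\<gamma> - real DIM('a) / 2) * m k) powr (1 / \<gamma>))
    = T powr ((\<gamma> - real DIM('a) / 2) / \<gamma>) * (\<Sum>k\<in>F'. x k powr ((\<gamma> + 1) / \<gamma>))"
    unfolding sum_distrib_left
  proof (rule sum.cong[OF refl])
    fix k assume k: "k \<in> F'"
    have m0: "0 < m k" using k by (simp add: F'_def)
    have "(T powr (\<gamma> - real DIM('a) / 2) * m k) powr (1 / \<gamma>) = T powr ((\<gamma> - real DIM('a) / 2) / \<gamma>) * m k powr (1 / \<gamma>)"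
      by (simp add: powr_mult powr_powr)
    moreover have "x k powr ((\<gamma> + 1) / \<gamma>) = (h k)\<^sup>2 * (m k * m k powr (1 / \<gamma>))"
    proof -
      \<comment> \<open>This identity singles out q: because of it each summand is, apart from the
        power of T, a pure power of x k, whatever the height of the level.\<close>
      have "q * ((\<gamma> + 1) / \<gamma>) = (q - 1) * 2" using \<gamma> by (simp add: q_def field_simps)
      then have "((a * 2 ^ k) powr q) powr ((\<gamma> + 1) / \<gamma>) = ((a * 2 ^ k) powr (q - 1)) powr 2" by (simp only: powr_powr)
      also have "... = (h k)\<^sup>2" using h0[of k] by (simp add: h_def)
      finally have "((a * 2 ^ k) powr q) powr ((\<gamma> + 1) / \<gamma>) = (h k)\<^sup>2" .
      moreover have "m k powr ((\<gamma> + 1) / \<gamma>) = m k * m k powr (1 / \<gamma>)"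
      proof -
        have "(\<gamma> + 1) / \<gamma> = 1 + 1 / \<gamma>" using \<gamma> by (simp add: field_simps)
        then show ?thesis using m0 by (simp add: powr_add)
      qed
      ultimately show ?thesis by (simp add: x_def powr_mult)
    qed
    ultimately show "(h k)\<^sup>2 * m k * (T powr (\<gamma> - real DIM('a) / 2) * m k) powr (1 / \<gamma>)
      = T powr ((\<gamma> - real DIM('a) / 2) / \<gamma>) * x k powr ((\<gamma> + 1) / \<gamma>)" by simp
  qed
  also have "A * sqrt (c * T * (T powr ((\<gamma> - real DIM('a) / 2) / \<gamma>) * (\<Sum>k\<in>F'. x k powr ((\<gamma> + 1) / \<gamma>))))
    \<le> A * sqrt (c * T * (T powr ((\<gamma> - real DIM('a) / 2) / \<gamma>) * S powr ((\<gamma> + 1) / \<gamma>)))"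
    unfolding S_def using A c pos F' x0 \<gamma>
    by (intro mult_left_mono real_sqrt_le_mono sum_powr_le) auto
  also have "... = A * sqrt c * T powr (1 - real DIM('a) / (4 * \<gamma>)) * S powr ((\<gamma> + 1) / (2 * \<gamma>))"
  proof -
    have e: "1/2 + (\<gamma> - real DIM('a) / 2) / (2 * \<gamma>) = 1 - real DIM('a) / (4 * \<gamma>)" using \<gamma> by (simp add: field_simps)
    have "sqrt T * sqrt (T powr ((\<gamma> - real DIM('a) / 2) / \<gamma>)) = T powr (1/2) * T powr ((\<gamma> - real DIM('a) / 2) / (2 * \<gamma>))"
      using pos by (simp add: powr_half_sqrt[symmetric] powr_powr mult.commute)
    also have "... = T powr (1 - real DIM('a) / (4 * \<gamma>))" unfolding powr_add[symmetric] e ..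
    finally have T: "sqrt T * sqrt (T powr ((\<gamma> - real DIM('a) / 2) / \<gamma>)) = T powr (1 - real DIM('a) / (4 * \<gamma>))" .
    have "sqrt (S powr ((\<gamma> + 1) / \<gamma>)) = S powr ((\<gamma> + 1) / (2 * \<gamma>))"
      by (simp add: powr_half_sqrt[symmetric] powr_powr mult.commute)
    note Sq = this
    have "A * sqrt (c * T * (T powr ((\<gamma> - real DIM('a) / 2) / \<gamma>) * S powr ((\<gamma> + 1) / \<gamma>)))
      = A * sqrt c * (sqrt T * sqrt (T powr ((\<gamma> - real DIM('a) / 2) / \<gamma>))) * sqrt (S powr ((\<gamma> + 1) / \<gamma>))"
      by (simp only: real_sqrt_mult mult_ac)
    then show ?thesis by (simp only: T Sq)
  qed
  finally have main: "S \<le> A * sqrt c * T powr (1 - real DIM('a) / (4 * \<gamma>)) * S powr ((\<gamma> + 1) / (2 * \<gamma>))" .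
  have SF: "(\<Sum>k\<in>F. (a * 2 ^ k) powr q * measure lborel (E k)) = S"
    unfolding S_def x_def m_def
    by (rule sum.mono_neutral_right) (use F in \<open>auto simp: F'_def m_def zero_less_measure_iff\<close>)
  have "S powr (1 / q) \<le> A * sqrt c * T powr (1 - real DIM('a) / (4 * \<gamma>))"
  proof (cases "S = 0")
    case True
    then show ?thesis using A c by simp
  next
    case False
    then have S: "0 < S" using x0 sum_nonneg[of F' x] unfolding S_def by fastforce
    \<comment> \<open>The exponent left after dividing S by its power on the right-hand
      side.\<close>
    have "1 / q = 1 - (\<gamma> + 1) / (2 * \<gamma>)" using \<gamma> by (simp add: q_def field_simps)
    then have "S powr (1 / q) * S powr ((\<gamma> + 1) / (2 * \<gamma>)) = S" using S by (simp flip: powr_add)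
    then have "S powr (1 / q) * S powr ((\<gamma> + 1) / (2 * \<gamma>)) \<le> A * sqrt c * T powr (1 - real DIM('a) / (4 * \<gamma>)) * S powr ((\<gamma> + 1) / (2 * \<gamma>))"
      using main by simp
    then show ?thesis using S by (simp add: mult_le_cancel_right)
  qed
  then show ?thesis unfolding SF A_def c_def .
qed

section \<open>The inequality\<close>

text \<open>Since \<open>level_sum_le\<close> is uniform in the lowest height, the values between
  2^(-n) and 2^n are covered by 2 n levels starting at 2^(-n), and n tends to infinity. The leading
  factor 2 is the ratio of the upper to the lower end of a level.\<close>

lemma Lnorm_le_of_time:
  fixes \<gamma> T L :: real and u :: "'a::euclidean_space \<Rightarrow> complex"
  assumes sg: "\<And>b. b \<in> Basis \<Longrightarrow> (sg b)\<^sup>2 = 1"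
    and u: "C2_dir u u1 u2" and L: "0 \<le> L" "\<And>x z. norm (u (x - z) - u x) \<le> L * norm z"
    and \<gamma>: "1 < \<gamma>" "real DIM('a) / 2 \<le> \<gamma>" and T: "0 < T"
  defines "q \<equiv> 2 * \<gamma> / (\<gamma> - 1)" and "Bu \<equiv> (\<lambda>z. \<Sum>b\<in>Basis. of_real (sg b) * u2 b z)"
  shows "Lnorm q u \<le> 2 * ((sqrt (l2sq u) / T + sqrt (l2sq Bu)) * sqrt (curve_sum_const \<gamma> (2 powr (q - 1))) * T powr (1 - real DIM('a) / (4 * \<gamma>)))"
proof -
  define B where "B = (sqrt (l2sq u) / T + sqrt (l2sq Bu)) * sqrt (curve_sum_const \<gamma> (2 powr (q - 1))) * T powr (1 - real DIM('a) / (4 * \<gamma>))"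
  have q: "2 < q" using \<gamma> by (simp add: q_def field_simps)
  have B0: "0 \<le> B"
    unfolding B_def using T curve_sum_const_pos[OF \<gamma>(1), of "2 powr (q - 1)"] q by (auto intro!: mult_nonneg_nonneg add_nonneg_nonneg)
  have ui: "L1_bdd u" using u by (auto simp: C2_dir_def)
  have um [measurable]: "u \<in> borel_measurable borel" using L1_bdd_measurable[OF ui] .
  define U where "U = (\<lambda>n::nat. {z. (1/2) ^ n < norm (u z) \<and> norm (u z) \<le> 2 ^ n})"
  have Um [measurable]: "U n \<in> sets borel" for n unfolding U_def by measurable
  \<comment> \<open>The integral in \<open>Lnorm\<close> would have the default value 0 if this
    failed; the same function dominates the limit in n.\<close>
  have int: "integrable lborel (\<lambda>z. norm (u z) powr q)"
  proof -
    obtain M where M: "0 < M" "\<And>z. norm (u z) \<le> M" using L1_bdd_bound[OF ui] by blast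
    show ?thesis
    proof (rule Bochner_Integration.integrable_bound)
      show "integrable lborel (\<lambda>z. M powr (q - 1) * norm (u z))" using L1_bdd_integrable[OF ui] by simp
      have "norm (u z) powr q \<le> M powr (q - 1) * norm (u z)" for z
      proof -
        have "norm (u z) powr q = norm (u z) powr (q - 1) * norm (u z)"
          using powr_add[of "norm (u z)" "q - 1" 1] by simp
        also have "... \<le> M powr (q - 1) * norm (u z)" using M q by (intro mult_right_mono powr_mono2) auto
        finally show ?thesis .
      qed
      then show "AE z in lborel. norm (norm (u z) powr q) \<le> norm (M powr (q - 1) * norm (u z))"
        using M by (intro AE_I2) (simp add: abs_mult)
    qed measurable
  qed
  have step: "(LBINT z. indicator (U n) z * norm (u z) powr q) \<le> (2 * B) powr q" for n
  proof -
    define a :: real where "a = (1/2) ^ n"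
    define E where "E = (\<lambda>k::nat. {z. a * 2 ^ k < norm (u z) \<and> norm (u z) \<le> a * 2 ^ Suc k})"
    define S where "S = (\<Sum>k<2*n. (a * 2 ^ k) powr q * measure lborel (E k))"
    have a: "0 < a" by (simp add: a_def)
    have Em [measurable]: "E k \<in> sets borel" for k unfolding E_def by measurable
    have iE: "integrable lborel (indicator (E k) :: 'a \<Rightarrow> real)" for k
      by (rule integrable_indicator_superlevel[OF ui _ Em, of "a * 2 ^ k"]) (use a in \<open>auto simp: E_def\<close>)
    have S0: "0 \<le> S" unfolding S_def by (intro sum_nonneg) auto
    have "S powr (1 / q) \<le> B"
      unfolding S_def E_def B_def q_def Bu_def
      by (rule level_sum_le[OF sg u L \<gamma> _ a T]) simp_all
    then have "(S powr (1 / q)) powr q \<le> B powr q" using q by (intro powr_mono2) auto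
    then have SB: "S \<le> B powr q" using q S0 by (simp add: powr_powr)
    have cover: "\<exists>k<2*n. z \<in> E k" if z: "z \<in> U n" for z
    proof -
      \<comment> \<open>The first level whose upper end reaches |u z|. Minimality gives the lower
        bound, except at k = 0, where it is part of \<open>U n\<close>.\<close>
      define k where "k = (LEAST k. norm (u z) \<le> a * 2 ^ Suc k)"
      have an: "a * 2 ^ (2 * n) = 2 ^ n"
        by (simp add: a_def power_mult_distrib power_one_over mult_2 power_add)
      \<comment> \<open>\<open>U 0\<close> is empty, so 2 n - 1 below is a genuine
        predecessor.\<close>
      have n: "0 < n" using z by (cases n) (auto simp: U_def)
      have "norm (u z) \<le> a * 2 ^ Suc (2 * n - 1)" using z an n by (simp add: U_def del: power_Suc)
      then have k1: "norm (u z) \<le> a * 2 ^ Suc k" and k2: "k \<le> 2 * n - 1"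
        unfolding k_def by (rule LeastI, rule Least_le)
      have "a * 2 ^ k < norm (u z)"
      proof (cases k)
        case 0
        then show ?thesis using z by (simp add: U_def a_def)
      next
        case (Suc j)
        then have "\<not> norm (u z) \<le> a * 2 ^ Suc j" using not_less_Least[of j "\<lambda>k. norm (u z) \<le> a * 2 ^ Suc k"] by (simp add: k_def)
        then show ?thesis using Suc by simp
      qed
      then show ?thesis using k1 k2 n by (intro exI[of _ k]) (auto simp: E_def)
    qed
    have "(LBINT z. indicator (U n) z * norm (u z) powr q) \<le> (LBINT z. (\<Sum>k<2*n. (a * 2 ^ Suc k) powr q * indicator (E k) z))"
    proof (rule integral_mono')
      show "integrable lborel (\<lambda>z. \<Sum>k<2*n. (a * 2 ^ Suc k) powr q * indicator (E k) z)"
        by (intro Bochner_Integration.integrable_sum integrable_mult_right iE)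
      fix z
      show nn: "0 \<le> (\<Sum>k<2*n. (a * 2 ^ Suc k) powr q * indicator (E k) z)" by (intro sum_nonneg) auto
      show "indicator (U n) z * norm (u z) powr q \<le> (\<Sum>k<2*n. (a * 2 ^ Suc k) powr q * indicator (E k) z)"
      proof (cases "z \<in> U n")
        case True
        obtain k where k: "k < 2 * n" "z \<in> E k" using cover[OF True] by blast
        have "norm (u z) powr q \<le> (a * 2 ^ Suc k) powr q * indicator (E k) z"
          using k q by (auto simp: E_def intro!: powr_mono2)
        also have "... \<le> (\<Sum>k<2*n. (a * 2 ^ Suc k) powr q * indicator (E k) z)"
          using k by (intro member_le_sum) auto
        finally show ?thesis using True by simp
      qed (use nn in simp)
    qed
    also have "... = (\<Sum>k<2*n. (a * 2 ^ Suc k) powr q * measure lborel (E k))"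
      using iE by (subst Bochner_Integration.integral_sum) auto
    also have "... = 2 powr q * S"
    proof -
      have "a * 2 ^ Suc k = 2 * (a * 2 ^ k)" for k by simp
      then show ?thesis unfolding S_def sum_distrib_left by (simp only: powr_mult mult.assoc)
    qed
    also have "... \<le> 2 powr q * B powr q" using SB by (intro mult_left_mono) auto
    also have "... = (2 * B) powr q" by (simp add: powr_mult)
    finally show ?thesis .
  qed
  have "(\<lambda>n. LBINT z. indicator (U n) z * norm (u z) powr q) \<longlonglongrightarrow> (LBINT z. norm (u z) powr q)"
  proof (rule integral_dominated_convergence)
    show "integrable lborel (\<lambda>z. norm (u z) powr q)" by (rule int)
    show "AE z in lborel. norm (indicator (U n) z * norm (u z) powr q) \<le> norm (u z) powr q" for n
      by (intro AE_I2) (auto simp: indicator_def)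
    show "AE z in lborel. (\<lambda>n. indicator (U n) z * norm (u z) powr q) \<longlonglongrightarrow> norm (u z) powr q"
    proof (intro AE_I2)
      fix z
      show "(\<lambda>n. indicator (U n) z * norm (u z) powr q) \<longlonglongrightarrow> norm (u z) powr q"
      proof (cases "u z = 0")
        case False
        have "eventually (\<lambda>n. (1/2::real) ^ n < norm (u z)) sequentially"
          using False by (intro order_tendstoD(2)[OF LIMSEQ_power_zero]) auto
        moreover have "eventually (\<lambda>n. norm (u z) \<le> 2 ^ n) sequentially"
        proof -
          obtain m where "norm (u z) < 2 ^ m" using real_arch_pow[of 2 "norm (u z)"] by auto
          then have "norm (u z) \<le> 2 ^ n" if "m \<le> n" for n
            using power_increasing[OF that, of "2::real"] by linarith
          then show ?thesis by (auto simp: eventually_sequentially)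
        qed
        ultimately have "eventually (\<lambda>n. indicator (U n) z * norm (u z) powr q = norm (u z) powr q) sequentially"
          by eventually_elim (simp add: U_def)
        then show ?thesis by (rule tendsto_eventually)
      qed simp
    qed
  qed (use int in measurable)
  then have "(LBINT z. norm (u z) powr q) \<le> (2 * B) powr q"
    by (rule LIMSEQ_le_const2) (use step in auto)
  then have "(LBINT z. norm (u z) powr q) powr (1 / q) \<le> ((2 * B) powr q) powr (1 / q)"
    using q by (intro powr_mono2) auto
  also have "... = 2 * B" using q B0 by (simp add: powr_powr)
  finally show ?thesis unfolding Lnorm_def B_def .
qed

text \<open>At T = N / W the two terms are equal, hence the factor 2. As N or W may vanish, both are
  first increased by e; the right-hand side is continuous as e tends to 0 because both exponents are
  positive.\<close>

lemma le_powr_product_if_le_time: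
  fixes X C N W \<kappa> :: real
  assumes le: "\<And>T. 0 < T \<Longrightarrow> X \<le> C * ((N / T + W) * T powr \<kappa>)"
    and nn: "0 \<le> C" "0 \<le> N" "0 \<le> W" and \<kappa>: "0 < \<kappa>" "\<kappa> < 1"
  shows "X \<le> 2 * C * (W powr (1 - \<kappa>) * N powr \<kappa>)"
proof (rule tendsto_lowerbound)
  show "((\<lambda>e. 2 * C * ((W + e) powr (1 - \<kappa>) * (N + e) powr \<kappa>)) \<longlongrightarrow> 2 * C * (W powr (1 - \<kappa>) * N powr \<kappa>)) (at_right 0)"
  proof (intro tendsto_intros tendsto_powr')
    show "((\<lambda>e. W + e) \<longlongrightarrow> W) (at_right 0)" "((\<lambda>e. N + e) \<longlongrightarrow> N) (at_right 0)"
      by (auto intro!: tendsto_eq_intros)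
    show "W \<noteq> 0 \<or> 0 < 1 - \<kappa> \<and> (\<forall>\<^sub>F e in at_right 0. 0 \<le> W + e)"
      "N \<noteq> 0 \<or> 0 < \<kappa> \<and> (\<forall>\<^sub>F e in at_right 0. 0 \<le> N + e)"
      using \<kappa> nn by (auto simp: eventually_at_filter)
  qed
  show "\<forall>\<^sub>F e in at_right 0. X \<le> 2 * C * ((W + e) powr (1 - \<kappa>) * (N + e) powr \<kappa>)"
    unfolding eventually_at_filter
  proof (intro always_eventually allI impI)
    fix e :: real assume "e \<noteq> 0" "e \<in> {0<..}"
    then have e: "0 < e" "0 < N + e" "0 < W + e" using nn by auto
    define T where "T = (N + e) / (W + e)"
    have T: "0 < T" using e by (simp add: T_def)
    have "N / T + W \<le> (N + e) / T + (W + e)" using T e by (intro add_mono divide_right_mono) auto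
    also have "... = 2 * (W + e)" using e by (simp add: T_def)
    finally have le2: "(N / T + W) * T powr \<kappa> \<le> 2 * (W + e) * T powr \<kappa>" by (intro mult_right_mono) auto
    have "(W + e) * T powr \<kappa> = (W + e) powr (1 - \<kappa>) * (N + e) powr \<kappa>"
    proof -
      have "(W + e) powr (1 - \<kappa>) * (W + e) powr \<kappa> = W + e" using e by (simp flip: powr_add)
      then have "(W + e) * T powr \<kappa> = (W + e) powr (1 - \<kappa>) * ((W + e) powr \<kappa> * T powr \<kappa>)" by (simp add: mult.assoc[symmetric])
      also have "(W + e) powr \<kappa> * T powr \<kappa> = (N + e) powr \<kappa>" unfolding powr_mult[symmetric] using e by (simp add: T_def)
      finally show ?thesis .
    qed
    then have "2 * (W + e) * T powr \<kappa> = 2 * ((W + e) powr (1 - \<kappa>) * (N + e) powr \<kappa>)" by (simp only: mult.assoc)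
    with le2 have "C * ((N / T + W) * T powr \<kappa>) \<le> C * (2 * ((W + e) powr (1 - \<kappa>) * (N + e) powr \<kappa>))"
      using nn by (intro mult_left_mono) auto
    then show "X \<le> 2 * C * ((W + e) powr (1 - \<kappa>) * (N + e) powr \<kappa>)" using le[OF T] by (simp add: mult_ac)
  qed
qed simp

section \<open>Schwartz functions and the choice of exponents\<close>

lemma Lnorm_2: "Lnorm 2 u = sqrt (l2sq u)"
  unfolding Lnorm_def l2sq_def by (simp add: powr_half_sqrt)

lemma schwartz_L1_bdd:
  fixes f :: "'a::euclidean_space \<Rightarrow> complex"
  assumes u: "schwartz u" and f: "f \<in> partial_derivs u"
  shows "continuous_on UNIV f" "L1_bdd f"
proof -
  have d: "f differentiable (at z)" for z using u f by (auto simp: schwartz_def)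
  show c: "continuous_on UNIV f"
    using d by (intro continuous_at_imp_continuous_on) (auto intro: differentiable_imp_continuous_within)
  \<comment> \<open>The decay orders 0 and 2 d are combined through (1 + x)^d \<le> 2^d (1 + x^d) at
    x = |z|^2.\<close>
  obtain C0 where C0: "\<And>z. norm z ^ 0 * norm (f z) \<le> C0" using u f unfolding schwartz_def by blast
  obtain C1 where C1: "\<And>z. norm z ^ (2 * DIM('a)) * norm (f z) \<le> C1" using u f unfolding schwartz_def by blast
  show "L1_bdd f"
  proof (rule L1_bddI)
    show "f \<in> borel_measurable borel" using c by (rule borel_measurable_continuous_onI)
    show "integrable lborel (\<lambda>z::'a. 2 ^ DIM('a) * (C0 + C1) * cauchy_weight z)"
      using integrable_cauchy_weight[where 'a='a] by simp
    show "norm (f z) \<le> C0" for z using C0[of z] by simp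
    show "norm (f z) \<le> 2 ^ DIM('a) * (C0 + C1) * cauchy_weight z" for z
    proof -
      define x where "x = (norm z)\<^sup>2"
      have x: "0 \<le> x" by (simp add: x_def)
      have "(1 + x) ^ DIM('a) \<le> (2 * max 1 x) ^ DIM('a)" using x by (intro power_mono) auto
      also have "... \<le> 2 ^ DIM('a) * (1 + x ^ DIM('a))"
        using x by (cases "x \<le> 1") (auto simp: power_mult_distrib max_def)
      finally have p: "(1 + x) ^ DIM('a) \<le> 2 ^ DIM('a) * (1 + x ^ DIM('a))" .
      have "norm (f z) * 1 \<le> norm (f z) * ((1 + x) ^ DIM('a) * cauchy_weight z)"
        unfolding x_def by (intro mult_left_mono cauchy_weight_lower) auto
      also have "... = (norm (f z) * (1 + x) ^ DIM('a)) * cauchy_weight z" by simp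
      also have "... \<le> (norm (f z) * (2 ^ DIM('a) * (1 + x ^ DIM('a)))) * cauchy_weight z"
        using cauchy_weight_pos[of z] p by (intro mult_right_mono mult_left_mono) auto
      also have "norm (f z) * (2 ^ DIM('a) * (1 + x ^ DIM('a))) = 2 ^ DIM('a) * (norm z ^ 0 * norm (f z) + norm z ^ (2 * DIM('a)) * norm (f z))"
        by (simp add: x_def power_mult[symmetric] algebra_simps)
      also have "2 ^ DIM('a) * (norm z ^ 0 * norm (f z) + norm z ^ (2 * DIM('a)) * norm (f z)) * cauchy_weight z
        \<le> 2 ^ DIM('a) * (C0 + C1) * cauchy_weight z"
        using cauchy_weight_pos[of z] C0[of z] C1[of z] by (intro mult_right_mono mult_left_mono add_mono) auto
      finally show ?thesis by simp
    qed
  qed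
qed

lemma schwartz_C2_dir:
  assumes u: "schwartz u"
  shows "C2_dir u (\<lambda>b z. frechet_derivative u (at z) b) (\<lambda>b z. d2 u b z)"
proof -
  have dd: "has_dir_deriv f (\<lambda>z. frechet_derivative f (at z) b) b" if f: "f \<in> partial_derivs u" for f b
    unfolding has_dir_deriv_def
  proof
    fix z
    have "f differentiable (at z)" using u f by (auto simp: schwartz_def)
    then have D: "(f has_derivative frechet_derivative f (at z)) (at (z + 0 *\<^sub>R b))"
      by (simp add: frechet_derivative_works)
    have "((\<lambda>r. z + r *\<^sub>R b) has_derivative (\<lambda>r. r *\<^sub>R b)) (at 0)" by (auto intro!: derivative_eq_intros)
    from diff_chain_at[OF this D]
    have "((\<lambda>r. f (z + r *\<^sub>R b)) has_derivative (\<lambda>r. frechet_derivative f (at z) (r *\<^sub>R b))) (at 0)"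
      by (simp add: o_def)
    moreover have "frechet_derivative f (at z) (r *\<^sub>R b) = r *\<^sub>R frechet_derivative f (at z) b" for r
      using has_derivative_bounded_linear[OF D] by (rule linear_scale[OF bounded_linear.linear])
    ultimately show "((\<lambda>r. f (z + r *\<^sub>R b)) has_vector_derivative frechet_derivative f (at z) b) (at 0)"
      by (simp add: has_vector_derivative_def)
  qed
  have p0: "u \<in> partial_derivs u" by (rule partial_derivs.base)
  have p1: "(\<lambda>z. frechet_derivative u (at z) b) \<in> partial_derivs u" if "b \<in> Basis" for b
    by (rule partial_derivs.step[OF p0 that])
  have p2: "d2 u b \<in> partial_derivs u" if "b \<in> Basis" for b
    unfolding d2_def[abs_def] by (rule partial_derivs.step[OF p1[OF that] that])
  have "has_dir_deriv (\<lambda>z. frechet_derivative u (at z) b) (d2 u b) b" if "b \<in> Basis" for b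
    using dd[OF p1[OF that], of b] by (simp add: d2_def[abs_def])
  then show ?thesis unfolding C2_dir_def
    using dd[OF p0] schwartz_L1_bdd[OF u] p0 p1 p2 by auto
qed

lemma schwartz_Lipschitz:
  fixes u :: "'a::euclidean_space \<Rightarrow> complex"
  assumes u: "schwartz u"
  obtains L where "0 \<le> L" "\<And>x z. norm (u (x - z) - u x) \<le> L * norm z"
proof -
  have "\<exists>C. \<forall>b\<in>Basis. \<forall>z. norm (frechet_derivative u (at z) b) \<le> C b"
  proof (rule bchoice, rule ballI)
    fix b :: 'a assume "b \<in> Basis"
    then have "(\<lambda>z. frechet_derivative u (at z) b) \<in> partial_derivs u"
      by (intro partial_derivs.step partial_derivs.base)
    then have "\<forall>k::nat. \<exists>C. \<forall>z. norm z ^ k * norm (frechet_derivative u (at z) b) \<le> C"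
      using u unfolding schwartz_def by (metis (no_types, lifting))
    from this[rule_format, of 0] show "\<exists>C. \<forall>z. norm (frechet_derivative u (at z) b) \<le> C" by simp
  qed
  then obtain C where C: "\<And>b z. b \<in> Basis \<Longrightarrow> norm (frechet_derivative u (at z) b) \<le> C b" by blast
  have C0: "0 \<le> C b" if "b \<in> Basis" for b using C[OF that] norm_ge_zero order_trans by blast
  define L where "L = (\<Sum>b\<in>Basis. C b)"
  have D: "(u has_derivative frechet_derivative u (at z)) (at z)" for z
    using u partial_derivs.base[of u] by (auto simp: schwartz_def frechet_derivative_works[symmetric])
  have on: "onorm (frechet_derivative u (at z)) \<le> L" for z
  proof (rule onorm_le)
    fix v :: 'a
    interpret bounded_linear "frechet_derivative u (at z)" by (rule has_derivative_bounded_linear[OF D])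
    have "frechet_derivative u (at z) v = (\<Sum>b\<in>Basis. (v \<bullet> b) *\<^sub>R frechet_derivative u (at z) b)"
      by (subst euclidean_representation[symmetric, of v]) (simp only: sum scale)
    then have "norm (frechet_derivative u (at z) v) \<le> (\<Sum>b\<in>Basis. norm ((v \<bullet> b) *\<^sub>R frechet_derivative u (at z) b))"
      by (simp only: norm_sum)
    also have "... \<le> (\<Sum>b\<in>Basis. norm v * C b)"
      using C C0 Basis_le_norm by (intro sum_mono) (auto intro!: mult_mono)
    finally show "norm (frechet_derivative u (at z) v) \<le> L * norm v"
      by (simp only: L_def sum_distrib_right mult.commute[of "norm v"])
  qed
  show thesis
  proof (rule that[of L])
    show "0 \<le> L" unfolding L_def using C0 by (intro sum_nonneg)
    show "norm (u (x - z) - u x) \<le> L * norm z" for x z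
      using differentiable_bound[of UNIV u "\<lambda>z. frechet_derivative u (at z)" L "x - z" x] D on by simp
  qed
qed

lemma ultrahyperbolic_inequality:
  fixes sg :: "'a::euclidean_space \<Rightarrow> real" and \<kappa> :: real
  assumes sg: "\<And>b. b \<in> Basis \<Longrightarrow> (sg b)\<^sup>2 = 1"
    and \<kappa>: "1/2 \<le> \<kappa>" "\<kappa> < 1" "4 * (1 - \<kappa>) < real DIM('a)"
  shows "\<exists>C>0. \<forall>u. schwartz u \<longrightarrow>
     Lnorm (2 * real DIM('a) / (real DIM('a) - 4 + 4 * \<kappa>)) u
       \<le> C * (Lnorm 2 (\<lambda>z. \<Sum>b\<in>Basis. of_real (sg b) * d2 u b z) powr (1 - \<kappa>) * Lnorm 2 u powr \<kappa>)"
proof -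
  \<comment> \<open>\<gamma> solves 1 - d/(4 \<gamma>) = \<kappa>, so that the power of T in
    \<open>Lnorm_le_of_time\<close> is \<kappa>. Then \<kappa> \<ge> 1/2 means \<gamma> \<ge> d/2,
    and 4 (1 - \<kappa>) < d means \<gamma> > 1.\<close>
  define \<gamma> where "\<gamma> = real DIM('a) / (4 * (1 - \<kappa>))"
  define q where "q = 2 * \<gamma> / (\<gamma> - 1)"
  have d: "0 < real DIM('a)" by simp
  have \<gamma>: "1 < \<gamma>" using \<kappa> by (simp add: \<gamma>_def field_simps)
  have "real DIM('a) / 2 \<le> real DIM('a) / (4 * (1 - \<kappa>))" using \<kappa> d by (intro divide_left_mono) auto
  then have \<gamma>2: "real DIM('a) / 2 \<le> \<gamma>" by (simp only: \<gamma>_def)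
  have \<gamma>4: "4 * (1 - \<kappa>) * \<gamma> = real DIM('a)" using \<kappa> by (simp add: \<gamma>_def)
  have e: "1 - real DIM('a) / (4 * \<gamma>) = \<kappa>" using \<gamma> unfolding \<gamma>4[symmetric] by (simp add: diff_divide_distrib)
  have qq: "2 * real DIM('a) / (real DIM('a) - 4 + 4 * \<kappa>) = q"
  proof -
    have "real DIM('a) - 4 + 4 * \<kappa> = 4 * (1 - \<kappa>) * (\<gamma> - 1)" unfolding \<gamma>4[symmetric] by (simp add: algebra_simps)
    then show ?thesis unfolding q_def using \<kappa> \<gamma> \<gamma>4 by (simp add: field_simps)
  qed
  define c where "c = sqrt (curve_sum_const \<gamma> (2 powr (q - 1)))"
  have "2 < q" using \<gamma> by (simp add: q_def field_simps)
  then have c: "0 < c" unfolding c_def using curve_sum_const_pos[OF \<gamma>, of "2 powr (q - 1)"] by simp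
  show ?thesis
  \<comment> \<open>One factor 2 is the width of a dyadic level, the other comes from optimising
    T.\<close>
  proof (intro exI[of _ "2 * (2 * c)"] conjI allI impI)
    show "0 < 2 * (2 * c)" using c by simp
    fix u :: "'a \<Rightarrow> complex" assume u: "schwartz u"
    define Bu where "Bu = (\<lambda>z. \<Sum>b\<in>Basis. of_real (sg b) * d2 u b z)"
    obtain L where L: "0 \<le> L" "\<And>x z. norm (u (x - z) - u x) \<le> L * norm z" using schwartz_Lipschitz[OF u] by blast
    have "Lnorm q u \<le> 2 * (2 * c) * (Lnorm 2 Bu powr (1 - \<kappa>) * Lnorm 2 u powr \<kappa>)"
    proof (rule le_powr_product_if_le_time)
      fix T :: real assume T: "0 < T"
      have "Lnorm q u \<le> 2 * ((sqrt (l2sq u) / T + sqrt (l2sq Bu)) * sqrt (curve_sum_const \<gamma> (2 powr (q - 1))) * T powr (1 - real DIM('a) / (4 * \<gamma>)))"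
        unfolding q_def Bu_def by (rule Lnorm_le_of_time[OF _ schwartz_C2_dir[OF u] L \<gamma> \<gamma>2 T]) (rule sg)
      then show "Lnorm q u \<le> 2 * c * ((Lnorm 2 u / T + Lnorm 2 Bu) * T powr \<kappa>)"
        unfolding c_def[symmetric] e Lnorm_2 by (simp only: mult_ac)
    qed (use c \<kappa> in \<open>auto simp: Lnorm_2\<close>)
    then show "Lnorm (2 * real DIM('a) / (real DIM('a) - 4 + 4 * \<kappa>)) u
       \<le> 2 * (2 * c) * (Lnorm 2 (\<lambda>z. \<Sum>b\<in>Basis. of_real (sg b) * d2 u b z) powr (1 - \<kappa>) * Lnorm 2 u powr \<kappa>)"
      unfolding qq Bu_def .
  qed
qed

theorem theorem7p1:
  fixes \<kappa> :: real
  assumes "if DIM('a::euclidean_space) + 1 \<ge> 3 then 1/2 \<le> \<kappa> \<and> \<kappa> \<le> 1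
           else 1/2 < \<kappa> \<and> \<kappa> \<le> 1"
  shows "\<exists>C>0. \<forall>u :: 'a \<times> real \<Rightarrow> complex. schwartz u \<longrightarrow>
           Lnorm (2 * real (DIM('a) + 1) / (real (DIM('a) + 1) - 4 + 4 * \<kappa>)) u
             \<le> C * rpow (Lnorm 2 (wave u)) (1 - \<kappa>) * rpow (Lnorm 2 u) \<kappa>"
proof (cases "\<kappa> = 1")
  case True
  \<comment> \<open>At \<kappa> = 1 the exponent is 2 and \<open>rpow\<close> with exponent 0 is 1,
    so both sides are the same norm.\<close>
  then have "2 * real (DIM('a) + 1) / (real (DIM('a) + 1) - 4 + 4 * \<kappa>) = 2" by (simp add: field_simps)
  then show ?thesis using True by (intro exI[of _ 1]) (simp add: rpow_def Lnorm_2)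
next
  case False
  \<comment> \<open>A basis vector of the product has exactly one zero component, so a vanishing
    spatial part identifies the time direction.\<close>
  define sg :: "'a \<times> real \<Rightarrow> real" where "sg = (\<lambda>p. if fst p = 0 then 1 else - 1)"
  have dim: "DIM('a \<times> real) = DIM('a) + 1" by simp
  have d: "1 \<le> real DIM('a)" using DIM_positive[where 'a='a] by linarith
  have \<kappa>01: "1/2 \<le> \<kappa>" "\<kappa> < 1" using assms False by (auto split: if_splits)
  \<comment> \<open>For d \<ge> 3 the left side is at most 2. For d = 2 strictness is exactly
    \<kappa> > 1/2; at \<kappa> = 1/2 one would have \<gamma> = 1 and divergent tail
    integrals.\<close>
  have "4 * (1 - \<kappa>) < real (DIM('a) + 1)"
  proof (cases "DIM('a) + 1 \<ge> 3")
    case True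
    then have "2 \<le> real DIM('a)" by linarith
    then show ?thesis using \<kappa>01 by simp
  next
    case False
    then have "1/2 < \<kappa>" using assms by simp
    moreover have "real (DIM('a) + 1) = real DIM('a) + 1" by simp
    ultimately show ?thesis using d by argo
  qed
  with \<kappa>01 have \<kappa>: "1/2 \<le> \<kappa>" "\<kappa> < 1" "4 * (1 - \<kappa>) < real DIM('a \<times> real)"
    unfolding dim by auto
  have sg: "(sg b)\<^sup>2 = 1" for b by (simp add: sg_def)
  have wave: "wave u = (\<lambda>z. \<Sum>b\<in>Basis. of_real (sg b) * d2 u b z)" for u :: "'a \<times> real \<Rightarrow> complex"
  proof
    fix z
    have "(\<Sum>b\<in>Basis. of_real (sg b) * d2 u b z)
      = (\<Sum>b\<in>(\<lambda>a. (a, 0)) ` Basis. of_real (sg b) * d2 u b z) + (\<Sum>b\<in>{(0, 1)}. of_real (sg b) * d2 u b z)"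
      unfolding Basis_prod_def by (subst sum.union_disjoint) auto
    also have "(\<Sum>b\<in>(\<lambda>a. (a, 0)) ` Basis. of_real (sg b) * d2 u b z) = - (\<Sum>b\<in>Basis. d2 u (b, 0) z)"
      by (subst sum.reindex) (auto simp: inj_on_def sg_def sum_negf[symmetric] intro!: sum.cong)
    finally show "wave u z = (\<Sum>b\<in>Basis. of_real (sg b) * d2 u b z)" by (simp add: wave_def sg_def)
  qed
  \<comment> \<open>Both exponents are nonzero here, so \<open>rpow\<close> coincides with
    \<open>powr\<close>.\<close>
  show ?thesis
    using ultrahyperbolic_inequality[OF sg \<kappa>] \<kappa> unfolding wave rpow_def dim by (simp add: mult.assoc)
qed

end
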